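(* Let $p$ be a prime. Let $A$ be a $p$-normal ring and let $R=A[p^{-1}]$, equipped with the $p$-adic seminorm for $A$. Suppose that $A$ is Witt-perfect at $p$ and $p$-adically complete. Let $A'$ be the inverse limit of $A/(p)$ under the $p$-power Frobenius endomorphism, and let $R'$ be the inverse limit of $R$ under the $p$-power map, with its natural ring structure and power-multiplicative seminorm. For any $b>0$, the natural map $A'\to R'$ induces an embedding of $\underleftarrow{W}(A')$ into $\underleftarrow{W}^b(R')$, and for $0<b\le1$, the natural isomorphism $\underleftarrow{W}(A')\cong\underleftarrow{W}(A)$ extends to an isometric isomorphism $\underleftarrow{W}^b(R')\cong\underleftarrow{W}^b(R)$ (for the seminorms $|\bullet|_{W,b}$).
   Context: All rings are commutative and unital; $p$-adically complete includes $p$-adically separated. A ring $A$ is $p$-normal if it is $p$-torsion-free and integrally closed in $A[p^{-1}]$. The $p$-adic seminorm on $A[p^{-1}]$ is given by letting $|x|$ be the infimum of $p^{-c/d}$ over $c,d\in\mathbb{Z}$ with $d>0$ and $p^{-c}x^d\in A$. $W$ is the functor of $p$-typical Witt vectors with components $(x_1,x_p,x_{p^2},\dots)$; $W_{p^n}(R)$ is the truncation with components $(x_1,\dots,x_{p^n})$ (so $W_1(R)=R$). The Frobenius $F$ is the natural ring homomorphism determined on ghost components $w_{p^n}=\sum_{0\le i\le n}p^ix_{p^i}^{p^{n-i}}$ by $w_{p^n}\circ F=w_{p^{n+1}}$, inducing $F:W_{p^{n+1}}(R)\to W_{p^n}(R)$. $A$ is Witt-perfect at $p$ if $F:W_{p^{n+1}}(A)\to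 W_{p^n}(A)$ is surjective for all positive integers $n$. $\underleftarrow{W}(R)$ is the inverse limit of the $W_{p^n}(R)$, $n\ge0$, along $F$, with elements $\underline{x}=(\underline{x}_{p^{-n}})_{n\ge0}$, $\underline{x}_{p^{-n}}\in W_{p^n}(R)$. For a ring with a submultiplicative nonarchimedean seminorm, on $W_{p^r}$ put $|(x_{p^n})_{0\le n\le r}|_W=\sup\{|x_{p^n}|^{1/p^n}:0\le n\le r\}$. For $b>0$, $\underleftarrow{W}^b(R)$ is the set of $\underline{x}\in\underleftarrow{W}(R)$ with $p^{-bn}|\underline{x}_{p^{-n}}|_W^{p^n}\to0$ as $n\to\infty$, with seminorm $|\underline{x}|_{W,b}=\sup_n\{p^{-bn}|\underline{x}_{p^{-n}}|_W^{p^n}\}$. The ring $R'$: its elements are sequences $(x_{p^{-m}})_{m\ge0}$ in $R$ with $x_{p^{-m-1}}^p=x_{p^{-m}}$; multiplication is termwise, the sum of $(x_{p^{-m}})$ and $(y_{p^{-m}})$ is $(z_{p^{-m}})$ with $z_{p^{-m}}=\lim_{l\to\infty}(x_{p^{-m-l}}+y_{p^{-m-l}})^{p^l}$, and the seminorm is $|(x_{p^{-m}})|:=|x_1|$. The ring $R'$ has characteristic $p$. The natural map $A'\to R'$ identifies $A'$ with the subring of those sequences in $R'$ with $x_1\in A$: the sequence $(x_{p^{-m}})_m$ corresponds to the sequence of its reductions modulo $p$ in $A'$. The natural isomorphism $\underleftarrow{W}(A')\cong\underleftarrow{W}(A)$ is the composition of the isomorphism $\underleftarrow{W}(A')\to\underleftarrow{W}(A/(p))$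 induced by the projection of $A'$ onto the final term $A/(p)$ of the inverse system with the inverse of the isomorphism $\underleftarrow{W}(A)\to\underleftarrow{W}(A/(p))$ induced by reduction modulo $p$. *)

theory Defs
  imports
    Complex_Main
    "HOL-Computational_Algebra.Primes"
    "HOL-Library.Poly_Mapping"
    "HOL-Algebra.QuotRing"
    "HOL-Algebra.Subrings"
begin

section \<open>The rings \<open>A\<close> and \<open>R = A[1/p]\<close>\<close>

text \<open>The element \<open>p = p \<cdot> 1\<close> of a ring.\<close>

definition p_elem :: "nat \<Rightarrow> ('a, 'm) ring_scheme \<Rightarrow> 'a" where
  "p_elem p R = [p] \<cdot>\<^bsub>R\<^esub> \<one>\<^bsub>R\<^esub>"

text \<open>
  \<open>R = A[1/p]\<close>, for \<open>p\<close>-torsion-free \<open>A\<close>. In that case the localization map is injective, and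
  \<open>A\<close> is regarded as a subring of \<open>R\<close>, with operations restricted from \<open>R\<close>.
\<close>

definition is_inverting_p ::
    "nat \<Rightarrow> ('a, 'm) ring_scheme \<Rightarrow> ('a, 'm) ring_scheme \<Rightarrow> bool" where
  "is_inverting_p p A R \<longleftrightarrow>
     cring R \<and> subring (carrier A) R \<and> A = R\<lparr>carrier := carrier A\<rparr> \<and>
     p_elem p R \<in> Units R \<and>
     (\<forall>x \<in> carrier R. \<exists>n::nat. p_elem p R [^]\<^bsub>R\<^esub> n \<otimes>\<^bsub>R\<^esub> x \<in> carrier A)"

definition integral_over ::
    "('a, 'm) ring_scheme \<Rightarrow> ('a, 'm) ring_scheme \<Rightarrow> 'a \<Rightarrow> bool" where
  "integral_over A R x \<longleftrightarrow>
     (\<exists>(n::nat) a. (\<forall>i<n. a i \<in> carrier A) \<and>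
        x [^]\<^bsub>R\<^esub> n \<oplus>\<^bsub>R\<^esub> (\<Oplus>\<^bsub>R\<^esub>i\<in>{..<n}. a i \<otimes>\<^bsub>R\<^esub> x [^]\<^bsub>R\<^esub> i) = \<zero>\<^bsub>R\<^esub>)"

text \<open>Here \<open>R\<close> is meant to be \<open>A[1/p]\<close>.\<close>

definition p_normal ::
    "nat \<Rightarrow> ('a, 'm) ring_scheme \<Rightarrow> ('a, 'm) ring_scheme \<Rightarrow> bool" where
  "p_normal p A R \<longleftrightarrow>
     (\<forall>a \<in> carrier A. [p] \<cdot>\<^bsub>A\<^esub> a = \<zero>\<^bsub>A\<^esub> \<longrightarrow> a = \<zero>\<^bsub>A\<^esub>) \<and>
     (\<forall>x \<in> carrier R. integral_over A R x \<longrightarrow> x \<in> carrier A)"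

text \<open>
  Bijectivity of the map from \<open>A\<close> to the inverse limit of the rings \<open>A/(p\<^sup>n)\<close>: every compatible
  system of residues, represented by a sequence \<open>a\<close>, comes from a unique element of \<open>A\<close>
  (uniqueness being \<open>p\<close>-adic separatedness).
\<close>

definition p_adically_complete :: "nat \<Rightarrow> ('a, 'm) ring_scheme \<Rightarrow> bool" where
  "p_adically_complete p A \<longleftrightarrow>
     (\<forall>a :: nat \<Rightarrow> 'a.
        (\<forall>n. a n \<in> carrier A) \<and>
        (\<forall>n. a (Suc n) \<ominus>\<^bsub>A\<^esub> a n \<in> PIdl\<^bsub>A\<^esub> (p_elem p A [^]\<^bsub>A\<^esub> n)) \<longrightarrow>
        (\<exists>!x. x \<in> carrier A \<and>
           (\<forall>n. x \<ominus>\<^bsub>A\<^esub> a n \<in> PIdl\<^bsub>A\<^esub> (p_elem p A [^]\<^bsub>A\<^esub> n))))"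

definition p_adic_seminorm ::
    "nat \<Rightarrow> ('a, 'm) ring_scheme \<Rightarrow> ('a, 'm) ring_scheme \<Rightarrow> 'a \<Rightarrow> real" where
  "p_adic_seminorm p A R x =
     Inf {real p powr (- (real_of_int c / real d)) | (c::int) (d::nat).
            d > 0 \<and> p_elem p R [^]\<^bsub>R\<^esub> (- c) \<otimes>\<^bsub>R\<^esub> x [^]\<^bsub>R\<^esub> d \<in> carrier A}"


section \<open>Witt vectors\<close>

text \<open>Polynomials over the integers in variables indexed by \<open>'v\<close>.\<close>

type_synonym 'v zpoly = "('v \<Rightarrow>\<^sub>0 nat) \<Rightarrow>\<^sub>0 int"

definition X :: "'v \<Rightarrow> 'v zpoly" where
  "X v = Poly_Mapping.single (Poly_Mapping.single v 1) 1"

definition zpoly_eval :: "('a, 'm) ring_scheme \<Rightarrow> ('v \<Rightarrow> 'a) \<Rightarrow> 'v zpoly \<Rightarrow> 'a" where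
  "zpoly_eval R a P =
     (\<Oplus>\<^bsub>R\<^esub>m\<in>Poly_Mapping.keys P.
        [Poly_Mapping.lookup P m] \<cdot>\<^bsub>R\<^esub>
          (\<Otimes>\<^bsub>R\<^esub>v\<in>Poly_Mapping.keys m. a v [^]\<^bsub>R\<^esub> Poly_Mapping.lookup m v))"

text \<open>
  Throughout, index \<open>n\<close> stands for the subscript \<open>p\<^sup>n\<close> (or \<open>p\<^sup>-\<^sup>n\<close> in inverse limits).
\<close>

definition ghost :: "nat \<Rightarrow> (nat \<Rightarrow> 'v zpoly) \<Rightarrow> nat \<Rightarrow> 'v zpoly" where
  "ghost p x n = (\<Sum>i\<le>n. of_nat (p ^ i) * x i ^ (p ^ (n - i)))"

text \<open>
  The universal polynomials with prescribed ghost components. The ghost map is injective over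
  the torsion-free ring of integer polynomials, and each of the three families of ghost components
  used below is in its image.
\<close>

definition with_ghost :: "nat \<Rightarrow> (nat \<Rightarrow> 'v zpoly) \<Rightarrow> nat \<Rightarrow> 'v zpoly" where
  "with_ghost p g = (THE S. \<forall>n. ghost p S n = g n)"

text \<open>The variables \<open>Inl i\<close> and \<open>Inr i\<close> are the components of the first and second operand.\<close>

definition witt_add_poly :: "nat \<Rightarrow> nat \<Rightarrow> (nat + nat) zpoly" where
  "witt_add_poly p =
     with_ghost p (\<lambda>n. ghost p (\<lambda>i. X (Inl i)) n + ghost p (\<lambda>i. X (Inr i)) n)"

definition witt_mult_poly :: "nat \<Rightarrow> nat \<Rightarrow> (nat + nat) zpoly" where
  "witt_mult_poly p =
     with_ghost p (\<lambda>n. ghost p (\<lambda>i. X (Inl i)) n * ghost p (\<lambda>i. X (Inr i)) n)"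

definition witt_frob_poly :: "nat \<Rightarrow> nat \<Rightarrow> nat zpoly" where
  "witt_frob_poly p = with_ghost p (\<lambda>n. ghost p X (Suc n))"

text \<open>
  \<open>witt p R n\<close> is the truncation with the \<open>n + 1\<close> components of index \<open>0, \<dots>, n\<close>. The \<open>k\<close>-th
  addition and multiplication polynomials involve only components of index at most \<open>k\<close>, and the
  \<open>k\<close>-th Frobenius polynomial only those of index at most \<open>k + 1\<close>.
\<close>

definition witt :: "nat \<Rightarrow> ('a, 'm) ring_scheme \<Rightarrow> nat \<Rightarrow> (nat \<Rightarrow> 'a) ring" where
  "witt p R n =
     \<lparr>carrier = {..n} \<rightarrow>\<^sub>E carrier R,
      mult = (\<lambda>x y. \<lambda>k\<in>{..n}. zpoly_eval R (case_sum x y) (witt_mult_poly p k)),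
      one = (\<lambda>k\<in>{..n}. if k = 0 then \<one>\<^bsub>R\<^esub> else \<zero>\<^bsub>R\<^esub>),
      zero = (\<lambda>k\<in>{..n}. \<zero>\<^bsub>R\<^esub>),
      add = (\<lambda>x y. \<lambda>k\<in>{..n}. zpoly_eval R (case_sum x y) (witt_add_poly p k))\<rparr>"

text \<open>\<open>witt_F p R n\<close> maps \<open>witt p R (n + 1)\<close> to \<open>witt p R n\<close>.\<close>

definition witt_F :: "nat \<Rightarrow> ('a, 'm) ring_scheme \<Rightarrow> nat \<Rightarrow> (nat \<Rightarrow> 'a) \<Rightarrow> (nat \<Rightarrow> 'a)" where
  "witt_F p R n x = (\<lambda>k\<in>{..n}. zpoly_eval R x (witt_frob_poly p k))"

definition witt_perfect :: "nat \<Rightarrow> ('a, 'm) ring_scheme \<Rightarrow> bool" where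
  "witt_perfect p A \<longleftrightarrow>
     (\<forall>n\<ge>1. witt_F p A n ` carrier (witt p A (Suc n)) = carrier (witt p A n))"

text \<open>The inverse limit of the truncations along \<open>F\<close>.\<close>

definition witt_lim :: "nat \<Rightarrow> ('a, 'm) ring_scheme \<Rightarrow> (nat \<Rightarrow> nat \<Rightarrow> 'a) ring" where
  "witt_lim p R =
     \<lparr>carrier = {x. \<forall>n. x n \<in> carrier (witt p R n) \<and> witt_F p R n (x (Suc n)) = x n},
      mult = (\<lambda>x y n. x n \<otimes>\<^bsub>witt p R n\<^esub> y n),
      one = (\<lambda>n. \<one>\<^bsub>witt p R n\<^esub>),
      zero = (\<lambda>n. \<zero>\<^bsub>witt p R n\<^esub>),
      add = (\<lambda>x y n. x n \<oplus>\<^bsub>witt p R n\<^esub> y n)\<rparr>"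

definition witt_lim_map :: "('a \<Rightarrow> 'b) \<Rightarrow> (nat \<Rightarrow> nat \<Rightarrow> 'a) \<Rightarrow> (nat \<Rightarrow> nat \<Rightarrow> 'b)" where
  "witt_lim_map f x = (\<lambda>n. \<lambda>k\<in>{..n}. f (x n k))"

text \<open>In what follows \<open>\<nu>\<close> is a seminorm on the base ring.\<close>

definition witt_norm :: "nat \<Rightarrow> ('a \<Rightarrow> real) \<Rightarrow> nat \<Rightarrow> (nat \<Rightarrow> 'a) \<Rightarrow> real" where
  "witt_norm p \<nu> r x = (SUP n\<in>{..r}. root (p ^ n) (\<nu> (x n)))"

definition witt_lim_term ::
    "nat \<Rightarrow> real \<Rightarrow> ('a \<Rightarrow> real) \<Rightarrow> (nat \<Rightarrow> nat \<Rightarrow> 'a) \<Rightarrow> nat \<Rightarrow> real" where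
  "witt_lim_term p b \<nu> x n = real p powr (- b * real n) * witt_norm p \<nu> n (x n) ^ (p ^ n)"

definition witt_lim_b ::
    "nat \<Rightarrow> real \<Rightarrow> ('a, 'm) ring_scheme \<Rightarrow> ('a \<Rightarrow> real) \<Rightarrow> (nat \<Rightarrow> nat \<Rightarrow> 'a) ring" where
  "witt_lim_b p b R \<nu> =
     (witt_lim p R)\<lparr>carrier :=
        {x \<in> carrier (witt_lim p R). witt_lim_term p b \<nu> x \<longlonglongrightarrow> 0}\<rparr>"

definition witt_lim_norm ::
    "nat \<Rightarrow> real \<Rightarrow> ('a \<Rightarrow> real) \<Rightarrow> (nat \<Rightarrow> nat \<Rightarrow> 'a) \<Rightarrow> real" where
  "witt_lim_norm p b \<nu> x = (SUP n. witt_lim_term p b \<nu> x n)"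


section \<open>The rings \<open>A'\<close> and \<open>R'\<close>\<close>

definition mod_p :: "nat \<Rightarrow> ('a, 'm) ring_scheme \<Rightarrow> 'a set ring" where
  "mod_p p A = A Quot (PIdl\<^bsub>A\<^esub> (p_elem p A))"

definition red_p :: "nat \<Rightarrow> ('a, 'm) ring_scheme \<Rightarrow> 'a \<Rightarrow> 'a set" where
  "red_p p A a = (PIdl\<^bsub>A\<^esub> (p_elem p A)) +>\<^bsub>A\<^esub> a"

definition p_power_seqs :: "nat \<Rightarrow> ('a, 'm) ring_scheme \<Rightarrow> (nat \<Rightarrow> 'a) set" where
  "p_power_seqs p S = {x. \<forall>m. x m \<in> carrier S \<and> x (Suc m) [^]\<^bsub>S\<^esub> p = x m}"

text \<open>\<open>A'\<close>: the inverse limit of \<open>A/(p)\<close> under Frobenius, with termwise operations.\<close>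

definition A_prime :: "nat \<Rightarrow> ('a, 'm) ring_scheme \<Rightarrow> (nat \<Rightarrow> 'a set) ring" where
  "A_prime p A =
     \<lparr>carrier = p_power_seqs p (mod_p p A),
      mult = (\<lambda>x y m. x m \<otimes>\<^bsub>mod_p p A\<^esub> y m),
      one = (\<lambda>m. \<one>\<^bsub>mod_p p A\<^esub>),
      zero = (\<lambda>m. \<zero>\<^bsub>mod_p p A\<^esub>),
      add = (\<lambda>x y m. x m \<oplus>\<^bsub>mod_p p A\<^esub> y m)\<rparr>"

definition seq_lim :: "('a, 'm) ring_scheme \<Rightarrow> ('a \<Rightarrow> real) \<Rightarrow> (nat \<Rightarrow> 'a) \<Rightarrow> 'a" where
  "seq_lim R \<nu> s = (THE z. z \<in> carrier R \<and> (\<lambda>l. \<nu> (s l \<ominus>\<^bsub>R\<^esub> z)) \<longlonglongrightarrow> 0)"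

text \<open>\<open>R'\<close>, for a ring \<open>R\<close> with seminorm \<open>\<nu>\<close>.\<close>

definition R_prime ::
    "nat \<Rightarrow> ('a, 'm) ring_scheme \<Rightarrow> ('a \<Rightarrow> real) \<Rightarrow> (nat \<Rightarrow> 'a) ring" where
  "R_prime p R \<nu> =
     \<lparr>carrier = p_power_seqs p R,
      mult = (\<lambda>x y m. x m \<otimes>\<^bsub>R\<^esub> y m),
      one = (\<lambda>m. \<one>\<^bsub>R\<^esub>),
      zero = (\<lambda>m. \<zero>\<^bsub>R\<^esub>),
      add = (\<lambda>x y m. seq_lim R \<nu> (\<lambda>l. (x (m + l) \<oplus>\<^bsub>R\<^esub> y (m + l)) [^]\<^bsub>R\<^esub> (p ^ l)))\<rparr>"

definition R_prime_norm :: "('a \<Rightarrow> real) \<Rightarrow> (nat \<Rightarrow> 'a) \<Rightarrow> real" where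
  "R_prime_norm \<nu> x = \<nu> (x 0)"

text \<open>
  The natural map from \<open>A'\<close> to \<open>R'\<close>: termwise reduction modulo \<open>p\<close> identifies the sequences in
  \<open>R'\<close> whose term of index \<open>0\<close> is in \<open>A\<close> (so that all terms are in \<open>A\<close>, by \<open>p\<close>-normality) with
  the elements of \<open>A'\<close>, and the map is the inverse of this.
\<close>

definition A_prime_to_R_prime ::
    "nat \<Rightarrow> ('a, 'm) ring_scheme \<Rightarrow> ('a, 'm) ring_scheme \<Rightarrow> (nat \<Rightarrow> 'a set) \<Rightarrow> (nat \<Rightarrow> 'a)" where
  "A_prime_to_R_prime p A R y =
     (THE x. x \<in> p_power_seqs p R \<and> x 0 \<in> carrier A \<and> (\<forall>m. red_p p A (x m) = y m))"

text \<open>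
  The natural isomorphism from \<open>witt_lim p (A_prime p A)\<close> to \<open>witt_lim p A\<close>; both factors are
  the maps to \<open>witt_lim p (mod_p p A)\<close> induced by ring homomorphisms to \<open>A/(p)\<close>.
\<close>

definition witt_lim_iso ::
    "nat \<Rightarrow> ('a, 'm) ring_scheme \<Rightarrow> (nat \<Rightarrow> nat \<Rightarrow> nat \<Rightarrow> 'a set) \<Rightarrow> (nat \<Rightarrow> nat \<Rightarrow> 'a)" where
  "witt_lim_iso p A x =
     inv_into (carrier (witt_lim p A)) (witt_lim_map (red_p p A)) (witt_lim_map (\<lambda>y. y 0) x)"

end

theory Submission
  imports Defs
begin

text \<open>
  A Witt vector over \<open>R\<close> is determined by its ghost components, as \<open>p\<close> is invertible in \<open>R\<close>, and \<open>F\<close>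
  shifts these. Hence an element \<open>x\<close> of the inverse limit over \<open>R\<close> amounts to the sequence of first
  components \<open>x\<^sub>m\<^sub>,\<^sub>0\<close>: the ghost component of index \<open>k\<close> of \<open>x\<^sub>n\<close> is \<open>x\<^sub>n\<^sub>-\<^sub>k\<^sub>,\<^sub>0\<close>. In \<open>R'\<close>, which is
  perfect of characteristic \<open>p\<close>, \<open>F\<close> raises components to the power \<open>p\<close>, so an element \<open>z\<close> of the
  inverse limit over \<open>R'\<close> amounts to the first entries \<open>y\<^sub>n\<^sub>,\<^sub>k\<close> of its components \<open>z\<^sub>n\<^sub>,\<^sub>k\<close>, which are
  elements of \<open>R\<close> with \<open>y\<^sub>n\<^sub>+\<^sub>1\<^sub>,\<^sub>k\<^sup>p = y\<^sub>n\<^sub>,\<^sub>k\<close>. The isomorphism takes \<open>z\<close> to the \<open>x\<close> with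
  \<open>x\<^sub>m\<^sub>,\<^sub>0 = y\<^sub>m\<^sub>,\<^sub>0 + p y\<^sub>m\<^sub>+\<^sub>1\<^sub>,\<^sub>1 + p\<^sup>2 y\<^sub>m\<^sub>+\<^sub>2\<^sub>,\<^sub>2 + \<dots>\<close>. The partial sum of the first \<open>k + 1\<close> terms is the ghost
  component of index \<open>k\<close> of the vector \<open>(y\<^sub>m\<^sub>+\<^sub>k\<^sub>,\<^sub>0, y\<^sub>m\<^sub>+\<^sub>k\<^sub>,\<^sub>1, \<dots>)\<close>, so that \<open>x\<^sub>n\<close> and \<open>y\<^sub>n\<close> have almost the
  same ghost components.

  Convergence and isometry come from a quantitative form of Dwork's congruences: if the ghost
  components of index \<open>k\<close> of two Witt vectors differ by at most \<open>d\<^sub>k p\<^sup>-\<^sup>k\<^sup>-\<^sup>1\<close>, where the \<open>d\<^sub>k\<close> bound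
  the components of one of them and are compatible with the weights \<open>p\<^sup>k\<close>, then the components
  differ by at most \<open>d\<^sub>k / p\<close> (\<open>N_diff_of_ghost_sum\<close>). The growth condition gives bounds
  \<open>|y\<^sub>n\<^sub>,\<^sub>k|\<close> to the \<open>p\<^sup>n\<^sup>-\<^sup>k\<close> at most \<open>G\<^sub>k\<close>, where \<open>G\<^sub>k = o(p\<^sup>b\<^sup>k)\<close>; this is where \<open>b \<le> 1\<close> enters, as the
  series converges because \<open>G\<^sub>k = o(p\<^sup>k)\<close>. One may choose \<open>G\<close> increasing with \<open>G\<^sub>k\<^sub>+\<^sub>1 \<le> p\<^sup>b G\<^sub>k\<close>
  without enlarging the seminorm (\<open>envelope_exists\<close>). The comparison of \<open>x\<^sub>n\<close> with \<open>y\<^sub>n\<close> then shows that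
  \<open>x\<close> obeys the same bounds (\<open>rel_bnd\<close>). Conversely, comparing \<open>x\<^sub>n\<close> with the vector of \<open>p\<close>-th
  powers of the components of \<open>x\<^sub>n\<^sub>+\<^sub>1\<close> shows that the powers of \<open>x\<^sub>n\<^sub>+\<^sub>M\<^sub>,\<^sub>k\<close> to the \<open>p\<^sup>M\<close> converge as \<open>M\<close>
  increases; the limits \<open>y\<^sub>n\<^sub>,\<^sub>k\<close> again obey the bounds, and they give back \<open>x\<close> (\<open>rel_exists_y\<close>).
  Since neither direction increases the seminorm, both preserve it.

  Sums and products over \<open>R\<close> and over \<open>R'\<close> are computed with the same Witt polynomials, and entries of
  elements of \<open>R'\<close> are limits of \<open>p\<close>-power powers of entries computed in \<open>R\<close>. So compatibility with the
  ring operations is an exchange of this limit with the summation. It is immediate when only finitely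
  many components are nonzero (\<open>rel_op\<close>), and in general the tails have to be estimated. For sums the
  homogeneity of the Witt polynomials suffices; for products one uses in addition that in
  characteristic \<open>p\<close> components of index \<open>i\<close> and \<open>j\<close> contribute only to components of index \<open>i + j\<close> and
  higher (\<open>N_witt_mult_char_p\<close>).

  On the image of the inverse limit over \<open>A'\<close>, the comparison of \<open>x\<^sub>n\<close> with \<open>y\<^sub>n\<close> can be made with
  congruences instead of seminorms, and gives \<open>x\<^sub>n\<^sub>,\<^sub>k \<equiv> y\<^sub>n\<^sub>,\<^sub>k\<close> modulo \<open>p A\<close> (\<open>corr_integral\<close>). This is the
  condition that characterizes the natural isomorphism.

  All estimates are carried out in a polynomial ring over the integers that maps onto \<open>R\<close>, with the
  seminorm pulled back. Elements with the same image are then at distance zero, and conversely,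
  because \<open>A\<close> is \<open>p\<close>-adically separated.
\<close>

section \<open>Evaluation of integer polynomials\<close>

definition mono_eval :: "('a, 'm) ring_scheme \<Rightarrow> ('v \<Rightarrow> 'a) \<Rightarrow> ('v \<Rightarrow>\<^sub>0 nat) \<Rightarrow> 'a" where
  "mono_eval R f m = (\<Otimes>\<^bsub>R\<^esub>v\<in>Poly_Mapping.keys m. f v [^]\<^bsub>R\<^esub> Poly_Mapping.lookup m v)"

lemma zpoly_eval_mono_eval:
  "zpoly_eval R f P = (\<Oplus>\<^bsub>R\<^esub>m\<in>Poly_Mapping.keys P. [Poly_Mapping.lookup P m] \<cdot>\<^bsub>R\<^esub> mono_eval R f m)"
  by (simp add: zpoly_eval_def mono_eval_def)

lemma add_pow_int_0: "[(0::int)] \<cdot>\<^bsub>R\<^esub> x = \<zero>\<^bsub>R\<^esub>"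
  by (simp add: add_pow_def)

context cring
begin

context
  fixes f :: "'v \<Rightarrow> 'a"
  assumes f: "\<And>v. f v \<in> carrier R"
begin

lemma mono_eval_closed: "mono_eval R f m \<in> carrier R"
  unfolding mono_eval_def by (intro finprod_closed) (auto simp: f)

lemma mono_eval_superset:
  assumes "finite K" "Poly_Mapping.keys m \<subseteq> K"
  shows "mono_eval R f m = (\<Otimes>v\<in>K. f v [^] Poly_Mapping.lookup m v)"
  unfolding mono_eval_def
  by (rule finprod_mono_neutral_cong_left) (use assms in \<open>auto simp: f in_keys_iff\<close>)

lemma mono_eval_add: "mono_eval R f (m + m') = mono_eval R f m \<otimes> mono_eval R f m'"
proof -
  let ?K = "Poly_Mapping.keys m \<union> Poly_Mapping.keys m'"
  have "mono_eval R f (m + m') = (\<Otimes>v\<in>?K. f v [^] Poly_Mapping.lookup (m + m') v)"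
    by (rule mono_eval_superset) (use keys_add[of m m'] in auto)
  also have "\<dots> = (\<Otimes>v\<in>?K. f v [^] Poly_Mapping.lookup m v \<otimes> f v [^] Poly_Mapping.lookup m' v)"
    by (rule finprod_cong') (auto simp: f lookup_add nat_pow_mult)
  also have "\<dots> = (\<Otimes>v\<in>?K. f v [^] Poly_Mapping.lookup m v) \<otimes> (\<Otimes>v\<in>?K. f v [^] Poly_Mapping.lookup m' v)"
    by (rule finprod_multf) (auto simp: f)
  also have "\<dots> = mono_eval R f m \<otimes> mono_eval R f m'"
    by (simp add: mono_eval_superset[of ?K])
  finally show ?thesis .
qed

lemma zpoly_eval_closed: "zpoly_eval R f P \<in> carrier R"
  unfolding zpoly_eval_mono_eval
  by (intro finsum_closed) (auto simp: mono_eval_closed add.int_pow_closed)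

lemma zpoly_eval_superset:
  assumes "finite K" "Poly_Mapping.keys P \<subseteq> K"
  shows "zpoly_eval R f P = (\<Oplus>m\<in>K. [Poly_Mapping.lookup P m] \<cdot> mono_eval R f m)"
  unfolding zpoly_eval_mono_eval
  by (rule add.finprod_mono_neutral_cong_left)
    (use assms in \<open>auto simp: mono_eval_closed in_keys_iff add_pow_int_0\<close>)

lemma zpoly_eval_add: "zpoly_eval R f (P + Q) = zpoly_eval R f P \<oplus> zpoly_eval R f Q"
proof -
  let ?K = "Poly_Mapping.keys P \<union> Poly_Mapping.keys Q"
  have "zpoly_eval R f (P + Q) = (\<Oplus>m\<in>?K. [Poly_Mapping.lookup (P + Q) m] \<cdot> mono_eval R f m)"
    by (rule zpoly_eval_superset) (use keys_add[of P Q] in auto)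
  also have "\<dots> = (\<Oplus>m\<in>?K. [Poly_Mapping.lookup P m] \<cdot> mono_eval R f m
      \<oplus> [Poly_Mapping.lookup Q m] \<cdot> mono_eval R f m)"
    by (rule finsum_cong') (auto simp: mono_eval_closed lookup_add add.int_pow_mult)
  also have "\<dots> = (\<Oplus>m\<in>?K. [Poly_Mapping.lookup P m] \<cdot> mono_eval R f m)
      \<oplus> (\<Oplus>m\<in>?K. [Poly_Mapping.lookup Q m] \<cdot> mono_eval R f m)"
    by (rule finsum_addf) (auto simp: mono_eval_closed)
  also have "\<dots> = zpoly_eval R f P \<oplus> zpoly_eval R f Q"
    by (simp add: zpoly_eval_superset[of ?K])
  finally show ?thesis .
qed

lemma zpoly_eval_0: "zpoly_eval R f 0 = \<zero>"
  by (simp add: zpoly_eval_mono_eval)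

lemma zpoly_eval_uminus: "zpoly_eval R f (- P) = \<ominus> zpoly_eval R f P"
proof -
  have "zpoly_eval R f (- P) \<oplus> zpoly_eval R f P = \<zero>"
    using zpoly_eval_add[of "- P" P] by (simp add: zpoly_eval_0)
  thus ?thesis
    using minus_equality zpoly_eval_closed by metis
qed

lemma zpoly_eval_diff: "zpoly_eval R f (P - Q) = zpoly_eval R f P \<ominus> zpoly_eval R f Q"
  using zpoly_eval_add[of P "- Q"] by (simp add: zpoly_eval_uminus a_minus_def)

lemma zpoly_eval_single: "zpoly_eval R f (Poly_Mapping.single m 1) = mono_eval R f m"
  by (simp add: zpoly_eval_mono_eval mono_eval_closed add.int_pow_1)

lemma zpoly_eval_1: "zpoly_eval R f 1 = \<one>"
proof -
  have "mono_eval R f 0 = \<one>"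
    by (simp add: mono_eval_def)
  thus ?thesis
    using zpoly_eval_single[of 0] by simp
qed

lemma zpoly_eval_X: "zpoly_eval R f (X v) = f v"
  unfolding X_def zpoly_eval_single by (simp add: mono_eval_def f)

lemma zpoly_eval_mult: "zpoly_eval R f (P * Q) = zpoly_eval R f P \<otimes> zpoly_eval R f Q"
proof -
  have *: "zpoly_eval R f (Poly_Mapping.single m 1 * Q) = mono_eval R f m \<otimes> zpoly_eval R f Q" for m
  proof (rule frag_induction[where c = Q and S = UNIV])
    fix a b assume "zpoly_eval R f (Poly_Mapping.single m 1 * a) = mono_eval R f m \<otimes> zpoly_eval R f a"
      "zpoly_eval R f (Poly_Mapping.single m 1 * b) = mono_eval R f m \<otimes> zpoly_eval R f b"
    thus "zpoly_eval R f (Poly_Mapping.single m 1 * (a - b)) = mono_eval R f m \<otimes> zpoly_eval R f (a - b)"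
      by (simp add: right_diff_distrib zpoly_eval_diff a_minus_def r_distr r_minus
          mono_eval_closed zpoly_eval_closed)
  qed (auto simp: zpoly_eval_0 mono_eval_closed mult_single zpoly_eval_single mono_eval_add)
  show ?thesis
  proof (rule frag_induction[where c = P and S = UNIV])
    fix a b assume "zpoly_eval R f (a * Q) = zpoly_eval R f a \<otimes> zpoly_eval R f Q"
      "zpoly_eval R f (b * Q) = zpoly_eval R f b \<otimes> zpoly_eval R f Q"
    thus "zpoly_eval R f ((a - b) * Q) = zpoly_eval R f (a - b) \<otimes> zpoly_eval R f Q"
      by (simp add: left_diff_distrib zpoly_eval_diff a_minus_def l_distr l_minus zpoly_eval_closed)
  qed (auto simp: zpoly_eval_0 zpoly_eval_closed * zpoly_eval_single)
qed

end

end

lemma mono_induct: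
  fixes m :: "'v \<Rightarrow>\<^sub>0 nat"
  assumes "Q 0" "\<And>m v. Q m \<Longrightarrow> Q (m + Poly_Mapping.single v 1)"
  shows "Q m"
proof (induction m rule: update_induct)
  case (update m v n)
  have "Poly_Mapping.update v n m = m + Poly_Mapping.single v n"
    by (rule poly_mapping_eqI)
      (use update(1) in \<open>auto simp: lookup_update lookup_add lookup_single when_def in_keys_iff\<close>)
  moreover have "Q (m + Poly_Mapping.single v k)" for k
  proof (induction k)
    case (Suc k)
    have "m + Poly_Mapping.single v (Suc k) = (m + Poly_Mapping.single v k) + Poly_Mapping.single v 1"
      by (simp add: add.assoc single_add[symmetric])
    thus ?case using assms(2)[OF Suc] by simp
  qed (use update in simp)
  ultimately show ?case by simp
qed (use assms in simp)

lemma zpoly_induct [case_names zero one X diff mult]: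
  fixes P :: "'v zpoly"
  assumes "Q 0" "Q 1" "\<And>v. Q (X v)" "\<And>P P'. Q P \<Longrightarrow> Q P' \<Longrightarrow> Q (P - P')"
    "\<And>P P'. Q P \<Longrightarrow> Q P' \<Longrightarrow> Q (P * P')"
  shows "Q P"
proof (rule frag_induction[where c = P and S = UNIV])
  fix m :: "'v \<Rightarrow>\<^sub>0 nat"
  show "Q (frag_of m)"
  proof (induction m rule: mono_induct)
    case (2 m v)
    have "frag_of (m + Poly_Mapping.single v 1) = frag_of m * X v"
      by (simp add: X_def mult_single)
    thus ?case using 2 assms by simp
  qed (use assms in simp)
qed (use assms in auto)

text \<open>
  Identities between integer polynomials are needed both in rings with a carrier and in rings
  given by a type class; the second kind is reduced to the first through this record.
\<close>

definition type_ring :: "'r::comm_ring_1 ring" where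
  "type_ring = \<lparr>carrier = UNIV, mult = (*), one = 1, zero = 0, add = (+)\<rparr>"

lemma type_ring_simps [simp]:
  "carrier type_ring = UNIV" "mult type_ring = (*)" "one type_ring = 1"
  "zero type_ring = 0" "add type_ring = (+)"
  by (simp_all add: type_ring_def)

lemma cring_type_ring: "cring (type_ring :: 'r::comm_ring_1 ring)"
proof (rule cringI)
  show "abelian_group (type_ring :: 'r ring)"
    by (rule abelian_groupI) (auto simp: add.assoc add.commute intro: exI[of _ "- x" for x] ab_left_minus)
  show "comm_monoid (type_ring :: 'r ring)"
    by (rule comm_monoidI) (auto simp: ac_simps)
qed (auto simp: algebra_simps)

definition peval :: "('v \<Rightarrow> 'r::comm_ring_1) \<Rightarrow> 'v zpoly \<Rightarrow> 'r" where
  "peval f P = zpoly_eval type_ring f P"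

lemma peval_simps [simp]:
  fixes f :: "'v \<Rightarrow> 'r::comm_ring_1"
  shows
  "peval f 0 = 0" "peval f 1 = 1" "peval f (X v) = f v"
  "peval f (P + Q) = peval f P + peval f Q"
  "peval f (P * Q) = peval f P * peval f Q"
  "peval f (- P) = - peval f P"
  "peval f (P - Q) = peval f P - peval f Q"
proof -
  interpret cring "type_ring :: 'r ring"
    by (rule cring_type_ring)
  show "peval f 0 = 0" "peval f 1 = 1" "peval f (X v) = f v"
    and add: "\<And>P Q. peval f (P + Q) = peval f P + peval f Q"
    and "peval f (P * Q) = peval f P * peval f Q"
    by (simp_all add: peval_def zpoly_eval_0 zpoly_eval_1 zpoly_eval_X zpoly_eval_add zpoly_eval_mult)
  show "peval f (- P) = - peval f P" "peval f (P - Q) = peval f P - peval f Q"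
    using add[of P "- P"] add[of "P - Q" Q] \<open>peval f 0 = 0\<close>
    by (metis add_diff_cancel_left' diff_self diff_0 add.right_inverse minus_unique)
      (use add[of "P - Q" Q] in \<open>simp add: algebra_simps\<close>)
qed

lemma peval_of_nat [simp]: "peval f (of_nat n) = of_nat n"
  by (induction n) auto

lemma peval_power [simp]: "peval f (P ^ n) = peval f P ^ n"
  by (induction n) auto

lemma peval_sum [simp]: "peval f (\<Sum>i\<in>I. g i) = (\<Sum>i\<in>I. peval f (g i))"
  by (induction I rule: infinite_finite_induct) auto

lemma peval_peval: "peval f (peval g P) = peval (\<lambda>v. peval f (g v)) P"
  by (induction P rule: zpoly_induct) auto

lemma peval_X [simp]: "peval X P = P"
  by (induction P rule: zpoly_induct) auto

text \<open>
  Through such a homomorphism from a type-class ring, computations in \<open>R\<close> can be replaced by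
  computations with representatives.
\<close>

locale ring_cover =
  fixes R :: "('a, 'm) ring_scheme" and h :: "'r::comm_ring_1 \<Rightarrow> 'a"
  assumes R: "cring R"
    and closed [simp]: "h x \<in> carrier R"
    and one [simp]: "h 1 = \<one>\<^bsub>R\<^esub>"
    and diff [simp]: "h (x - y) = h x \<ominus>\<^bsub>R\<^esub> h y"
    and mult [simp]: "h (x * y) = h x \<otimes>\<^bsub>R\<^esub> h y"
begin

sublocale R: cring R by (rule R)

lemma zero [simp]: "h 0 = \<zero>\<^bsub>R\<^esub>"
  using diff[of 0 0] closed[of 0] R.r_neg[of "h 0"] by (simp add: a_minus_def)

lemma uminus [simp]: "h (- x) = \<ominus>\<^bsub>R\<^esub> h x"
  using diff[of 0 x] by (simp add: a_minus_def)

lemma add [simp]: "h (x + y) = h x \<oplus>\<^bsub>R\<^esub> h y"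
  using diff[of x "- y"] by (simp add: a_minus_def)

lemma power [simp]: "h (x ^ n) = h x [^]\<^bsub>R\<^esub> n"
  by (induction n) (auto simp: R.m_comm)

lemma of_nat [simp]: "h (of_nat n) = [n] \<cdot>\<^bsub>R\<^esub> \<one>\<^bsub>R\<^esub>"
  by (induction n) (auto simp: R.a_comm)

lemma zpoly_eval_cover: "zpoly_eval R (\<lambda>v. h (f v)) P = h (peval f P)"
  by (induction P rule: zpoly_induct)
    (auto simp: R.zpoly_eval_0 R.zpoly_eval_1 R.zpoly_eval_X R.zpoly_eval_diff R.zpoly_eval_mult)

end

definition zpoly_vars :: "'v zpoly \<Rightarrow> 'v set" where
  "zpoly_vars P = (\<Union>m\<in>Poly_Mapping.keys P. Poly_Mapping.keys m)"

lemma (in cring) zpoly_eval_cong: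
  assumes "\<And>v. v \<in> zpoly_vars P \<Longrightarrow> f v = g v" "\<And>v. v \<in> zpoly_vars P \<Longrightarrow> g v \<in> carrier R"
  shows "zpoly_eval R f P = zpoly_eval R g P"
proof -
  have "mono_eval R f m = mono_eval R g m \<and> mono_eval R g m \<in> carrier R"
    if "m \<in> Poly_Mapping.keys P" for m
  proof
    have *: "f v = g v \<and> g v \<in> carrier R" if "v \<in> Poly_Mapping.keys m" for v
      using assms that \<open>m \<in> Poly_Mapping.keys P\<close> unfolding zpoly_vars_def by blast
    show "mono_eval R f m = mono_eval R g m"
      unfolding mono_eval_def by (rule finprod_cong') (use * in auto)
    show "mono_eval R g m \<in> carrier R"
      unfolding mono_eval_def by (rule finprod_closed) (use * in auto)
  qed
  thus ?thesis
    unfolding zpoly_eval_mono_eval by (intro finsum_cong') (auto simp: add.int_pow_closed)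
qed

text \<open>
  Components of a truncated Witt vector beyond the truncation are \<open>undefined\<close>, hence possibly outside
  of the ring, but the Witt polynomials do not involve them. This allows for replacing them by zero.
\<close>

lemma (in cring) zpoly_eval_restrict:
  assumes "\<And>v. v \<in> zpoly_vars P \<Longrightarrow> f v \<in> carrier R"
  shows "zpoly_eval R f P = zpoly_eval R (\<lambda>v. if f v \<in> carrier R then f v else \<zero>) P"
  by (rule zpoly_eval_cong) (use assms in auto)

lemma zpoly_eval_hom:
  assumes "cring R" "cring S" "h \<in> ring_hom R S" "\<And>v. v \<in> zpoly_vars P \<Longrightarrow> f v \<in> carrier R"
  shows "zpoly_eval S (\<lambda>v. h (f v)) P = h (zpoly_eval R f P)"
proof -
  interpret R: cring R by fact
  interpret S: cring S by fact
  interpret ring_hom_cring R S h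
    by unfold_locales (use assms in auto)
  let ?f = "\<lambda>v. if f v \<in> carrier R then f v else \<zero>\<^bsub>R\<^esub>"
  have f: "?f v \<in> carrier R" for v by simp
  have h: "h (?f v) \<in> carrier S" for v using f by (rule hom_closed)
  note ev = f h R.zpoly_eval_closed[OF f]
  have "zpoly_eval S (\<lambda>v. h (?f v)) P' = h (zpoly_eval R ?f P')" for P'
  proof (induction P' rule: zpoly_induct)
    case (X v)
    show ?case by (subst R.zpoly_eval_X[OF f], subst S.zpoly_eval_X[OF h], rule refl)
  next
    case (diff P P')
    thus ?case
      unfolding R.zpoly_eval_diff[of ?f, OF f] S.zpoly_eval_diff[of "\<lambda>v. h (?f v)", OF h]
      by (simp add: a_minus_def R.zpoly_eval_closed[of ?f, OF f])
  next
    case (mult P P')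
    thus ?case
      unfolding R.zpoly_eval_mult[of ?f, OF f] S.zpoly_eval_mult[of "\<lambda>v. h (?f v)", OF h]
      by (simp add: R.zpoly_eval_closed[of ?f, OF f])
  qed (simp_all only: R.zpoly_eval_0[of ?f, OF f] S.zpoly_eval_0[of "\<lambda>v. h (?f v)", OF h]
       R.zpoly_eval_1[of ?f, OF f] S.zpoly_eval_1[of "\<lambda>v. h (?f v)", OF h] hom_zero hom_one)
  moreover have "zpoly_eval S (\<lambda>v. h (f v)) P = zpoly_eval S (\<lambda>v. h (?f v)) P"
    by (rule S.zpoly_eval_cong) (use assms in auto)
  moreover have "zpoly_eval R f P = zpoly_eval R ?f P"
    by (rule R.zpoly_eval_restrict) (use assms in auto)
  ultimately show ?thesis by simp
qed

text \<open>
  With one variable for each element, every ring is the image of a polynomial ring, where \<open>X a\<close> serves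
  as a representative of \<open>a\<close>.
\<close>

definition cover :: "('a, 'm) ring_scheme \<Rightarrow> 'a zpoly \<Rightarrow> 'a" where
  "cover R = zpoly_eval R (\<lambda>a. if a \<in> carrier R then a else \<zero>\<^bsub>R\<^esub>)"

lemma ring_cover_cover: 
  assumes "cring R" shows "ring_cover R (cover R)"
proof -
  interpret R: cring R by fact
  have c: "(if a \<in> carrier R then a else \<zero>\<^bsub>R\<^esub>) \<in> carrier R" for a by simp
  show ?thesis
    unfolding cover_def
    by unfold_locales (simp_all only: R.zpoly_eval_1[OF c] R.zpoly_eval_diff[OF c] R.zpoly_eval_mult[OF c] R.zpoly_eval_closed[OF c])
qed

lemma cover_X: "cring R \<Longrightarrow> a \<in> carrier R \<Longrightarrow> cover R (X a) = a"
  unfolding cover_def by (subst cring.zpoly_eval_X) (auto simp: cring.cring_simprules)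


section \<open>Witt polynomials\<close>

text \<open>
  The binomial coefficients in the middle are divisible by \<open>p\<close>, and the middle terms by \<open>d\<close>. Both
  factors together make \<open>p\<close>-th powers of nearby elements closer to each other than the elements themselves.
\<close>

lemma prime_power_add_expand:
  fixes b d :: "'r::comm_ring_1"
  assumes "Factorial_Ring.prime p"
  shows "(b + d) ^ p = b ^ p + d ^ p + of_nat p * d *
           (\<Sum>l\<in>{1..<p}. of_nat ((p choose l) div p) * (d ^ (l - 1) * b ^ (p - l)))"
proof -
  have p: "p > 0" using assms prime_gt_0_nat by blast
  have "(b + d) ^ p = (\<Sum>l\<le>p. of_nat (p choose l) * d ^ l * b ^ (p - l))"
    by (subst add.commute) (rule binomial_ring)
  also have "{..p} = insert 0 (insert p {1..<p})" using p by auto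
  also have "(\<Sum>l\<in>\<dots>. of_nat (p choose l) * d ^ l * b ^ (p - l)) =
      b ^ p + d ^ p + (\<Sum>l\<in>{1..<p}. of_nat (p choose l) * d ^ l * b ^ (p - l))"
    using p by simp
  also have "(\<Sum>l\<in>{1..<p}. of_nat (p choose l) * d ^ l * b ^ (p - l)) =
     (\<Sum>l\<in>{1..<p}. of_nat p * d * (of_nat ((p choose l) div p) * (d ^ (l - 1) * b ^ (p - l))))"
  proof (rule sum.cong)
    fix l assume l: "l \<in> {1..<p}"
    have "p dvd (p choose l)"
      using assms l by (intro dvd_choose_prime) auto
    hence "of_nat (p choose l) = (of_nat p * of_nat ((p choose l) div p) :: 'r)"
      by (metis dvd_mult_div_cancel of_nat_mult)
    moreover have "d ^ l = d * d ^ (l - 1)"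
      using l by (cases l) auto
    ultimately show "of_nat (p choose l) * d ^ l * b ^ (p - l) =
        of_nat p * d * (of_nat ((p choose l) div p) * (d ^ (l - 1) * b ^ (p - l)))"
      by (simp add: ac_simps)
  qed simp
  finally show ?thesis by (simp add: sum_distrib_left)
qed

definition ghost_sum :: "nat \<Rightarrow> (nat \<Rightarrow> 'r::comm_ring_1) \<Rightarrow> nat \<Rightarrow> 'r" where
  "ghost_sum p x n = (\<Sum>i\<le>n. of_nat p ^ i * x i ^ (p ^ (n - i)))"

lemma ghost_eq_ghost_sum: "ghost p x n = ghost_sum p x n"
  by (simp add: ghost_def ghost_sum_def)

lemma ghost_sum_0 [simp]: "ghost_sum p x 0 = x 0"
  by (simp add: ghost_sum_def)

lemma ghost_sum_Suc:
  "ghost_sum p x (Suc n) = ghost_sum p (\<lambda>i. x i ^ p) n + of_nat p ^ Suc n * x (Suc n)"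
proof -
  have "x i ^ p ^ (Suc n - i) = (x i ^ p) ^ p ^ (n - i)" if "i \<le> n" for i
    using that by (simp add: Suc_diff_le power_mult)
  thus ?thesis by (simp add: ghost_sum_def)
qed

lemma ghost_sum_Suc_shift:
  "ghost_sum p x (Suc n) = x 0 ^ p ^ Suc n + of_nat p * ghost_sum p (\<lambda>i. x (Suc i)) n"
  unfolding ghost_sum_def
  by (subst sum.atMost_Suc_shift) (simp add: sum_distrib_left mult.assoc)

lemma ghost_sum_split:
  "ghost_sum p x n = (\<Sum>i<n. of_nat p ^ i * x i ^ (p ^ (n - i))) + of_nat p ^ n * x n"
proof -
  have "{..n} = insert n {..<n}" by auto
  thus ?thesis by (simp add: ghost_sum_def)
qed

lemma ghost_sum_cong: "(\<And>i. i \<le> n \<Longrightarrow> x i = y i) \<Longrightarrow> ghost_sum p x n = ghost_sum p y n"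
  by (simp add: ghost_sum_def)

lemma peval_ghost_sum: "peval f (ghost_sum p S n) = ghost_sum p (\<lambda>i. peval f (S i)) n"
  by (simp add: ghost_sum_def)

text \<open>
  Here \<open>Q j a\<close> stands for \<open>a \<in> p\<^sup>j B\<close> for some subring \<open>B\<close> of a \<open>p\<close>-torsion-free ring.
\<close>

locale p_filtration =
  fixes p :: nat and Q :: "nat \<Rightarrow> 'r::comm_ring_1 \<Rightarrow> bool"
  assumes prime: "Factorial_Ring.prime p"
    and Q_1: "Q 0 1"
    and Q_p: "Q 1 (of_nat p)"
    and Q_diff: "Q j a \<Longrightarrow> Q j b \<Longrightarrow> Q j (a - b)"
    and Q_mult: "Q i a \<Longrightarrow> Q j b \<Longrightarrow> Q (i + j) (a * b)"
    and Q_Suc: "Q (Suc j) a \<Longrightarrow> Q j a"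
    and Q_cancel: "Q (k + j) (of_nat p ^ k * a) \<Longrightarrow> Q j a"
    and Q_0: "Q j 0"
begin

lemma Q_uminus: "Q j a \<Longrightarrow> Q j (- a)"
  using Q_diff[OF Q_0, of j a] by simp

lemma Q_add: "Q j a \<Longrightarrow> Q j b \<Longrightarrow> Q j (a + b)"
  using Q_diff[of j a "- b"] Q_uminus by simp

lemma Q_sum: "(\<And>i. i \<in> I \<Longrightarrow> Q j (f i)) \<Longrightarrow> Q j (\<Sum>i\<in>I. f i)"
  by (induction I rule: infinite_finite_induct) (auto simp: Q_0 intro: Q_add)

lemma Q_of_nat: "Q 0 (of_nat n)"
  by (induction n) (auto simp: Q_0 Q_1 intro: Q_add)

lemma Q_power: "Q j a \<Longrightarrow> Q (j * n) (a ^ n)"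
  by (induction n) (auto simp: Q_1 intro: Q_mult)

lemma Q_mono:
  assumes "Q j a" "i \<le> j"
  shows "Q i a"
  using assms(2) by (induction rule: inc_induct) (use assms in \<open>auto intro: Q_Suc\<close>)

lemma Q_mult': "Q i a \<Longrightarrow> Q j b \<Longrightarrow> k \<le> i + j \<Longrightarrow> Q k (a * b)"
  using Q_mult Q_mono by blast

lemma Q_p_power: "Q j a \<Longrightarrow> Q (i + j) (of_nat p ^ i * a)"
  using Q_mult[OF Q_power[OF Q_p, of i]] by simp

lemma p2: "p \<ge> 2"
  using prime prime_ge_2_nat by blast

lemma Q_prime_power_add:
  assumes "Q 0 a" "Q 0 b"
  shows "Q 1 ((a + b) ^ p - (a ^ p + b ^ p))"
proof -
  have "Q 0 (b * (\<Sum>l\<in>{1..<p}. of_nat ((p choose l) div p) * (b ^ (l - 1) * a ^ (p - l))))"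
    by (intro Q_sum Q_mult'[of 0 _ 0 _ 0] Q_of_nat Q_power[of 0, simplified] assms) auto
  from Q_mult'[OF Q_p this, of 1] show ?thesis
    unfolding prime_power_add_expand[OF prime] by (simp add: mult.assoc)
qed

lemma Q_prime_power_diff:
  assumes "Q (Suc j) (a - b)" "Q 0 b"
  shows "Q (Suc (Suc j)) (a ^ p - b ^ p)"
proof -
  define d where "d = a - b"
  have a: "a = b + d" by (simp add: d_def)
  have d: "Q (Suc j) d" using assms by (simp add: d_def)
  have d0: "Q 0 d" using Q_mono[OF d] by simp
  have "Q (Suc (Suc j)) (d ^ p)"
    by (rule Q_mono[OF Q_power[OF d]]) (use p2 mult_le_mono2[OF p2, of "Suc j"] in simp)
  moreover have "Q 0 (\<Sum>l\<in>{1..<p}. of_nat ((p choose l) div p) * (d ^ (l - 1) * b ^ (p - l)))"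
    by (intro Q_sum Q_mult'[of 0 _ 0 _ 0] Q_of_nat Q_power[of 0, simplified] d0 assms(2)) auto
  ultimately show ?thesis
    unfolding a prime_power_add_expand[OF prime]
    using Q_mult'[OF Q_mult[OF Q_p d]] by (simp add: Q_add)
qed

lemma Q_power_diff:
  assumes "Q 1 (a - b)" "Q 0 b"
  shows "Q (Suc j) (a ^ p ^ j - b ^ p ^ j)"
proof (induction j)
  case (Suc j)
  have "Q 0 (b ^ p ^ j)" using Q_power[OF assms(2)] by simp
  from Q_prime_power_diff[OF Suc this] show ?case
    by (simp add: power_mult[symmetric] mult.commute)
qed (use assms in simp)

text \<open>
  Witt vectors are congruent modulo \<open>p\<close> if and only if their ghost components of index \<open>k\<close> are
  congruent modulo \<open>p\<^sup>k\<^sup>+\<^sup>1\<close>: the terms of lower index in the ghost sum only depend on the classes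
  modulo \<open>p\<close>, by the previous lemma.
\<close>

lemma ghost_sum_congruent:
  assumes "\<And>i. i \<le> n \<Longrightarrow> Q 1 (x i - y i)" "\<And>i. i \<le> n \<Longrightarrow> Q 0 (y i)"
  shows "Q (Suc n) (ghost_sum p x n - ghost_sum p y n)"
proof -
  have "Q (Suc n) (of_nat p ^ i * (x i ^ p ^ (n - i) - y i ^ p ^ (n - i)))" if "i \<le> n" for i
    using Q_p_power[OF Q_power_diff[OF assms], of i i "n - i"] that by simp
  hence "Q (Suc n) (\<Sum>i\<le>n. of_nat p ^ i * (x i ^ p ^ (n - i) - y i ^ p ^ (n - i)))"
    by (intro Q_sum) auto
  thus ?thesis
    by (simp add: ghost_sum_def sum_subtractf right_diff_distrib)
qed

lemma congruent_of_ghost_sum: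
  assumes "\<And>k. k \<le> n \<Longrightarrow> Q (Suc k) (ghost_sum p x k - ghost_sum p y k)" "\<And>i. i \<le> n \<Longrightarrow> Q 0 (y i)"
    and "k \<le> n"
  shows "Q 1 (x k - y k)"
  using \<open>k \<le> n\<close>
proof (induction k rule: less_induct)
  case (less k)
  have "Q (Suc k) (\<Sum>i<k. of_nat p ^ i * (x i ^ p ^ (k - i) - y i ^ p ^ (k - i)))"
  proof (rule Q_sum)
    fix i assume i: "i \<in> {..<k}"
    hence "Q 1 (x i - y i)" "Q 0 (y i)" using less assms by auto
    from Q_p_power[OF Q_power_diff[OF this], of i "k - i"] i
    show "Q (Suc k) (of_nat p ^ i * (x i ^ p ^ (k - i) - y i ^ p ^ (k - i)))" by simp
  qed
  from Q_diff[OF assms(1)[OF less.prems] this]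
  have "Q (k + 1) (of_nat p ^ k * (x k - y k))"
    by (simp add: ghost_sum_split sum_subtractf right_diff_distrib)
  thus ?case by (rule Q_cancel)
qed

end

subsection \<open>Integer polynomials with prescribed ghost components\<close>

lemma lookup_of_nat_mult: "Poly_Mapping.lookup (of_nat q * P :: 'v zpoly) m = int q * Poly_Mapping.lookup P m"
proof -
  have "(of_nat q :: 'v zpoly) = Poly_Mapping.single 0 (int q)"
    by (metis single_of_nat)
  hence "of_nat q * P = Poly_Mapping.map ((*) (int q)) P"
    using mult_map_scale_conv_mult[of "int q" P] by simp
  thus ?thesis by (simp add: Poly_Mapping.map.rep_eq when_def)
qed

lemma zpoly_of_nat_mult_cancel:
  fixes P P' :: "'v zpoly"
  assumes "of_nat q * P = of_nat q * P'" "q > 0"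
  shows "P = P'"
proof (rule poly_mapping_eqI)
  fix m
  have "int q * Poly_Mapping.lookup P m = int q * Poly_Mapping.lookup P' m"
    using assms(1) by (metis lookup_of_nat_mult)
  thus "Poly_Mapping.lookup P m = Poly_Mapping.lookup P' m" using assms(2) by simp
qed

lemma p_filtration_zpoly:
  assumes "Factorial_Ring.prime p"
  shows "p_filtration p (\<lambda>j (P :: 'v zpoly). of_nat p ^ j dvd P)"
proof
  fix k j and a :: "'v zpoly"
  assume "of_nat p ^ (k + j) dvd of_nat p ^ k * a"
  then obtain b where "of_nat p ^ k * a = of_nat p ^ k * (of_nat p ^ j * b)"
    by (auto simp: power_add mult.assoc elim: dvdE)
  hence "of_nat (p ^ k) * a = of_nat (p ^ k) * (of_nat p ^ j * b)" by simp
  hence "a = of_nat p ^ j * b"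
    by (rule zpoly_of_nat_mult_cancel) (use assms prime_gt_0_nat in auto)
  thus "of_nat p ^ j dvd a" by simp
next
  show "of_nat p ^ (i + j) dvd a * b" if "of_nat p ^ i dvd a" "of_nat p ^ j dvd b"
    for i j and a b :: "'v zpoly"
    using that by (simp add: power_add mult_dvd_mono)
qed (use assms in \<open>auto intro: dvd_diff simp: power_Suc dest: dvd_mult_right\<close>)

lemma ghost_unique:
  assumes "Factorial_Ring.prime p" "\<And>k. k \<le> n \<Longrightarrow> ghost p S k = ghost p T k" "k \<le> n"
  shows "S k = T k"
  using \<open>k \<le> n\<close>
proof (induction k rule: less_induct)
  case (less k)
  have "of_nat (p ^ k) * S k = of_nat (p ^ k) * T k"
    using assms(2)[OF less.prems] less by (simp add: ghost_eq_ghost_sum ghost_sum_split)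
  thus ?case
    by (rule zpoly_of_nat_mult_cancel) (use assms(1) prime_gt_0_nat in auto)
qed

text \<open>
  A ring endomorphism that reduces to the \<open>p\<close>-th power modulo \<open>p\<close>, as needed for Dwork's criterion.
\<close>

definition frob_lift :: "nat \<Rightarrow> 'v zpoly \<Rightarrow> 'v zpoly" where
  "frob_lift p = peval (\<lambda>v. X v ^ p)"

lemma frob_lift_simps [simp]:
  "frob_lift p (P + P') = frob_lift p P + frob_lift p P'"
  "frob_lift p (P * P') = frob_lift p P * frob_lift p P'"
  "frob_lift p (ghost_sum p S n) = ghost_sum p (\<lambda>i. frob_lift p (S i)) n"
  "frob_lift p (X v) = X v ^ p"
  by (simp_all add: frob_lift_def peval_ghost_sum)

lemma frob_lift_mod_p:
  assumes "Factorial_Ring.prime p"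
  shows "of_nat p dvd P ^ p - frob_lift p (P :: 'v zpoly)"
proof (induction P rule: zpoly_induct)
  case zero
  show ?case using prime_gt_0_nat[OF assms] by (simp add: frob_lift_def zero_power)
next
  case (diff P P')
  have *: "of_nat p dvd (a + b) ^ p - (a ^ p + b ^ p)" for a b :: "'v zpoly"
    by (simp add: prime_power_add_expand[OF assms] mult.assoc)
  have "of_nat p dvd (P - P' + P') ^ p - ((P - P') ^ p + P' ^ p)" by (rule *)
  hence "of_nat p dvd P ^ p - ((P - P') ^ p + P' ^ p)" by simp
  from dvd_diff[OF dvd_diff[OF diff(1) this] diff(2)] show ?case
    by (simp add: frob_lift_def algebra_simps)
next
  case (mult P P')
  have "(P * P') ^ p - frob_lift p (P * P') =
    (P ^ p - frob_lift p P) * P' ^ p + frob_lift p P * (P' ^ p - frob_lift p P')"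
    by (simp add: algebra_simps power_mult_distrib)
  thus ?case using mult by simp
qed (auto simp: frob_lift_def)

text \<open>
  Dwork's criterion: the congruences make the equation for the next component divisible by the
  power of \<open>p\<close> with which this component occurs.
\<close>

lemma dwork_existence:
  fixes g :: "nat \<Rightarrow> 'v zpoly"
  assumes p: "Factorial_Ring.prime p"
    and g: "\<And>n. of_nat p ^ Suc n dvd g (Suc n) - frob_lift p (g n)"
  shows "\<exists>S. \<forall>n. ghost p S n = g n"
proof -
  interpret p_filtration p "\<lambda>j (P :: 'v zpoly). of_nat p ^ j dvd P"
    by (rule p_filtration_zpoly) fact
  have step: "\<exists>S. \<forall>k\<le>n. ghost p S k = g k" for n
  proof (induction n)
    case 0
    show ?case by (rule exI[of _ g]) (simp add: ghost_eq_ghost_sum)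
  next
    case (Suc n)
    then obtain S where S: "\<And>k. k \<le> n \<Longrightarrow> ghost p S k = g k" by blast
    have "of_nat p ^ Suc n dvd ghost_sum p (\<lambda>i. S i ^ p) n - ghost_sum p (\<lambda>i. frob_lift p (S i)) n"
      by (rule ghost_sum_congruent) (use frob_lift_mod_p[OF p] in auto)
    moreover have "ghost_sum p (\<lambda>i. frob_lift p (S i)) n = frob_lift p (g n)"
      using S[of n] by (simp add: ghost_eq_ghost_sum flip: frob_lift_simps(3))
    ultimately have "of_nat p ^ Suc n dvd g (Suc n) - ghost_sum p (\<lambda>i. S i ^ p) n"
      using dvd_diff[OF g[of n], of "ghost_sum p (\<lambda>i. S i ^ p) n - frob_lift p (g n)"] by simp
    then obtain c where c: "g (Suc n) - ghost_sum p (\<lambda>i. S i ^ p) n = of_nat p ^ Suc n * c"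
      by (elim dvdE)
    define T where "T = S(Suc n := c)"
    have "ghost p T k = g k" if "k \<le> n" for k
      using S[OF that] that by (simp add: ghost_eq_ghost_sum T_def ghost_sum_def)
    moreover have "ghost p T (Suc n) = g (Suc n)"
    proof -
      have "ghost_sum p (\<lambda>i. T i ^ p) n = ghost_sum p (\<lambda>i. S i ^ p) n"
        by (rule ghost_sum_cong) (simp add: T_def)
      thus ?thesis using c by (simp add: ghost_eq_ghost_sum ghost_sum_Suc T_def algebra_simps)
    qed
    ultimately show ?case by (auto simp: le_Suc_eq)
  qed
  then obtain S where S: "\<And>n k. k \<le> n \<Longrightarrow> ghost p (S n) k = g k" by metis
  have "ghost p (\<lambda>i. S i i) n = g n" for n
  proof -
    have "S i i = S n i" if "i \<le> n" for i
      by (rule ghost_unique[OF p, of i]) (use S that in auto)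
    hence "ghost_sum p (\<lambda>i. S i i) n = ghost_sum p (S n) n"
      by (intro ghost_sum_cong) auto
    thus ?thesis using S[of n n] by (simp add: ghost_eq_ghost_sum)
  qed
  thus ?thesis by blast
qed

lemma ghost_with_ghost:
  fixes g :: "nat \<Rightarrow> 'v zpoly"
  assumes "Factorial_Ring.prime p" "\<And>n. of_nat p ^ Suc n dvd g (Suc n) - frob_lift p (g n)"
  shows "ghost p (with_ghost p g) n = g n"
proof -
  obtain S where S: "\<forall>n. ghost p S n = g n" using dwork_existence[OF assms] by blast
  have "with_ghost p g = S"
    unfolding with_ghost_def
  proof (rule the_equality[where P = "\<lambda>S. \<forall>n. ghost p S n = g n", OF S])
    fix T assume "\<forall>n. ghost p T n = g n"
    show "T = S"
    proof
      fix n show "T n = S n"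
        by (rule ghost_unique[OF assms(1), of n]) (use S \<open>\<forall>n. ghost p T n = g n\<close> in auto)
    qed
  qed
  thus ?thesis using S by simp
qed

lemma frob_lift_ghost_X:
  "ghost_sum p (\<lambda>i. X (f i)) (Suc n) - frob_lift p (ghost_sum p (\<lambda>i. X (f i)) n) =
     of_nat p ^ Suc n * (X (f (Suc n)) :: 'v zpoly)"
  by (simp add: ghost_sum_Suc)

lemma ghost_witt_add_poly:
  assumes "Factorial_Ring.prime p"
  shows "ghost_sum p (witt_add_poly p) n = ghost_sum p (\<lambda>i. X (Inl i)) n + ghost_sum p (\<lambda>i. X (Inr i)) n"
proof -
  let ?a = "ghost_sum p (\<lambda>i. X (Inl i) :: (nat + nat) zpoly)"
  let ?b = "ghost_sum p (\<lambda>i. X (Inr i) :: (nat + nat) zpoly)"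
  have *: "of_nat p ^ Suc n dvd (?a (Suc n) + ?b (Suc n)) - frob_lift p (?a n + ?b n)" for n
  proof -
    have "(?a (Suc n) + ?b (Suc n)) - frob_lift p (?a n + ?b n) =
      (?a (Suc n) - frob_lift p (?a n)) + (?b (Suc n) - frob_lift p (?b n))"
      unfolding frob_lift_simps by (simp add: algebra_simps)
    thus ?thesis unfolding frob_lift_ghost_X by simp
  qed
  show ?thesis
    using ghost_with_ghost[OF assms *] by (simp add: witt_add_poly_def ghost_eq_ghost_sum)
qed

lemma ghost_witt_mult_poly:
  assumes "Factorial_Ring.prime p"
  shows "ghost_sum p (witt_mult_poly p) n = ghost_sum p (\<lambda>i. X (Inl i)) n * ghost_sum p (\<lambda>i. X (Inr i)) n"
proof -
  let ?a = "ghost_sum p (\<lambda>i. X (Inl i) :: (nat + nat) zpoly)"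
  let ?b = "ghost_sum p (\<lambda>i. X (Inr i) :: (nat + nat) zpoly)"
  have *: "of_nat p ^ Suc n dvd (?a (Suc n) * ?b (Suc n)) - frob_lift p (?a n * ?b n)" for n
  proof -
    have "(?a (Suc n) * ?b (Suc n)) - frob_lift p (?a n * ?b n) =
      (?a (Suc n) - frob_lift p (?a n)) * ?b (Suc n) + frob_lift p (?a n) * (?b (Suc n) - frob_lift p (?b n))"
      unfolding frob_lift_simps(2) by (simp add: algebra_simps)
    moreover have "of_nat p ^ Suc n dvd of_nat p ^ Suc n * c * d + e * (of_nat p ^ Suc n * f)"
      for c d e f :: "(nat + nat) zpoly"
      by (intro dvd_add dvd_mult dvd_mult2) auto
    ultimately show ?thesis unfolding frob_lift_ghost_X by simp
  qed
  show ?thesis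
    using ghost_with_ghost[OF assms *] by (simp add: witt_mult_poly_def ghost_eq_ghost_sum)
qed

lemma ghost_witt_frob_poly:
  assumes "Factorial_Ring.prime p"
  shows "ghost_sum p (witt_frob_poly p) n = ghost_sum p X (Suc n)"
proof -
  have *: "of_nat p ^ Suc n dvd ghost_sum p X (Suc (Suc n)) - frob_lift p (ghost_sum p X (Suc n))" for n
    using frob_lift_ghost_X[of p "\<lambda>i. i" "Suc n"] by (metis dvd_triv_left power_Suc dvd_mult dvd_mult2 mult.assoc mult.left_commute)
  show ?thesis
    using ghost_with_ghost[OF assms *] by (simp add: witt_frob_poly_def ghost_eq_ghost_sum)
qed

lemma ghost_sum_witt_add:
  assumes "Factorial_Ring.prime p"
  shows "ghost_sum p (\<lambda>k. peval (case_sum x y) (witt_add_poly p k)) n = ghost_sum p x n + ghost_sum p y n"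
  by (simp add: ghost_witt_add_poly[OF assms] peval_ghost_sum flip: peval_ghost_sum[of _ p "witt_add_poly p"])

lemma ghost_sum_witt_mult:
  assumes "Factorial_Ring.prime p"
  shows "ghost_sum p (\<lambda>k. peval (case_sum x y) (witt_mult_poly p k)) n = ghost_sum p x n * ghost_sum p y n"
  by (simp add: ghost_witt_mult_poly[OF assms] peval_ghost_sum flip: peval_ghost_sum[of _ p "witt_mult_poly p"])

lemma ghost_sum_witt_frob:
  assumes "Factorial_Ring.prime p"
  shows "ghost_sum p (\<lambda>k. peval x (witt_frob_poly p k)) n = ghost_sum p x (Suc n)"
  by (simp add: ghost_witt_frob_poly[OF assms] peval_ghost_sum flip: peval_ghost_sum[of _ p "witt_frob_poly p"])

subsection \<open>Homogeneity\<close>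

definition wdeg :: "('v \<Rightarrow> nat) \<Rightarrow> ('v \<Rightarrow>\<^sub>0 nat) \<Rightarrow> nat" where
  "wdeg wt m = (\<Sum>v\<in>Poly_Mapping.keys m. wt v * Poly_Mapping.lookup m v)"

text \<open>
  The set \<open>V\<close> records which variables occur, because only the components within the truncation are
  available or bounded.
\<close>

definition homog :: "('v \<Rightarrow> nat) \<Rightarrow> 'v set \<Rightarrow> nat \<Rightarrow> 'v zpoly \<Rightarrow> bool" where
  "homog wt V d P \<longleftrightarrow> (\<forall>m\<in>Poly_Mapping.keys P. Poly_Mapping.keys m \<subseteq> V \<and> wdeg wt m = d)"

lemma wdeg_superset:
  assumes "finite K" "Poly_Mapping.keys m \<subseteq> K"
  shows "wdeg wt m = (\<Sum>v\<in>K. wt v * Poly_Mapping.lookup m v)"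
  unfolding wdeg_def by (rule sum.mono_neutral_left) (use assms in \<open>auto simp: in_keys_iff\<close>)

lemma wdeg_add: "wdeg wt (m + m') = wdeg wt m + wdeg wt m'"
proof -
  let ?K = "Poly_Mapping.keys m \<union> Poly_Mapping.keys m'"
  have "wdeg wt (m + m') = (\<Sum>v\<in>?K. wt v * Poly_Mapping.lookup (m + m') v)"
    by (rule wdeg_superset) (use keys_add[of m m'] in auto)
  also have "\<dots> = wdeg wt m + wdeg wt m'"
    by (simp add: wdeg_superset[of ?K] lookup_add algebra_simps sum.distrib)
  finally show ?thesis .
qed

lemma homog_0: "homog wt V d 0"
  by (simp add: homog_def)

lemma homog_1: "homog wt V 0 1"
  by (simp add: homog_def wdeg_def)

lemma homog_X: "v \<in> V \<Longrightarrow> homog wt V (wt v) (X v)"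
  by (simp add: homog_def X_def wdeg_def)

lemma homog_diff: "homog wt V d P \<Longrightarrow> homog wt V d P' \<Longrightarrow> homog wt V d (P - P')"
  using keys_diff[of P P'] unfolding homog_def by blast

lemma homog_add: "homog wt V d P \<Longrightarrow> homog wt V d P' \<Longrightarrow> homog wt V d (P + P')"
  using keys_add[of P P'] unfolding homog_def by blast

lemma homog_mult:
  assumes "homog wt V d P" "homog wt V d' P'"
  shows "homog wt V (d + d') (P * P')"
  unfolding homog_def
proof
  fix m assume "m \<in> Poly_Mapping.keys (P * P')"
  then obtain a b where "m = a + b" "a \<in> Poly_Mapping.keys P" "b \<in> Poly_Mapping.keys P'"
    using keys_mult[of P P'] by blast
  thus "Poly_Mapping.keys m \<subseteq> V \<and> wdeg wt m = d + d'"
    using assms keys_add[of a b] unfolding homog_def by (force simp: wdeg_add)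
qed

lemma homog_power: "homog wt V d P \<Longrightarrow> homog wt V (n * d) (P ^ n)"
  by (induction n) (auto simp: homog_1 intro: homog_mult)

lemma homog_sum: "(\<And>i. i \<in> I \<Longrightarrow> homog wt V d (f i)) \<Longrightarrow> homog wt V d (\<Sum>i\<in>I. f i)"
  by (induction I rule: infinite_finite_induct) (auto simp: homog_0 intro: homog_add)

lemma homog_of_nat_mult_iff: "q > 0 \<Longrightarrow> homog wt V d (of_nat q * P) \<longleftrightarrow> homog wt V d P"
  by (simp add: homog_def Ball_def in_keys_iff lookup_of_nat_mult)

lemma homog_mono: "homog wt V d P \<Longrightarrow> V \<subseteq> V' \<Longrightarrow> homog wt V' d P"
  unfolding homog_def by blast

lemma homog_vars: "homog wt V d P \<Longrightarrow> zpoly_vars P \<subseteq> V"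
  unfolding homog_def zpoly_vars_def by blast

lemma homog_ghost_term:
  assumes "p > 0" "i \<le> n" "homog wt V (e * p ^ i) P"
  shows "homog wt V (e * p ^ n) (of_nat p ^ i * P ^ p ^ (n - i))"
proof -
  have "p ^ (n - i) * p ^ i = p ^ n" using assms by (simp flip: power_add)
  hence *: "p ^ (n - i) * (e * p ^ i) = e * p ^ n" by (metis mult.left_commute)
  have "homog wt V (e * p ^ n) (P ^ p ^ (n - i))"
    using homog_power[OF assms(3), of "p ^ (n - i)"] unfolding * .
  thus ?thesis
    using assms(1) by (simp add: homog_of_nat_mult_iff flip: of_nat_power)
qed

text \<open>
  Each component of a Witt vector is a polynomial in its ghost components, up to the factor
  \<open>p\<^sup>n\<close>, so it inherits homogeneity from them.
\<close>

lemma homog_of_ghost: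
  assumes "Factorial_Ring.prime p" "\<And>n. homog wt (V n) (e * p ^ n) (ghost_sum p S n)"
    "\<And>i n. i \<le> n \<Longrightarrow> V i \<subseteq> V n"
  shows "homog wt (V n) (e * p ^ n) (S n)"
proof (induction n rule: less_induct)
  case (less n)
  have p: "p > 0" using assms(1) prime_gt_0_nat by blast
  have "homog wt (V n) (e * p ^ n) (\<Sum>i<n. of_nat p ^ i * S i ^ p ^ (n - i))"
    by (intro homog_sum homog_ghost_term[OF p]) (use homog_mono[OF less assms(3)] in auto)
  from homog_diff[OF assms(2)[of n] this]
  have "homog wt (V n) (e * p ^ n) (of_nat p ^ n * S n)"
    by (simp add: ghost_sum_split)
  thus ?case
    using p by (simp add: homog_of_nat_mult_iff flip: of_nat_power)
qed

lemma homog_ghost_X: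
  assumes "p > 0" "\<And>i. i \<le> n \<Longrightarrow> f i \<in> V" "\<And>i. i \<le> n \<Longrightarrow> wt (f i) = p ^ i"
  shows "homog wt V (p ^ n) (ghost_sum p (\<lambda>i. X (f i)) n)"
  unfolding ghost_sum_def
  by (intro homog_sum homog_ghost_term[where e = 1, simplified])
    (use assms homog_X[of "f _" V wt] in fastforce)+

abbreviation "witt_wt p \<equiv> case_sum (\<lambda>i. p ^ i) (\<lambda>i. p ^ i)"

lemma homog_witt_add_poly:
  assumes "Factorial_Ring.prime p"
  shows "homog (witt_wt p) ({..n} <+> {..n}) (p ^ n) (witt_add_poly p n)"
proof -
  have "homog (witt_wt p) ({..n} <+> {..n}) (1 * p ^ n) (witt_add_poly p n)"
    by (rule homog_of_ghost[OF assms]; (unfold ghost_witt_add_poly[OF assms])?)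
      (use assms prime_gt_0_nat in \<open>auto intro!: homog_add homog_ghost_X\<close>)
  thus ?thesis by simp
qed

lemma homog_witt_mult_poly:
  assumes "Factorial_Ring.prime p"
  shows "homog (witt_wt p) ({..n} <+> {..n}) (2 * p ^ n) (witt_mult_poly p n)"
  by (rule homog_of_ghost[OF assms]; (unfold ghost_witt_mult_poly[OF assms] mult_2)?)
    (use assms prime_gt_0_nat in \<open>auto intro!: homog_mult homog_ghost_X\<close>)

lemma homog_witt_frob_poly:
  assumes "Factorial_Ring.prime p"
  shows "homog (\<lambda>i. p ^ i) {..Suc n} (p * p ^ n) (witt_frob_poly p n)"
proof (rule homog_of_ghost[OF assms, where V = "\<lambda>n. {..Suc n}"])
  show "homog (\<lambda>i. p ^ i) {..Suc n} (p * p ^ n) (ghost_sum p (witt_frob_poly p) n)" for n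
    unfolding ghost_witt_frob_poly[OF assms]
    using homog_ghost_X[of p "Suc n" "\<lambda>i. i" "{..Suc n}" "\<lambda>i. p ^ i"] assms prime_gt_0_nat by simp
qed auto

subsection \<open>Reduction modulo \<open>p\<close>\<close>

lemma witt_poly_mod_p:
  fixes S T :: "nat \<Rightarrow> 'v zpoly"
  assumes "Factorial_Ring.prime p" "\<And>k. of_nat p ^ Suc k dvd ghost_sum p S k - ghost_sum p T k"
  shows "of_nat p dvd S n - T n"
proof -
  interpret p_filtration p "\<lambda>j (P :: 'v zpoly). of_nat p ^ j dvd P"
    by (rule p_filtration_zpoly) fact
  have "of_nat p ^ 1 dvd S n - T n"
    by (rule congruent_of_ghost_sum[of n]) (use assms in auto)
  thus ?thesis by simp
qed

lemma witt_frob_poly_mod_p: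
  assumes "Factorial_Ring.prime p"
  shows "of_nat p dvd witt_frob_poly p n - X n ^ p"
  by (rule witt_poly_mod_p[OF assms, where T = "\<lambda>n. X n ^ p"])
    (simp add: ghost_witt_frob_poly[OF assms] ghost_sum_Suc)

text \<open>
  Modulo \<open>p\<close>, writing \<open>x = [x\<^sub>0] + V x'\<close> gives \<open>x y = [x\<^sub>0] y + V (x' F y)\<close>, with \<open>F\<close> raising
  components to the power \<open>p\<close>.
\<close>

definition mult_shift :: "nat \<Rightarrow> nat \<Rightarrow> (nat + nat) zpoly" where
  "mult_shift p l = (case l of 0 \<Rightarrow> 0 | Suc l \<Rightarrow>
     peval (case_sum (\<lambda>i. X (Inl (Suc i))) (\<lambda>i. X (Inr i) ^ p)) (witt_mult_poly p l))"

lemma witt_mult_poly_mod_p: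
  assumes p: "Factorial_Ring.prime p"
  shows "of_nat p dvd witt_mult_poly p n -
     peval (case_sum (\<lambda>l. X (Inl 0) ^ p ^ l * X (Inr l)) (mult_shift p)) (witt_add_poly p n)"
proof (rule witt_poly_mod_p[OF p, where S = "witt_mult_poly p"])
  fix k
  define x y :: "nat \<Rightarrow> (nat + nat) zpoly" where "x = (\<lambda>i. X (Inl i))" and "y = (\<lambda>i. X (Inr i))"
  have teich: "ghost_sum p (\<lambda>l. x 0 ^ p ^ l * y l) k = x 0 ^ p ^ k * ghost_sum p y k"
  proof -
    have "(x 0 ^ p ^ i * y i) ^ p ^ (k - i) = x 0 ^ p ^ k * y i ^ p ^ (k - i)" if "i \<le> k" for i
      using that by (simp add: power_mult_distrib flip: power_mult power_add)
    thus ?thesis by (simp add: ghost_sum_def sum_distrib_left ac_simps)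
  qed
  have "of_nat p ^ Suc k dvd ghost_sum p x k * ghost_sum p y k -
     (x 0 ^ p ^ k * ghost_sum p y k + ghost_sum p (mult_shift p) k)"
  proof (cases k)
    case 0
    thus ?thesis by (simp add: mult_shift_def)
  next
    case (Suc n)
    have shift: "ghost_sum p (mult_shift p) (Suc n) =
        of_nat p * (ghost_sum p (\<lambda>i. x (Suc i)) n * ghost_sum p (\<lambda>i. y i ^ p) n)"
      using prime_gt_0_nat[OF p]
      by (simp add: zero_power ghost_sum_Suc_shift mult_shift_def x_def y_def ghost_sum_witt_mult[OF p])
    have "ghost_sum p x k * ghost_sum p y k - (x 0 ^ p ^ k * ghost_sum p y k + ghost_sum p (mult_shift p) k) =
      of_nat p * ghost_sum p (\<lambda>i. x (Suc i)) n * (ghost_sum p y k - ghost_sum p (\<lambda>i. y i ^ p) n)"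
      unfolding Suc shift ghost_sum_Suc_shift[of p x] by (simp add: algebra_simps)
    also have "ghost_sum p y k - ghost_sum p (\<lambda>i. y i ^ p) n = of_nat p ^ k * y k"
      unfolding Suc ghost_sum_Suc by simp
    also have "of_nat p * ghost_sum p (\<lambda>i. x (Suc i)) n * (of_nat p ^ k * y k) =
       of_nat p ^ Suc k * (ghost_sum p (\<lambda>i. x (Suc i)) n * y k)"
      by (simp add: ac_simps)
    finally show ?thesis by simp
  qed
  thus "of_nat p ^ Suc k dvd ghost_sum p (witt_mult_poly p) k - ghost_sum p
     (\<lambda>n. peval (case_sum (\<lambda>l. X (Inl 0) ^ p ^ l * X (Inr l)) (mult_shift p)) (witt_add_poly p n)) k"
    using teich by (simp add: ghost_witt_mult_poly[OF p] ghost_sum_witt_add[OF p] x_def y_def)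
qed


section \<open>Nonarchimedean seminorms\<close>

locale seminorm =
  fixes N :: "'r::comm_ring_1 \<Rightarrow> real"
  assumes N_nonneg [simp]: "N x \<ge> 0"
    and N_0 [simp]: "N 0 = 0"
    and N_diff: "N (x - y) \<le> max (N x) (N y)"
    and N_mult: "N (x * y) \<le> N x * N y"
    and N_power: "n > 0 \<Longrightarrow> N (x ^ n) = N x ^ n"
begin

lemma N_uminus [simp]: "N (- x) = N x"
proof -
  have "N (- x) \<le> N x" for x using N_diff[of 0 x] by simp
  from this[of x] this[of "- x"] show ?thesis by simp
qed

lemma N_le_0: "N x \<le> 0 \<longleftrightarrow> N x = 0"
  using N_nonneg[of x] by linarith

lemma N_commute: "N (x - y) = N (y - x)"
  using N_uminus[of "x - y"] by simp

lemma N_add: "N (x + y) \<le> max (N x) (N y)"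
  using N_diff[of x "- y"] by simp

lemma N_trans: "N (x - z) \<le> max (N (x - y)) (N (y - z))"
  using N_add[of "x - y" "y - z"] by simp

lemma N_1: "N 1 \<le> 1"
proof (rule ccontr)
  assume "\<not> N 1 \<le> 1"
  hence "N 1 * 1 < N 1 * N 1" by (intro mult_strict_left_mono) auto
  moreover have "N 1 = N 1 * N 1" using N_power[of 2 1] by (simp add: power2_eq_square)
  ultimately show False by simp
qed

lemma N_power_le: "N (x ^ n) \<le> N x ^ n"
  by (cases "n = 0") (auto simp: N_1 N_power)

lemma N_power_mono: "N x \<le> b \<Longrightarrow> N (x ^ n) \<le> b ^ n"
  using N_power_le[of x n] power_mono[of "N x" b n] by simp

lemma N_mult_mono: "N x \<le> a \<Longrightarrow> N y \<le> b \<Longrightarrow> N (x * y) \<le> a * b"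
  using N_mult[of x y] mult_mono[of "N x" a "N y" b] order_trans[OF N_nonneg[of x], of a] by simp

lemma N_sum: "(\<And>i. i \<in> I \<Longrightarrow> N (f i) \<le> b) \<Longrightarrow> 0 \<le> b \<Longrightarrow> N (\<Sum>i\<in>I. f i) \<le> b"
proof (induction I rule: infinite_finite_induct)
  case (insert i I)
  thus ?case using N_add[of "f i" "sum f I"] by fastforce
qed auto

lemma N_of_nat: "N (of_nat n) \<le> 1"
proof (induction n)
  case (Suc n)
  thus ?case using N_add[of 1 "of_nat n"] N_1 by simp
qed auto

lemma N_of_nat_mult: "N (of_nat n * x) \<le> N x"
  using N_mult_mono[OF N_of_nat order_refl, of n x] by simp

text \<open>
  For the weights \<open>p\<^sup>i\<close>, the hypothesis with bound \<open>b\<close> says that the seminorm of a truncated Witt vector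
  is at most \<open>b\<close>, and homogeneity turns such bounds for the operands into one for the result.
\<close>

lemma N_peval_homog:
  assumes P: "homog wt V d P" and f: "\<And>v. v \<in> V \<Longrightarrow> N (f v) \<le> b ^ wt v" and b: "b \<ge> 0"
  shows "N (peval f P) \<le> b ^ d"
proof -
  have mono: "N (peval f (Poly_Mapping.single m 1)) \<le> b ^ wdeg wt m"
    if "Poly_Mapping.keys m \<subseteq> V" for m
    using that
  proof (induction m rule: mono_induct)
    case 1
    thus ?case using N_1 by (simp add: wdeg_def)
  next
    case (2 m v)
    have keys: "Poly_Mapping.keys (m + Poly_Mapping.single v 1) = insert v (Poly_Mapping.keys m)"
      by (auto simp: in_keys_iff lookup_add lookup_single when_def split: if_splits)
    have "Poly_Mapping.single (m + Poly_Mapping.single v 1) 1 = Poly_Mapping.single m 1 * X v"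
      by (simp add: X_def mult_single)
    hence "peval f (Poly_Mapping.single (m + Poly_Mapping.single v 1) 1) =
        peval f (Poly_Mapping.single m 1) * f v"
      by (simp del: One_nat_def)
    also have "N \<dots> \<le> b ^ wdeg wt m * b ^ wt v"
      by (rule N_mult_mono) (use 2 keys f in auto)
    also have "\<dots> = b ^ wdeg wt (m + Poly_Mapping.single v 1)"
      by (simp add: wdeg_add power_add) (simp add: wdeg_def)
    finally show ?case .
  qed
  show ?thesis
  proof (rule frag_induction[where c = P and S = "{m. Poly_Mapping.keys m \<subseteq> V \<and> wdeg wt m = d}"])
    show "Poly_Mapping.keys P \<subseteq> {m. Poly_Mapping.keys m \<subseteq> V \<and> wdeg wt m = d}"
      using P unfolding homog_def by blast
    show "N (peval f (P1 - P2)) \<le> b ^ d" if "N (peval f P1) \<le> b ^ d" "N (peval f P2) \<le> b ^ d" for P1 P2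
      using that N_diff[of "peval f P1" "peval f P2"] by simp
  qed (use mono b in auto)
qed

lemma N_witt_add:
  assumes "Factorial_Ring.prime p" "b \<ge> 0"
    and "\<And>i. i \<le> k \<Longrightarrow> N (x i) \<le> b ^ p ^ i" "\<And>i. i \<le> k \<Longrightarrow> N (y i) \<le> b ^ p ^ i"
  shows "N (peval (case_sum x y) (witt_add_poly p k)) \<le> b ^ p ^ k"
  by (rule N_peval_homog[OF homog_witt_add_poly]) (use assms in auto)

subsection \<open>Characteristic \<open>p\<close>\<close>

lemma N_dvd_p:
  assumes "N (of_nat p) = 0" "of_nat p dvd P"
  shows "N (peval f P) = 0"
proof -
  from assms(2) obtain c where "P = of_nat p * c" by (elim dvdE)
  hence "peval f P = of_nat p * peval f c" by simp
  thus ?thesis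
    using N_mult[of "of_nat p" "peval f c"] assms(1) by (simp add: N_le_0)
qed

lemma N_witt_frob_char_p:
  assumes "Factorial_Ring.prime p" "N (of_nat p) = 0"
  shows "N (peval x (witt_frob_poly p k) - x k ^ p) = 0"
  using N_dvd_p[OF assms(2) witt_frob_poly_mod_p[OF assms(1)], of x k] by simp

text \<open>
  In characteristic \<open>p\<close>, the product of \<open>V\<^sup>i[a]\<close> and \<open>V\<^sup>j[b]\<close> only has a component of index
  \<open>i + j\<close>, which gives a better bound than homogeneity.
\<close>

lemma N_witt_mult_char_p:
  assumes p: "Factorial_Ring.prime p" and charp: "N (of_nat p) = 0" and "b \<ge> 0"
    and "\<And>i j. i + j \<le> k \<Longrightarrow> N (x i) ^ p ^ j * N (y j) ^ p ^ i \<le> b ^ p ^ (i + j)"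
  shows "N (peval (case_sum x y) (witt_mult_poly p k)) \<le> b ^ p ^ k"
  using assms(3,4)
proof (induction k arbitrary: x y b rule: less_induct)
  case (less k)
  note bound = less.prems(2)
  have "p > 0" using p prime_gt_0_nat by blast
  let ?f = "\<lambda>v. peval (case_sum x y) (case_sum (\<lambda>l. X (Inl 0) ^ p ^ l * X (Inr l)) (mult_shift p) v)"
  have "N (peval ?f (witt_add_poly p k)) \<le> b ^ p ^ k"
  proof (rule N_peval_homog[OF homog_witt_add_poly[OF p]])
    fix v :: "nat + nat" assume v: "v \<in> {..k} <+> {..k}"
    show "N (?f v) \<le> b ^ witt_wt p v"
    proof (cases v)
      case (Inl l)
      have "N (x 0 ^ p ^ l * y l) \<le> N (x 0) ^ p ^ l * N (y l)"
        by (intro N_mult_mono N_power_mono) auto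
      also have "\<dots> \<le> b ^ p ^ l" using bound[of 0 l] Inl v by auto
      finally show ?thesis using Inl by simp
    next
      case (Inr l)
      show ?thesis
      proof (cases l)
        case 0
        thus ?thesis using Inr less.prems by (simp add: mult_shift_def)
      next
        case (Suc l')
        have eq: "?f v = peval (case_sum (\<lambda>i. x (Suc i)) (\<lambda>i. y i ^ p)) (witt_mult_poly p l')"
        proof -
          have "(\<lambda>v. peval (case_sum x y) (case_sum (\<lambda>i. X (Inl (Suc i))) (\<lambda>i. X (Inr i) ^ p) v))
              = case_sum (\<lambda>i. x (Suc i)) (\<lambda>i. y i ^ p)"
            by (rule ext) (simp split: sum.split)
          thus ?thesis by (simp add: Inr Suc mult_shift_def peval_peval)
        qed
        have "N (peval (case_sum (\<lambda>i. x (Suc i)) (\<lambda>i. y i ^ p)) (witt_mult_poly p l')) \<le> (b ^ p) ^ p ^ l'"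
        proof (rule less.IH)
          show "l' < k" using v Inr Suc by auto
          fix i j assume ij: "i + j \<le> l'"
          have "N (x (Suc i)) ^ p ^ j * N (y j ^ p) ^ p ^ i = N (x (Suc i)) ^ p ^ j * N (y j) ^ p ^ Suc i"
            using \<open>p > 0\<close> by (simp add: N_power power_mult)
          also have "\<dots> \<le> b ^ p ^ (Suc i + j)"
            by (rule bound) (use ij \<open>l' < k\<close> in auto)
          finally show "N (x (Suc i)) ^ p ^ j * N (y j ^ p) ^ p ^ i \<le> (b ^ p) ^ p ^ (i + j)"
            by (simp add: power_mult)
        qed (use less.prems in auto)
        thus ?thesis using eq unfolding Inr Suc by (simp add: power_mult)
      qed
    qed
  qed (use less.prems in auto)
  moreover have "N (peval (case_sum x y) (witt_mult_poly p k) - peval ?f (witt_add_poly p k)) = 0"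
    using N_dvd_p[OF charp witt_mult_poly_mod_p[OF p], of "case_sum x y" k] by (simp add: peval_peval)
  ultimately show ?case
    using N_add[of "peval (case_sum x y) (witt_mult_poly p k) - peval ?f (witt_add_poly p k)"
      "peval ?f (witt_add_poly p k)"] by simp
qed

subsection \<open>Equality up to elements of seminorm zero, and limits\<close>

text \<open>
  If \<open>N\<close> is the pullback of a norm along a ring homomorphism, this is equality of the images.
\<close>

definition eqv :: "'r \<Rightarrow> 'r \<Rightarrow> bool" (infix "\<approx>" 50) where
  "x \<approx> y \<longleftrightarrow> N (x - y) = 0"

lemma eqv_refl [simp]: "x \<approx> x"
  by (simp add: eqv_def)

lemma eqv_sym: "x \<approx> y \<Longrightarrow> y \<approx> x"
  by (simp add: eqv_def N_commute)

lemma eqv_trans [trans]: "x \<approx> y \<Longrightarrow> y \<approx> z \<Longrightarrow> x \<approx> z"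
  using N_trans[of x z y] by (simp add: eqv_def N_le_0)

lemma eqv_add: "x \<approx> x' \<Longrightarrow> y \<approx> y' \<Longrightarrow> x + y \<approx> x' + y'"
  using N_add[of "x - x'" "y - y'"] by (simp add: eqv_def algebra_simps N_le_0)

lemma eqv_uminus: "x \<approx> x' \<Longrightarrow> - x \<approx> - x'"
  using N_commute[of x x'] by (simp add: eqv_def)

lemma eqv_diff: "x \<approx> x' \<Longrightarrow> y \<approx> y' \<Longrightarrow> x - y \<approx> x' - y'"
  using eqv_add[OF _ eqv_uminus, of x x' y y'] by simp

lemma eqv_mult:
  assumes "x \<approx> x'" "y \<approx> y'"
  shows "x * y \<approx> x' * y'"
proof -
  have "x * y - x' * y' = (x - x') * y + x' * (y - y')" by (simp add: algebra_simps)
  thus ?thesis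
    using N_add[of "(x - x') * y" "x' * (y - y')"] N_mult[of "x - x'" y] N_mult[of x' "y - y'"] assms
    by (simp add: eqv_def N_le_0)
qed

lemma eqv_power: "x \<approx> x' \<Longrightarrow> x ^ n \<approx> x' ^ n"
  by (induction n) (auto intro: eqv_mult)

lemma eqv_sum: "(\<And>i. i \<in> I \<Longrightarrow> f i \<approx> g i) \<Longrightarrow> (\<Sum>i\<in>I. f i) \<approx> (\<Sum>i\<in>I. g i)"
  by (induction I rule: infinite_finite_induct) (auto intro: eqv_add)

lemma eqv_peval: "(\<And>v. f v \<approx> g v) \<Longrightarrow> peval f P \<approx> peval g P"
  by (induction P rule: zpoly_induct) (auto intro: eqv_diff eqv_mult)

lemma eqv_ghost_sum: "(\<And>i. i \<le> n \<Longrightarrow> x i \<approx> y i) \<Longrightarrow> ghost_sum p x n \<approx> ghost_sum p y n"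
  unfolding ghost_sum_def by (intro eqv_sum eqv_mult eqv_power) auto

lemma eqv_N: "x \<approx> y \<Longrightarrow> N x = N y"
  using N_add[of "x - y" y] N_add[of "y - x" x] by (simp add: eqv_def N_commute) 

definition tends :: "(nat \<Rightarrow> 'r) \<Rightarrow> 'r \<Rightarrow> bool" where
  "tends s z \<longleftrightarrow> (\<lambda>l. N (s l - z)) \<longlonglongrightarrow> 0"

lemma tendsI:
  assumes "\<And>l. N (s l - z) \<le> e l" "e \<longlonglongrightarrow> 0"
  shows "tends s z"
  unfolding tends_def
  by (rule tendsto_sandwich[OF _ _ tendsto_const assms(2)]) (use assms in auto)

lemma tendsD: "tends s z \<Longrightarrow> e > 0 \<Longrightarrow> eventually (\<lambda>l. N (s l - z) < e) sequentially"
  unfolding tends_def by (rule order_tendstoD)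

lemma tends_const: "tends (\<lambda>_. z) z"
  by (simp add: tends_def)

lemma tends_diff:
  assumes "tends s z" "tends t w"
  shows "tends (\<lambda>l. s l - t l) (z - w)"
proof (rule tendsI)
  fix l show "N (s l - t l - (z - w)) \<le> N (s l - z) + N (t l - w)"
    using N_diff[of "s l - z" "t l - w"] N_nonneg[of "s l - z"] N_nonneg[of "t l - w"]
    by (simp add: algebra_simps del: N_nonneg)
qed (use tendsto_add[OF assms[unfolded tends_def]] in simp)

lemma tends_uminus: "tends s z \<Longrightarrow> tends (\<lambda>l. - s l) (- z)"
  using tends_diff[OF tends_const[of 0]] by simp

lemma tends_add: "tends s z \<Longrightarrow> tends t w \<Longrightarrow> tends (\<lambda>l. s l + t l) (z + w)"
  using tends_diff[OF _ tends_uminus] by simp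

lemma tends_mult:
  assumes "tends s z" "tends t w"
  shows "tends (\<lambda>l. s l * t l) (z * w)"
proof (rule tendsI)
  fix l
  have "s l * t l - z * w = (s l - z) * (t l - w) + ((s l - z) * w + z * (t l - w))"
    by (simp add: algebra_simps)
  also have "N \<dots> \<le> N ((s l - z) * (t l - w)) + (N ((s l - z) * w) + N (z * (t l - w)))"
    by (smt (verit) N_add N_nonneg)
  also have "\<dots> \<le> N (s l - z) * N (t l - w) + (N (s l - z) * N w + N z * N (t l - w))"
    by (intro add_mono N_mult)
  finally show "N (s l * t l - z * w) \<le> \<dots>" .
next
  have "(\<lambda>l. N (s l - z) * N (t l - w) + (N (s l - z) * N w + N z * N (t l - w))) \<longlonglongrightarrow> 0 * 0 + (0 * N w + N z * 0)"
    by (intro tendsto_intros assms[unfolded tends_def])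
  thus "(\<lambda>l. N (s l - z) * N (t l - w) + (N (s l - z) * N w + N z * N (t l - w))) \<longlonglongrightarrow> 0" by simp
qed

lemma tends_power: "tends s z \<Longrightarrow> tends (\<lambda>l. s l ^ n) (z ^ n)"
  by (induction n) (auto intro: tends_const tends_mult)

lemma tends_sum: "(\<And>i. i \<in> I \<Longrightarrow> tends (s i) (z i)) \<Longrightarrow> tends (\<lambda>l. \<Sum>i\<in>I. s i l) (\<Sum>i\<in>I. z i)"
  by (induction I rule: infinite_finite_induct) (auto intro: tends_const tends_add)

lemma tends_le:
  assumes "tends s z" "eventually (\<lambda>l. N (s l - w) \<le> b) sequentially"
  shows "N (z - w) \<le> b"
proof (rule field_le_epsilon)
  fix e :: real assume "e > 0"
  have "eventually (\<lambda>l. N (s l - z) < e \<and> N (s l - w) \<le> b) sequentially"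
    using tendsD[OF assms(1) \<open>e > 0\<close>] assms(2) by (rule eventually_conj)
  then obtain l where "N (s l - z) < e" "N (s l - w) \<le> b"
    by (auto dest: eventually_happens)
  thus "N (z - w) \<le> b + e"
    using N_trans[of z w "s l"] N_commute[of z "s l"] \<open>e > 0\<close> N_nonneg[of "s l - w"]
    by (simp del: N_nonneg)
qed

lemma tends_N_le:
  assumes "tends s z" "eventually (\<lambda>l. N (s l) \<le> b) sequentially"
  shows "N z \<le> b"
  using tends_le[OF assms(1), of 0 b] assms(2) by simp

lemma tends_unique: "tends s z \<Longrightarrow> tends s w \<Longrightarrow> z \<approx> w"
proof -
  assume s: "tends s z" "tends s w"
  have "N (z - w) \<le> 0"
  proof (rule field_le_epsilon)
    fix e :: real assume "e > 0"
    have "eventually (\<lambda>l. N (s l - w) \<le> e) sequentially"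
      using tendsD[OF s(2) \<open>e > 0\<close>] by eventually_elim simp
    thus "N (z - w) \<le> 0 + e" using tends_le[OF s(1)] by simp
  qed
  thus ?thesis by (simp add: eqv_def N_le_0)
qed

lemma tends_eqv:
  assumes "tends s z" "eventually (\<lambda>l. s l \<approx> t l) sequentially" "z \<approx> w"
  shows "tends t w"
proof -
  have "eventually (\<lambda>l. N (s l - z) = N (t l - w)) sequentially"
    using assms(2) by eventually_elim (rule eqv_N, rule eqv_diff, use assms in auto)
  thus ?thesis
    using assms(1) unfolding tends_def by (rule Lim_transform_eventually[rotated])
qed

lemma tends_subseq: "tends s z \<Longrightarrow> strict_mono r \<Longrightarrow> tends (\<lambda>l. s (r l)) z"
  unfolding tends_def using LIMSEQ_subseq_LIMSEQ[of "\<lambda>l. N (s l - z)" 0 r] by (simp add: o_def)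

end

section \<open>Seminorms with \<open>|p x| = p\<^sup>-\<^sup>1 |x|\<close>\<close>

locale p_seminorm = seminorm N for N :: "'r::comm_ring_1 \<Rightarrow> real" +
  fixes p :: nat
  assumes prime: "Factorial_Ring.prime p"
    and N_p: "N (of_nat p * x) = N x / p"
begin

lemma p_ge_2: "p \<ge> 2"
  using prime prime_ge_2_nat by blast

lemma p_gt: "real p > 0" "real p > 1" "p > 0" "p > 1"
  using p_ge_2 by auto

lemma N_p_power: "N (of_nat p ^ i * x) = N x / real p ^ i"
  by (induction i) (auto simp: mult.assoc N_p)

lemma N_prime_power_add:
  assumes "N e \<le> c" "c \<le> d" "N v \<le> d"
  shows "N ((v + e) ^ p - (v ^ p + e ^ p)) \<le> c * d ^ (p - 1) / p"
proof -
  let ?c = "\<Sum>l\<in>{1..<p}. of_nat ((p choose l) div p) * (e ^ (l - 1) * v ^ (p - l))"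
  have d: "d \<ge> 0" using assms(3) N_nonneg[of v] by linarith
  have c: "N ?c \<le> d ^ (p - 1)"
  proof (rule N_sum)
    fix l assume l: "l \<in> {1..<p}"
    have "N (of_nat ((p choose l) div p) * (e ^ (l - 1) * v ^ (p - l))) \<le> N (e ^ (l - 1) * v ^ (p - l))"
      by (rule N_of_nat_mult)
    also have "\<dots> \<le> d ^ (l - 1) * d ^ (p - l)"
      by (intro N_mult_mono N_power_mono order_trans[OF assms(1,2)] assms(3))
    also have "\<dots> = d ^ (p - 1)" using l by (simp flip: power_add)
    finally show "N (of_nat ((p choose l) div p) * (e ^ (l - 1) * v ^ (p - l))) \<le> d ^ (p - 1)" .
  qed (use d in auto)
  have "(v + e) ^ p - (v ^ p + e ^ p) = of_nat p * (e * ?c)"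
    unfolding prime_power_add_expand[OF prime] by (simp add: mult.assoc)
  also have "N \<dots> = N (e * ?c) / p" by (rule N_p)
  also have "\<dots> \<le> (c * d ^ (p - 1)) / p"
    by (intro divide_right_mono N_mult_mono assms c) auto
  finally show ?thesis .
qed

text \<open>
  In the expansion of \<open>(v + e)\<^sup>p\<close>, the middle terms gain a factor \<open>p\<^sup>-\<^sup>1\<close> from the binomial coefficients,
  and \<open>e\<^sup>p\<close> is small enough since \<open>p \<ge> 2\<close>.
\<close>

lemma N_prime_power_diff:
  assumes "N (u - v) \<le> d / real p ^ Suc j" "N v \<le> d"
  shows "N (u ^ p - v ^ p) \<le> d ^ p / real p ^ Suc (Suc j)"
proof -
  have d: "d \<ge> 0" using assms(2) N_nonneg[of v] by linarith
  define e where "e = u - v"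
  have u: "u = v + e" by (simp add: e_def)
  have e: "N e \<le> d / real p ^ Suc j" using assms by (simp add: e_def)
  have "real p ^ Suc j \<ge> 1" using p_gt by (intro one_le_power) auto
  hence ed: "d / real p ^ Suc j \<le> d" using d by (simp add: divide_le_eq mult_left_mono[of 1 _ d, simplified])
  have "N ((v + e) ^ p - (v ^ p + e ^ p)) \<le> d / real p ^ Suc j * d ^ (p - 1) / p"
    by (rule N_prime_power_add[OF e ed assms(2)])
  also have "\<dots> = d ^ p / real p ^ Suc (Suc j)"
    using p_gt power_minus_mult[of p d] by (simp add: field_simps)
  finally have 1: "N ((v + e) ^ p - (v ^ p + e ^ p)) \<le> d ^ p / real p ^ Suc (Suc j)" .
  have "N (e ^ p) \<le> (d / real p ^ Suc j) ^ p"
    by (rule N_power_mono) fact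
  also have "\<dots> = d ^ p / real p ^ (Suc j * p)"
    by (simp only: power_divide power_mult)
  also have "\<dots> \<le> d ^ p / real p ^ Suc (Suc j)"
  proof (rule divide_left_mono)
    have "Suc (Suc j) \<le> Suc j * p" using mult_le_mono2[OF p_ge_2, of "Suc j"] by simp
    thus "real p ^ Suc (Suc j) \<le> real p ^ (Suc j * p)" using p_gt by (intro power_increasing) auto
  qed (use d p_gt in auto)
  finally have 2: "N (e ^ p) \<le> d ^ p / real p ^ Suc (Suc j)" .
  have "u ^ p - v ^ p = ((v + e) ^ p - (v ^ p + e ^ p)) + e ^ p"
    unfolding u by simp
  thus ?thesis using N_add[of "(v + e) ^ p - (v ^ p + e ^ p)" "e ^ p"] 1 2 by simp
qed

lemma N_power_diff:
  assumes "N (u - v) \<le> d / p" "N v \<le> d"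
  shows "N (u ^ p ^ j - v ^ p ^ j) \<le> d ^ p ^ j / real p ^ Suc j"
proof (induction j)
  case (Suc j)
  have "N ((u ^ p ^ j) ^ p - (v ^ p ^ j) ^ p) \<le> (d ^ p ^ j) ^ p / real p ^ Suc (Suc j)"
    by (rule N_prime_power_diff[OF Suc]) (rule N_power_mono, fact)
  thus ?case by (simp add: power_mult[symmetric] mult.commute)
qed (use assms in simp)

text \<open>
  The quantitative form of the criterion for congruence of Witt vectors modulo \<open>p\<close>. By induction,
  the components of index \<open>i < k\<close> differ by at most \<open>d\<^sub>i / p\<close>. Raising them to the power \<open>p\<^sup>k\<^sup>-\<^sup>i\<close> gains
  another factor \<open>p\<^sup>-\<^sup>k\<^sup>+\<^sup>i\<close>, so their contributions to the ghost components differ by at most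
  \<open>d\<^sub>k p\<^sup>-\<^sup>k\<^sup>-\<^sup>1\<close>. Then so do the contributions \<open>p\<^sup>k x\<^sub>k\<close> and \<open>p\<^sup>k y\<^sub>k\<close>.
\<close>

lemma N_diff_of_ghost_sum:
  assumes ghost: "\<And>k. k \<le> n \<Longrightarrow> N (ghost_sum p x k - ghost_sum p y k) \<le> d k / real p ^ Suc k"
    and y: "\<And>k. k \<le> n \<Longrightarrow> N (y k) \<le> d k"
    and d: "\<And>k. k < n \<Longrightarrow> d k ^ p \<le> d (Suc k)"
    and "k \<le> n"
  shows "N (x k - y k) \<le> d k / p"
  using \<open>k \<le> n\<close>
proof (induction k rule: less_induct)
  case (less k)
  have d0: "d i \<ge> 0" if "i \<le> n" for i using y[OF that] N_nonneg[of "y i"] by linarith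
  have dpow: "d i ^ p ^ j \<le> d (i + j)" if "i + j \<le> n" for i j
    using that
  proof (induction j)
    case (Suc j)
    have "d i ^ p ^ Suc j = (d i ^ p ^ j) ^ p" by (simp add: power_mult[symmetric] mult.commute)
    also have "\<dots> \<le> d (i + j) ^ p" using Suc d0[of i] by (intro power_mono) auto
    also have "\<dots> \<le> d (i + Suc j)" using Suc d[of "i + j"] by simp
    finally show ?case .
  qed simp
  have "N (\<Sum>i<k. of_nat p ^ i * (x i ^ p ^ (k - i) - y i ^ p ^ (k - i))) \<le> d k / real p ^ Suc k"
  proof (rule N_sum)
    fix i assume "i \<in> {..<k}"
    hence i: "i < k" by simp
    have "N (of_nat p ^ i * (x i ^ p ^ (k - i) - y i ^ p ^ (k - i))) =
        N (x i ^ p ^ (k - i) - y i ^ p ^ (k - i)) / real p ^ i"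
      by (simp add: N_p_power)
    also have "\<dots> \<le> (d i ^ p ^ (k - i) / real p ^ Suc (k - i)) / real p ^ i"
      by (intro divide_right_mono N_power_diff less.IH y) (use i less in auto)
    also have "\<dots> = d i ^ p ^ (k - i) / real p ^ Suc k"
      using i by (simp flip: power_add)
    also have "\<dots> \<le> d k / real p ^ Suc k"
      using dpow[of i "k - i"] i less by (intro divide_right_mono) auto
    finally show "N (of_nat p ^ i * (x i ^ p ^ (k - i) - y i ^ p ^ (k - i))) \<le> d k / real p ^ Suc k" .
  qed (use d0 less in auto)
  moreover have "of_nat p ^ k * (x k - y k) = (ghost_sum p x k - ghost_sum p y k) -
      (\<Sum>i<k. of_nat p ^ i * (x i ^ p ^ (k - i) - y i ^ p ^ (k - i)))"
    by (simp add: ghost_sum_split sum_subtractf right_diff_distrib)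
  ultimately have "N (of_nat p ^ k * (x k - y k)) \<le> d k / real p ^ Suc k"
    using ghost[OF less.prems] N_diff[of "ghost_sum p x k - ghost_sum p y k"
        "\<Sum>i<k. of_nat p ^ i * (x i ^ p ^ (k - i) - y i ^ p ^ (k - i))"] by simp
  hence "N (x k - y k) / real p ^ k \<le> (d k / p) / real p ^ k"
    by (simp add: N_p_power)
  thus ?case using p_gt by (simp only: divide_le_cancel) simp
qed

lemma eqv_p_cancel: "of_nat p ^ i * x \<approx> of_nat p ^ i * y \<Longrightarrow> x \<approx> y"
  using N_p_power[of i "x - y"] p_gt by (simp add: eqv_def algebra_simps)

lemma eqv_of_ghost_sum:
  assumes "\<And>k. k \<le> n \<Longrightarrow> ghost_sum p x k \<approx> ghost_sum p y k" "k \<le> n"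
  shows "x k \<approx> y k"
  using \<open>k \<le> n\<close>
proof (induction k rule: less_induct)
  case (less k)
  have "(\<Sum>i<k. of_nat p ^ i * x i ^ p ^ (k - i)) \<approx> (\<Sum>i<k. of_nat p ^ i * y i ^ p ^ (k - i))"
    by (intro eqv_sum eqv_mult eqv_power) (use less in auto)
  from eqv_diff[OF assms(1)[OF less.prems] this] have "of_nat p ^ k * x k \<approx> of_nat p ^ k * y k"
    by (simp add: ghost_sum_split)
  thus ?case by (rule eqv_p_cancel)
qed

end


section \<open>Sequences of \<open>p\<close>-power roots\<close>

text \<open>
  Limits and quotients by \<open>p\<close> exist only up to elements of seminorm zero, as \<open>N\<close> will be a seminorm on a
  polynomial ring that is pulled back from \<open>R\<close>.
\<close>

locale p_banach = p_seminorm N p for N :: "'r::comm_ring_1 \<Rightarrow> real" and p +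
  assumes complete: "(\<lambda>l. N (s (Suc l) - s l)) \<longlonglongrightarrow> 0 \<Longrightarrow> \<exists>z. tends s z"
    and p_divisible: "\<exists>y. of_nat p * y \<approx> x"

context p_seminorm
begin

text \<open>
  A sequence of \<open>p\<close>-power roots satisfies \<open>|s\<^sub>m| = |s\<^sub>0|\<close> to the \<open>1/p\<^sup>m\<close>, so natural bounds for sequences
  have the form \<open>B\<close> to the \<open>1/p\<^sup>m\<close>. Two sequences are close if their difference is smaller than such a
  bound by the factor \<open>p\<close>. Powers with exponent \<open>p\<^sup>m\<close> avoid the roots.
\<close>

definition pseq :: "(nat \<Rightarrow> 'r) \<Rightarrow> bool" where
  "pseq s \<longleftrightarrow> (\<forall>m. s (Suc m) ^ p \<approx> s m)"

definition pbounded :: "(nat \<Rightarrow> 'r) \<Rightarrow> bool" where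
  "pbounded a \<longleftrightarrow> (\<exists>B. \<forall>m. N (a m) ^ p ^ m \<le> B)"

definition pclose :: "(nat \<Rightarrow> 'r) \<Rightarrow> (nat \<Rightarrow> 'r) \<Rightarrow> bool" where
  "pclose a b \<longleftrightarrow> (\<exists>B. \<forall>m. (p * N (a m - b m)) ^ p ^ m \<le> B)"

lemma pseq_power: "pseq s \<Longrightarrow> s (m + l) ^ p ^ l \<approx> s m"
proof (induction l)
  case (Suc l)
  have "s (m + Suc l) ^ p ^ Suc l = (s (Suc (m + l)) ^ p) ^ p ^ l"
    by (simp add: power_mult)
  also have "\<dots> \<approx> s (m + l) ^ p ^ l"
    using Suc.prems by (intro eqv_power) (simp add: pseq_def)
  finally show ?case using Suc eqv_trans by blast
qed simp

lemma p_power_pos: "p ^ m > 0"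
  using p_gt by simp

lemma pseq_N: "pseq s \<Longrightarrow> N (s m) ^ p ^ m = N (s 0)"
  using eqv_N[OF pseq_power[of s 0 m]] N_power[OF p_power_pos, of "s m" m] by simp

lemma pseq_pbounded: "pseq s \<Longrightarrow> pbounded s"
  unfolding pbounded_def using pseq_N by auto

lemma pboundedI: "(\<And>m. N (a m) ^ p ^ m \<le> B) \<Longrightarrow> pbounded a"
  unfolding pbounded_def by blast

lemma pcloseI: "(\<And>m. (p * N (a m - b m)) ^ p ^ m \<le> B) \<Longrightarrow> pclose a b"
  unfolding pclose_def by blast

lemma max_power_le:
  fixes x y z :: real
  assumes "0 \<le> x" "x \<le> max y z" "y ^ n \<le> b" "z ^ n \<le> c" 
  shows "x ^ n \<le> max b c"
proof (cases "y \<le> z")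
  case True
  hence "x ^ n \<le> z ^ n" using assms by (intro power_mono) auto
  thus ?thesis using assms by simp
next
  case False
  hence "x ^ n \<le> y ^ n" using assms by (intro power_mono) auto
  thus ?thesis using assms by simp
qed

lemma pclose_refl: "(\<And>m. a m \<approx> b m) \<Longrightarrow> pclose a b"
  using p_power_pos by (intro pcloseI[of _ _ 0]) (simp add: eqv_def zero_power)

lemma pclose_sym: "pclose a b \<Longrightarrow> pclose b a"
  by (simp add: pclose_def N_commute)

lemma pclose_trans:
  assumes "pclose a b" "pclose b c"
  shows "pclose a c"
proof -
  obtain B C where B: "\<And>m. (p * N (a m - b m)) ^ p ^ m \<le> B" and C: "\<And>m. (p * N (b m - c m)) ^ p ^ m \<le> C"
    using assms unfolding pclose_def by auto
  show ?thesis
  proof (rule pcloseI)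
    fix m
    have "p * N (a m - c m) \<le> max (p * N (a m - b m)) (p * N (b m - c m))"
      using N_trans[of "a m" "c m" "b m"] p_gt by (simp add: max_def split: if_splits)
    from max_power_le[OF _ this B C] show "(p * N (a m - c m)) ^ p ^ m \<le> max B C" by simp
  qed
qed

lemma pclose_diff:
  assumes "pclose a a'" "pclose b b'"
  shows "pclose (\<lambda>m. a m - b m) (\<lambda>m. a' m - b' m)"
proof -
  obtain B C where B: "\<And>m. (p * N (a m - a' m)) ^ p ^ m \<le> B" and C: "\<And>m. (p * N (b m - b' m)) ^ p ^ m \<le> C"
    using assms unfolding pclose_def by auto
  show ?thesis
  proof (rule pcloseI)
    fix m
    have "p * N ((a m - b m) - (a' m - b' m)) \<le> max (p * N (a m - a' m)) (p * N (b m - b' m))"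
      using N_diff[of "a m - a' m" "b m - b' m"] p_gt by (simp add: max_def algebra_simps split: if_splits)
    from max_power_le[OF _ this B C] show "(p * N (a m - b m - (a' m - b' m))) ^ p ^ m \<le> max B C" by simp
  qed
qed

lemma pclose_uminus: "pclose a b \<Longrightarrow> pclose (\<lambda>m. - a m) (\<lambda>m. - b m)"
  using pclose_diff[OF pclose_refl, of "\<lambda>_. 0" "\<lambda>_. 0" a b] by simp

lemma pclose_add: "pclose a a' \<Longrightarrow> pclose b b' \<Longrightarrow> pclose (\<lambda>m. a m + b m) (\<lambda>m. a' m + b' m)"
  using pclose_diff[OF _ pclose_uminus, of a a' b b'] by simp

lemma pbounded_diff:
  assumes "pbounded a" "pbounded b"
  shows "pbounded (\<lambda>m. a m - b m)"
proof -
  obtain B C where "\<And>m. N (a m) ^ p ^ m \<le> B" "\<And>m. N (b m) ^ p ^ m \<le> C"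
    using assms unfolding pbounded_def by auto
  from max_power_le[OF _ N_diff this] show ?thesis by (intro pboundedI) auto
qed

lemma pbounded_const: "N a \<le> 1 \<Longrightarrow> pbounded (\<lambda>_. a)"
  by (rule pboundedI[of _ 1]) (simp add: power_le_one)

lemma pbounded_add: "pbounded a \<Longrightarrow> pbounded b \<Longrightarrow> pbounded (\<lambda>m. a m + b m)"
  using pbounded_diff[of a "\<lambda>m. 0 - b m"] pbounded_diff[OF pbounded_const[of 0], of b] by simp

lemma mult_power_le:
  fixes x y :: real
  assumes "0 \<le> x" "0 \<le> y" "x ^ n \<le> b" "y ^ n \<le> c"
  shows "(x * y) ^ n \<le> b * c"
  unfolding power_mult_distrib
  using assms order_trans[OF zero_le_power[OF assms(1)] assms(3)] by (intro mult_mono) auto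

lemma pclose_pbounded:
  assumes "pclose a b" "pbounded b"
  shows "pbounded a"
proof -
  obtain B C where B: "\<And>m. (p * N (a m - b m)) ^ p ^ m \<le> B" and C: "\<And>m. N (b m) ^ p ^ m \<le> C"
    using assms unfolding pclose_def pbounded_def by auto
  have "N (a m - b m) ^ p ^ m \<le> B" for m
  proof (rule order_trans[OF power_mono B])
    show "N (a m - b m) \<le> p * N (a m - b m)"
      using mult_right_mono[of 1 "real p" "N (a m - b m)"] p_gt by auto
  qed auto
  from max_power_le[OF N_nonneg _ this C] N_add[of "a m - b m" "b m" for m] show ?thesis
    by (intro pboundedI) auto
qed

lemma pclose_mult:
  assumes "pclose a a'" "pclose b b'" "pbounded a'" "pbounded b'"
  shows "pclose (\<lambda>m. a m * b m) (\<lambda>m. a' m * b' m)"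
proof -
  have "pbounded b" using assms pclose_pbounded by blast
  then obtain B A' C D where
    B: "\<And>m. (p * N (a m - a' m)) ^ p ^ m \<le> B" and C: "\<And>m. (p * N (b m - b' m)) ^ p ^ m \<le> C" and
    A': "\<And>m. N (a' m) ^ p ^ m \<le> A'" and D: "\<And>m. N (b m) ^ p ^ m \<le> D"
    using assms unfolding pclose_def pbounded_def by metis
  show ?thesis
  proof (rule pcloseI)
    fix m
    have "a m * b m - a' m * b' m = (a m - a' m) * b m + a' m * (b m - b' m)" by (simp add: algebra_simps)
    hence "N (a m * b m - a' m * b' m) \<le> max (N (a m - a' m) * N (b m)) (N (a' m) * N (b m - b' m))"
      using N_add[of "(a m - a' m) * b m" "a' m * (b m - b' m)"] N_mult[of "a m - a' m" "b m"]
        N_mult[of "a' m" "b m - b' m"] by (simp add: max_def split: if_splits)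
    hence "p * N (a m * b m - a' m * b' m) \<le>
        p * max (N (a m - a' m) * N (b m)) (N (a' m) * N (b m - b' m))"
      by (rule mult_left_mono) auto
    also have "\<dots> = max (p * N (a m - a' m) * N (b m)) (N (a' m) * (p * N (b m - b' m)))"
      using p_gt by (simp add: max_mult_distrib_left max_def)
    finally show "(p * N (a m * b m - a' m * b' m)) ^ p ^ m \<le> max (B * D) (A' * C)"
      by (intro max_power_le[of _ "p * N (a m - a' m) * N (b m)" "N (a' m) * (p * N (b m - b' m))"]
        mult_power_le A' B C D) auto
  qed
qed

lemma le_max_1_of_power_le:
  fixes x :: real
  assumes "x ^ n \<le> b" "n > 0"
  shows "x \<le> max 1 b"
proof (cases "x \<le> 1")
  case False
  hence "x ^ 1 \<le> x ^ n" using assms by (intro power_increasing) auto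
  thus ?thesis using assms by simp
qed simp

text \<open>
  Raising to the power \<open>p\<^sup>l\<close> decreases the distance relative to the bounds by a factor \<open>p\<^sup>l\<close>.
\<close>

lemma pclose_power:
  assumes "pclose a b" "pbounded b"
  shows "\<exists>B. \<forall>m l. (p ^ Suc l * N (a (m + l) ^ p ^ l - b (m + l) ^ p ^ l)) ^ p ^ m \<le> B"
proof -
  obtain B C where B: "\<And>m. (p * N (a m - b m)) ^ p ^ m \<le> B" and C: "\<And>m. N (b m) ^ p ^ m \<le> C"
    using assms unfolding pclose_def pbounded_def by auto
  have "(p ^ Suc l * N (a (m + l) ^ p ^ l - b (m + l) ^ p ^ l)) ^ p ^ m \<le> max B C" for m l
  proof -
    define d where "d = max (p * N (a (m + l) - b (m + l))) (N (b (m + l)))"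
    have "N (a (m + l) ^ p ^ l - b (m + l) ^ p ^ l) \<le> d ^ p ^ l / real p ^ Suc l"
      by (rule N_power_diff) (use p_gt in \<open>auto simp: d_def le_divide_eq mult.commute\<close>)
    hence "p ^ Suc l * N (a (m + l) ^ p ^ l - b (m + l) ^ p ^ l) \<le> d ^ p ^ l"
      using p_gt by (simp add: field_simps)
    hence "(p ^ Suc l * N (a (m + l) ^ p ^ l - b (m + l) ^ p ^ l)) ^ p ^ m \<le> (d ^ p ^ l) ^ p ^ m"
      by (intro power_mono) auto
    also have "\<dots> = d ^ p ^ (m + l)" by (simp add: power_mult[symmetric] power_add mult.commute)
    also have "\<dots> \<le> max B C"
      by (rule max_power_le[OF _ _ B C]) (auto simp: d_def le_max_iff_disj)
    finally show ?thesis .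
  qed
  thus ?thesis by blast
qed

lemma pclose_power_le:
  assumes "pclose a b" "pbounded b"
  shows "\<exists>B. \<forall>m l. N (a (m + l) ^ p ^ l - b (m + l) ^ p ^ l) \<le> B / real p ^ Suc l"
proof -
  obtain B where "\<And>m l. (p ^ Suc l * N (a (m + l) ^ p ^ l - b (m + l) ^ p ^ l)) ^ p ^ m \<le> B"
    using pclose_power[OF assms] by blast
  from le_max_1_of_power_le[OF this p_power_pos]
  have "N (a (m + l) ^ p ^ l - b (m + l) ^ p ^ l) \<le> max 1 B / real p ^ Suc l" for m l
    using p_gt by (subst pos_le_divide_eq) (auto simp: mult.commute)
  thus ?thesis by blast
qed

lemma p_power_tendsto_0: "(\<lambda>l. B / real p ^ Suc l) \<longlonglongrightarrow> 0"
proof -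
  have "(\<lambda>l. B * inverse (real p) ^ Suc l) \<longlonglongrightarrow> B * 0"
    by (intro tendsto_mult tendsto_const LIMSEQ_Suc LIMSEQ_power_zero) (use p_gt in \<open>simp add: field_simps\<close>)
  thus ?thesis by (simp add: field_simps power_inverse)
qed

text \<open>
  Since \<open>(a + b)\<^sup>p\<close> and \<open>a\<^sup>p + b\<^sup>p\<close> are congruent modulo \<open>p\<close>, the termwise sum of two sequences of \<open>p\<close>-power
  roots is close to its own shifted \<open>p\<close>-th power. This is why the limits that define the addition of
  \<open>R'\<close> exist.
\<close>

lemma pclose_prime_power_add:
  assumes "pbounded a" "pbounded b"
  shows "pclose (\<lambda>m. (a (Suc m) + b (Suc m)) ^ p) (\<lambda>m. a (Suc m) ^ p + b (Suc m) ^ p)"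
proof -
  obtain B C where B: "\<And>m. N (a m) ^ p ^ m \<le> B" and C: "\<And>m. N (b m) ^ p ^ m \<le> C"
    using assms unfolding pbounded_def by auto
  show ?thesis
  proof (rule pcloseI)
    fix m
    define d where "d = max (N (a (Suc m))) (N (b (Suc m)))"
    have d: "d \<ge> 0" by (simp add: d_def le_max_iff_disj)
    have "N ((a (Suc m) + b (Suc m)) ^ p - (a (Suc m) ^ p + b (Suc m) ^ p)) \<le> d * d ^ (p - 1) / p"
      by (rule N_prime_power_add) (auto simp: d_def)
    also have "d * d ^ (p - 1) = d ^ p" using p_gt by (simp add: power_eq_if)
    finally have "p * N ((a (Suc m) + b (Suc m)) ^ p - (a (Suc m) ^ p + b (Suc m) ^ p)) \<le> d ^ p"
      using p_gt by (simp only: pos_le_divide_eq mult.commute)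
    hence "(p * N ((a (Suc m) + b (Suc m)) ^ p - (a (Suc m) ^ p + b (Suc m) ^ p))) ^ p ^ m \<le> (d ^ p) ^ p ^ m"
      by (intro power_mono) auto
    also have "(d ^ p) ^ p ^ m = d ^ p ^ Suc m" by (simp add: power_mult)
    also have "\<dots> \<le> max B C"
      using d by (rule max_power_le[OF _ _ B C]) (simp add: d_def)
    finally show "(p * N ((a (Suc m) + b (Suc m)) ^ p - (a (Suc m) ^ p + b (Suc m) ^ p))) ^ p ^ m \<le> max B C" .
  qed
qed

text \<open>
  As powers with exponent \<open>p\<^sup>l\<close> contract distances, a sequence of \<open>p\<close>-power roots can be recovered from
  any sequence close to it.
\<close>

lemma pseq_limit:
  assumes "pseq s" "pclose s a" "pbounded a"
  shows "tends (\<lambda>l. a (m + l) ^ p ^ l) (s m)"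
proof -
  obtain B where B: "\<And>m l. N (s (m + l) ^ p ^ l - a (m + l) ^ p ^ l) \<le> B / real p ^ Suc l"
    using pclose_power_le[OF assms(2,3)] by blast
  have B': "N (a (m + l) ^ p ^ l - s (m + l) ^ p ^ l) \<le> B / real p ^ Suc l" for l
    using B[of m l] by (simp add: N_commute)
  have "N (a (m + l) ^ p ^ l - s m) \<le> B / real p ^ Suc l" for l
    using eqv_N[OF eqv_diff[OF eqv_refl pseq_power[OF assms(1)]], of "a (m + l) ^ p ^ l" m l] B'[of l] by simp
  thus ?thesis using p_power_tendsto_0 by (rule tendsI)
qed

lemma pseq_unique:
  assumes "pseq s" "pseq t" "pclose s t"
  shows "s m \<approx> t m"
proof (rule tends_unique)
  show "tends (\<lambda>l. t (m + l) ^ p ^ l) (s m)" "tends (\<lambda>l. t (m + l) ^ p ^ l) (t m)"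
    using assms pseq_pbounded pclose_refl by (auto intro!: pseq_limit)
qed

end

context p_banach
begin

lemma pseq_exists:
  assumes "pbounded a" "pclose (\<lambda>m. a (Suc m) ^ p) a"
  shows "\<exists>s. pseq s \<and> pclose s a"
proof -
  have step: "(a (Suc (m + l)) ^ p) ^ p ^ l = a (m + Suc l) ^ p ^ Suc l" for m l
    by (simp add: power_mult)
  have "\<exists>z. tends (\<lambda>l. a (m + l) ^ p ^ l) z" for m
  proof (rule complete)
    obtain B where B: "\<And>l. N (a (m + Suc l) ^ p ^ Suc l - a (m + l) ^ p ^ l) \<le> B / real p ^ Suc l"
      using pclose_power_le[OF assms(2,1)] unfolding step by blast
    show "(\<lambda>l. N (a (m + Suc l) ^ p ^ Suc l - a (m + l) ^ p ^ l)) \<longlonglongrightarrow> 0"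
      by (rule tendsto_sandwich[OF _ _ tendsto_const p_power_tendsto_0[of B]]) (use B in auto)
  qed
  then obtain s where s: "\<And>m. tends (\<lambda>l. a (m + l) ^ p ^ l) (s m)" by metis
  have "pseq s"
    unfolding pseq_def
  proof
    fix m
    have "tends (\<lambda>l. (a (Suc m + l) ^ p ^ l) ^ p) (s (Suc m) ^ p)"
      by (intro tends_power s)
    moreover have "tends (\<lambda>l. a (m + Suc l) ^ p ^ Suc l) (s m)"
      using tends_subseq[OF s[of m], of Suc] by (simp add: strict_mono_def)
    ultimately show "s (Suc m) ^ p \<approx> s m"
      by (intro tends_unique[of "\<lambda>l. a (m + Suc l) ^ p ^ Suc l"])
        (simp_all add: power_mult[symmetric] mult.commute)
  qed
  moreover have "pclose s a"
  proof -
    obtain B where B: "\<And>m l. (p ^ Suc l * N (a (m + Suc l) ^ p ^ Suc l - a (m + l) ^ p ^ l)) ^ p ^ m \<le> B"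
      using pclose_power[OF assms(2,1)] unfolding step by blast
    have B0: "B \<ge> 0" using B[of 0 0] by (smt (verit) N_nonneg mult_nonneg_nonneg of_nat_0_le_iff zero_le_power)
    have le_root: "x \<le> root (p ^ m) B" if "x ^ p ^ m \<le> B" "x \<ge> 0" for x m
      using real_root_le_mono[OF p_power_pos that(1), of m] real_root_power_cancel[OF p_power_pos that(2), of m]
      by simp
    have *: "N (a (m + l) ^ p ^ l - a m) \<le> root (p ^ m) B / p" for m l
    proof (induction l)
      case (Suc l)
      have "p ^ Suc l * N (a (m + Suc l) ^ p ^ Suc l - a (m + l) ^ p ^ l) \<le> root (p ^ m) B"
        using B by (rule le_root) auto
      moreover have "p * N (a (m + Suc l) ^ p ^ Suc l - a (m + l) ^ p ^ l) \<le>
         p ^ Suc l * N (a (m + Suc l) ^ p ^ Suc l - a (m + l) ^ p ^ l)"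
        using p_gt by (intro mult_right_mono) (auto simp: one_le_power)
      ultimately have "p * N (a (m + Suc l) ^ p ^ Suc l - a (m + l) ^ p ^ l) \<le> root (p ^ m) B"
        by linarith
      hence "N (a (m + Suc l) ^ p ^ Suc l - a (m + l) ^ p ^ l) \<le> root (p ^ m) B / p"
        using p_gt by (simp only: pos_le_divide_eq mult.commute)
      thus ?case using Suc N_trans[of "a (m + Suc l) ^ p ^ Suc l" "a m" "a (m + l) ^ p ^ l"] by simp
    qed (use real_root_ge_zero[OF B0, of "p ^ m"] in simp)
    show ?thesis
    proof (rule pcloseI)
      fix m
      have "N (s m - a m) \<le> root (p ^ m) B / p"
        by (rule tends_le[OF s]) (use * in auto)
      hence "p * N (s m - a m) \<le> root (p ^ m) B" using p_gt by (simp add: field_simps)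
      hence "(p * N (s m - a m)) ^ p ^ m \<le> root (p ^ m) B ^ p ^ m" by (intro power_mono) auto
      thus "(p * N (s m - a m)) ^ p ^ m \<le> B" using B0 p_power_pos by simp
    qed
  qed
  ultimately show ?thesis by blast
qed

end


section \<open>Ghost components and expansions in powers of \<open>p\<close>\<close>

subsection \<open>Growth conditions\<close>

text \<open>
  Monotonicity lets the bound \<open>G\<^sub>k\<close> serve for all components of index at most \<open>k\<close>. For \<open>c \<le> p\<close>, the
  bound for the ratios makes the terms of a series in \<open>p\<^sup>k\<close> with coefficients bounded by \<open>G\<^sub>k\<close> decrease,
  so that each tail is bounded by its first term.
\<close>

definition envelope :: "real \<Rightarrow> (nat \<Rightarrow> real) \<Rightarrow> bool" where
  "envelope c G \<longleftrightarrow> (\<forall>k. 0 \<le> G k \<and> G k \<le> G (Suc k) \<and> G (Suc k) \<le> c * G k) \<and> (\<lambda>k. G k / c ^ k) \<longlonglongrightarrow> 0"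

text \<open>
  Take \<open>G\<^sub>k = c\<^sup>k g\<^sub>k\<close>, where \<open>g\<^sub>k\<close> is the supremum of all later values of \<open>H\<^sub>l / c\<^sup>l\<close>: the ratio bound is the
  monotonicity of \<open>g\<close>. The last property of \<open>G\<close> says that the supremum of \<open>H\<^sub>n / c\<^sup>n\<close> has not increased,
  which is needed for the isometry.
\<close>

lemma envelope_exists:
  assumes c: "c > 1" and H0: "\<And>n. H n \<ge> 0" and mono: "\<And>n. H n \<le> H (Suc n)"
    and lim: "(\<lambda>n. H n / c ^ n) \<longlonglongrightarrow> 0"
  obtains G where "envelope c G" "\<And>n. H n \<le> G n"
    "\<And>M n. (\<And>l. H l / c ^ l \<le> M) \<Longrightarrow> G n / c ^ n \<le> M"
proof -
  define h where "h n = H n / c ^ n" for n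
  define g where "g k = (SUP l. h (k + l))" for k
  have h0: "h n \<ge> 0" for n using H0 c by (simp add: h_def)
  have "bdd_above (range h)"
    using lim[folded h_def] by (intro Bseq_bdd_above convergent_imp_Bseq) (auto simp: convergent_def)
  hence bdd: "bdd_above (range (\<lambda>l. h (k + l)))" for k
    by (rule bdd_above_mono) auto
  have g_ge: "h n \<le> g k" if "k \<le> n" for k n
    using cSUP_upper[OF UNIV_I bdd[of k], of "n - k"] that by (simp add: g_def)
  have g_le: "g k \<le> M" if "\<And>n. n \<ge> k \<Longrightarrow> h n \<le> M" for k M
    unfolding g_def by (rule cSUP_least) (use that in auto)
  have g0: "g k \<ge> 0" for k using order_trans[OF h0 g_ge[of k k]] by simp
  have g_dec: "g (Suc k) \<le> g k" for k by (rule g_le) (use g_ge in auto)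
  define G where "G k = c ^ k * g k" for k
  have Gg: "G k / c ^ k = g k" for k using c by (simp add: G_def)
  have HG: "H n \<le> G k" if "n \<le> k" for n k
  proof -
    have "H n \<le> H k" using mono that by (rule lift_Suc_mono_le)
    also have "H k = c ^ k * h k" using c by (simp add: h_def)
    also have "\<dots> \<le> G k" unfolding G_def using c g_ge[of k k] by (intro mult_left_mono) auto
    finally show ?thesis .
  qed
  have G_inc: "G k \<le> G (Suc k)" for k
  proof -
    have "g k \<le> G (Suc k) / c ^ k"
    proof (rule g_le)
      fix n assume "n \<ge> k"
      show "h n \<le> G (Suc k) / c ^ k"
      proof (cases "n = k")
        case True
        thus ?thesis using HG[of k "Suc k"] c by (simp add: h_def divide_right_mono)
      next
        case False
        hence "h n \<le> g (Suc k)" using \<open>n \<ge> k\<close> by (intro g_ge) auto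
        also have "\<dots> \<le> c * g (Suc k)" using c g0[of "Suc k"] mult_right_mono[of 1 c "g (Suc k)"] by simp
        also have "\<dots> = G (Suc k) / c ^ k" using c by (simp add: G_def)
        finally show ?thesis .
      qed
    qed
    thus ?thesis using c by (simp add: G_def field_simps)
  qed
  have "g \<longlonglongrightarrow> 0"
  proof (rule LIMSEQ_I)
    fix e :: real assume "e > 0"
    then obtain K where K: "\<And>n. n \<ge> K \<Longrightarrow> norm (h n - 0) < e / 2"
      using LIMSEQ_D[OF lim[folded h_def], of "e / 2"] by auto
    have "g k < e" if "k \<ge> K" for k
    proof -
      have "g k \<le> e / 2"
      proof (rule g_le)
        fix n assume "n \<ge> k"
        with that have "n \<ge> K" by simp
        from K[OF this] show "h n \<le> e / 2" using h0[of n] by simp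
      qed
      thus ?thesis using \<open>e > 0\<close> by simp
    qed
    thus "\<exists>K. \<forall>k\<ge>K. norm (g k - 0) < e" using g0 by (intro exI[of _ K]) auto
  qed
  hence "envelope c G"
    unfolding envelope_def Gg using G_inc g0 g_dec c by (auto simp: G_def)
  moreover have "H n \<le> G n" for n by (rule HG) simp
  moreover have "G n / c ^ n \<le> M" if "\<And>l. H l / c ^ l \<le> M" for M n
    unfolding Gg by (rule g_le) (use that in \<open>simp add: h_def\<close>)
  ultimately show ?thesis using that by blast
qed

lemma envelope_mono:
  assumes "envelope c G" "1 < c" "c \<le> d"
  shows "envelope d G"
proof -
  have G: "0 \<le> G k" for k using assms(1) by (simp add: envelope_def)
  have "G k / d ^ k \<le> G k / c ^ k" for k
    using assms G[of k] by (intro divide_left_mono power_mono mult_pos_pos zero_less_power) auto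
  hence "(\<lambda>k. G k / d ^ k) \<longlonglongrightarrow> 0"
    using assms G unfolding envelope_def
    by (intro tendsto_sandwich[of "\<lambda>_. 0" "\<lambda>k. G k / d ^ k" sequentially "\<lambda>k. G k / c ^ k" 0])
      (auto intro!: always_eventually)
  moreover have "c * G k \<le> d * G k" for k using assms G by (intro mult_right_mono) auto
  ultimately show ?thesis using assms(1) unfolding envelope_def by (meson order_trans)
qed

lemma envelope_add:
  assumes "envelope c G" "envelope c G'"
  shows "envelope c (\<lambda>k. G k + G' k)"
  using assms tendsto_add[of "\<lambda>k. G k / c ^ k" 0 sequentially "\<lambda>k. G' k / c ^ k" 0]
  unfolding envelope_def by (simp add: add_divide_distrib distrib_left) (meson add_mono)

lemma envelope_incr: "envelope c G \<Longrightarrow> k \<le> l \<Longrightarrow> G k \<le> G l"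
  by (rule lift_Suc_mono_le[of G]) (auto simp: envelope_def)

lemma envelope_add_le:
  assumes "envelope c G" "c > 0"
  shows "G (k + l) \<le> c ^ l * G k"
proof (induction l)
  case (Suc l)
  have "G (k + Suc l) \<le> c * G (k + l)" using assms(1) by (simp add: envelope_def)
  also have "\<dots> \<le> c * (c ^ l * G k)" using Suc assms(2) by (intro mult_left_mono) auto
  finally show ?case by (simp add: mult.assoc)
qed simp

lemma envelope_nonneg: "envelope c G \<Longrightarrow> 0 \<le> G k"
  by (simp add: envelope_def)

context p_banach
begin

abbreviation rt :: "nat \<Rightarrow> real \<Rightarrow> real" where
  "rt m \<equiv> root (p ^ m)"

lemma rt_le: "x ^ p ^ m \<le> b \<Longrightarrow> 0 \<le> x \<Longrightarrow> x \<le> rt m b"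
  using real_root_le_mono[OF p_power_pos, of "x ^ p ^ m" b m] real_root_power_cancel[OF p_power_pos, of x m]
  by simp

lemma rt_mono: "x \<le> y \<Longrightarrow> rt m x \<le> rt m y"
  using real_root_le_mono[OF p_power_pos] .

lemma rt_nonneg: "0 \<le> x \<Longrightarrow> 0 \<le> rt m x"
  by (rule real_root_ge_zero)

lemma rt_mult_le:
  assumes "a \<ge> 1" "x \<ge> 0"
  shows "rt m (a * x) \<le> a * rt m x"
proof -
  have "a ^ 1 \<le> a ^ p ^ m" using assms p_power_pos by (intro power_increasing) (auto simp: Suc_leI)
  hence "rt m a \<le> rt m (a ^ p ^ m)" by (intro rt_mono) simp
  also have "\<dots> = a" using assms p_power_pos by (simp add: real_root_power_cancel)
  finally show ?thesis
    using rt_nonneg[OF assms(2)] by (simp add: real_root_mult mult_right_mono)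
qed

lemma rt_add_power:
  assumes "0 \<le> x"
  shows "rt (m + j) x ^ p ^ j = rt m x"
proof -
  have "rt (m + j) x = root (p ^ j) (rt m x)"
    by (simp add: power_add real_root_mult_exp mult.commute)
  thus ?thesis using rt_nonneg[OF assms] p_power_pos by simp
qed

lemma rt_tendsto_0: "s \<longlonglongrightarrow> 0 \<Longrightarrow> (\<lambda>n. rt m (s n)) \<longlonglongrightarrow> 0"
  using tendsto_real_root[of s 0 sequentially "p ^ m"] by simp

lemma rt_div_p:
  assumes "x \<ge> 0"
  shows "rt m x / real p ^ k \<le> rt m (x / real p ^ k)"
proof -
  have "rt m (real p ^ k * (x / real p ^ k)) \<le> real p ^ k * rt m (x / real p ^ k)"
    using p_gt assms by (intro rt_mult_le) (auto simp: one_le_power)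
  thus ?thesis using p_gt by (simp add: field_simps)
qed

lemma envelope_rt_tendsto_0:
  assumes "envelope p G"
  shows "(\<lambda>k. rt m (G (j + k)) / real p ^ k) \<longlonglongrightarrow> 0"
proof -
  have lim: "(\<lambda>k. G (j + k) / real p ^ k) \<longlonglongrightarrow> 0"
  proof -
    have "(\<lambda>k. real p ^ j * (G (j + k) / real p ^ (j + k))) \<longlonglongrightarrow> real p ^ j * 0"
      using assms LIMSEQ_ignore_initial_segment[of "\<lambda>k. G k / real p ^ k" 0 j]
      by (intro tendsto_mult tendsto_const) (simp add: envelope_def add.commute)
    thus ?thesis using p_gt by (simp add: power_add)
  qed
  show ?thesis
    by (rule tendsto_sandwich[OF _ _ tendsto_const rt_tendsto_0[OF lim, of m]])
      (use envelope_nonneg[OF assms] rt_div_p rt_nonneg p_gt in \<open>auto intro!: always_eventually\<close>)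
qed

lemma series_converges:
  assumes "(\<lambda>k. N (t k)) \<longlonglongrightarrow> 0"
  shows "\<exists>z. tends (\<lambda>K. \<Sum>k<K. t k) z"
  by (rule complete) (use assms in simp)

lemma series_tail:
  assumes "tends (\<lambda>K. \<Sum>k<K. t k) z" "\<And>k. K \<le> k \<Longrightarrow> N (t k) \<le> b" "0 \<le> b"
  shows "N (z - (\<Sum>k<K. t k)) \<le> b"
proof (rule tends_le[OF assms(1)])
  show "eventually (\<lambda>l. N ((\<Sum>k<l. t k) - (\<Sum>k<K. t k)) \<le> b) sequentially"
    using eventually_ge_at_top[of K]
  proof eventually_elim
    case (elim l)
    have "(\<Sum>k<l. t k) - (\<Sum>k<K. t k) = (\<Sum>k\<in>{K..<l}. t k)"
      using sum_diff_nat_ivl[of 0 K l t] elim by (simp add: lessThan_atLeast0)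
    thus ?case using assms(2,3) by (auto intro!: N_sum)
  qed
qed

subsection \<open>The two descriptions\<close>

text \<open>
  Elements of the inverse limit for \<open>R\<close> are families \<open>x\<close> with shifted ghost components. Elements of
  the inverse limit for \<open>R'\<close> are, by taking first entries, families \<open>y\<close> with
  \<open>y\<^sub>n\<^sub>+\<^sub>1\<^sub>,\<^sub>k\<^sup>p = y\<^sub>n\<^sub>,\<^sub>k\<close>. Equalities only hold up to elements of seminorm zero.
\<close>

definition xfam :: "(nat \<Rightarrow> nat \<Rightarrow> 'r) \<Rightarrow> bool" where
  "xfam x \<longleftrightarrow> (\<forall>n k. k \<le> n \<longrightarrow> ghost_sum p (x n) k \<approx> ghost_sum p (x (Suc n)) (Suc k))"

definition yfam :: "(nat \<Rightarrow> nat \<Rightarrow> 'r) \<Rightarrow> bool" where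
  "yfam y \<longleftrightarrow> (\<forall>n k. k \<le> n \<longrightarrow> y (Suc n) k ^ p \<approx> y n k)"

text \<open>
  In the case of \<open>yfam y\<close> the left-hand side is \<open>|y\<^sub>k\<^sub>,\<^sub>k|\<close> for all \<open>n\<close>, so a bound in terms of \<open>k\<close> alone is natural.
\<close>

definition bnd :: "(nat \<Rightarrow> real) \<Rightarrow> (nat \<Rightarrow> nat \<Rightarrow> 'r) \<Rightarrow> bool" where
  "bnd G y \<longleftrightarrow> (\<forall>n k. k \<le> n \<longrightarrow> N (y n k) ^ p ^ (n - k) \<le> G k)"

definition psum :: "(nat \<Rightarrow> nat \<Rightarrow> 'r) \<Rightarrow> nat \<Rightarrow> nat \<Rightarrow> 'r" where
  "psum y m K = (\<Sum>k<K. of_nat p ^ k * y (m + k) k)"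

text \<open>
  An element of the inverse limit over \<open>R\<close> is determined by its first components, so this determines \<open>x\<close>.
\<close>

definition rel :: "(nat \<Rightarrow> nat \<Rightarrow> 'r) \<Rightarrow> (nat \<Rightarrow> nat \<Rightarrow> 'r) \<Rightarrow> bool" where
  "rel y x \<longleftrightarrow> (\<forall>m. tends (psum y m) (x m 0))"

lemma yfam_power: "yfam y \<Longrightarrow> k \<le> n \<Longrightarrow> y (n + l) k ^ p ^ l \<approx> y n k"
proof (induction l)
  case (Suc l)
  have "y (n + Suc l) k ^ p ^ Suc l = (y (Suc (n + l)) k ^ p) ^ p ^ l"
    by (simp add: power_mult)
  also have "\<dots> \<approx> y (n + l) k ^ p ^ l"
    using Suc.prems by (intro eqv_power) (simp add: yfam_def)
  finally show ?case using Suc eqv_trans by blast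
qed simp

lemma xfam_ghost:
  assumes "xfam x" "k \<le> n"
  shows "ghost_sum p (x n) k \<approx> x (n - k) 0"
  using assms(2)
proof (induction k)
  case (Suc k)
  then obtain n' where n: "n = Suc n'" by (cases n) auto
  have *: "ghost_sum p (x (n - Suc i)) (k - i) \<approx> ghost_sum p (x (n - i)) (Suc k - i)" if "i \<le> k" for i
  proof -
    have "n - i = Suc (n - Suc i)" "Suc k - i = Suc (k - i)" "k - i \<le> n - Suc i"
      using that Suc.prems by auto
    thus ?thesis
      using assms(1)[unfolded xfam_def, rule_format, of "k - i" "n - Suc i"] by simp
  qed
  have "ghost_sum p (x (n - i)) (Suc k - i) \<approx> ghost_sum p (x n) (Suc k)" if "i \<le> Suc k" for i
    using that
  proof (induction i)
    case (Suc i)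
    have "ghost_sum p (x (n - Suc i)) (Suc k - Suc i) \<approx> ghost_sum p (x (n - i)) (Suc k - i)"
      using *[of i] Suc.prems by simp
    also have "\<dots> \<approx> ghost_sum p (x n) (Suc k)" using Suc by simp
    finally show ?case .
  qed simp
  from eqv_sym[OF this[of "Suc k"]] show ?case by simp
qed simp

lemma ghost_sum_yfam:
  assumes "yfam y" "k \<le> n"
  shows "ghost_sum p (y n) k \<approx> psum y (n - k) (Suc k)"
proof -
  have "y n i ^ p ^ (k - i) \<approx> y (n - k + i) i" if "i \<le> k" for i
  proof -
    have "y (n - k + i + (k - i)) i ^ p ^ (k - i) \<approx> y (n - k + i) i"
      by (rule yfam_power[OF assms(1)]) simp
    thus ?thesis using that assms by simp
  qed
  thus ?thesis
    unfolding ghost_sum_def psum_def lessThan_Suc_atMost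
    by (intro eqv_sum eqv_mult) auto
qed

lemma bnd_rt:
  assumes "bnd G y"
  shows "N (y (m + k) k) \<le> rt m (G k)"
proof -
  have "N (y (m + k) k) ^ p ^ m \<le> G k"
    using assms unfolding bnd_def by (metis add_diff_cancel_right' le_add2)
  thus ?thesis by (intro rt_le) auto
qed

lemma psum_converges:
  assumes "bnd G y" "envelope p G"
  shows "\<exists>z. tends (psum y m) z"
  unfolding psum_def
proof (rule series_converges)
  show "(\<lambda>k. N (of_nat p ^ k * y (m + k) k)) \<longlonglongrightarrow> 0"
  proof (rule tendsto_sandwich[OF _ _ tendsto_const envelope_rt_tendsto_0[OF assms(2), of m 0]])
    show "eventually (\<lambda>k. N (of_nat p ^ k * y (m + k) k) \<le> rt m (G (0 + k)) / real p ^ k) sequentially"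
      using bnd_rt[OF assms(1)] by (intro always_eventually) (auto simp: N_p_power divide_right_mono)
  qed auto
qed

text \<open>
  The bound for the ratios of \<open>G\<close> makes the bounds for the terms of the series decrease.
\<close>

lemma psum_tail:
  assumes "bnd G y" "envelope p G" "tends (psum y m) z"
  shows "N (z - psum y m K) \<le> rt m (G K) / real p ^ K"
  unfolding psum_def
proof (rule series_tail)
  fix k assume k: "K \<le> k"
  have "N (of_nat p ^ k * y (m + k) k) \<le> rt m (G (K + (k - K))) / real p ^ k"
    using bnd_rt[OF assms(1), of m k] k by (simp add: N_p_power divide_right_mono)
  also have "\<dots> \<le> real p ^ (k - K) * rt m (G K) / real p ^ k"
  proof (intro divide_right_mono order_trans[OF rt_mono rt_mult_le])
    show "G (K + (k - K)) \<le> real p ^ (k - K) * G K"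
      using envelope_add_le[OF assms(2)] p_gt by auto
  qed (use p_gt envelope_nonneg[OF assms(2)] in \<open>auto simp: one_le_power\<close>)
  also have "real p ^ (k - K) * rt m (G K) / real p ^ k = rt m (G K) / real p ^ K"
    using p_gt power_add[of "real p" "k - K" K] k by simp
  finally show "N (of_nat p ^ k * y (m + k) k) \<le> rt m (G K) / real p ^ K" .
qed (use assms rt_nonneg envelope_nonneg in \<open>auto simp: psum_def[abs_def]\<close>)

lemma ghost_sum_surj: "\<exists>x. \<forall>k\<le>n. ghost_sum p x k \<approx> t k"
proof (induction n)
  case (Suc n)
  then obtain x where x: "\<And>k. k \<le> n \<Longrightarrow> ghost_sum p x k \<approx> t k" by blast
  have div: "\<exists>v. of_nat p ^ i * v \<approx> w" for i w
  proof (induction i arbitrary: w)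
    case (Suc i)
    obtain w' where w': "of_nat p * w' \<approx> w" using p_divisible by blast
    obtain v where "of_nat p ^ i * v \<approx> w'" using Suc by blast
    hence "of_nat p ^ Suc i * v \<approx> of_nat p * w'" using eqv_mult[OF eqv_refl] by (simp add: mult.assoc)
    thus ?case using w' eqv_trans by blast
  next
    case (0 w)
    have "of_nat p ^ 0 * w \<approx> w" by simp
    thus ?case by blast
  qed
  obtain v where v: "of_nat p ^ Suc n * v \<approx> t (Suc n) - ghost_sum p (\<lambda>i. x i ^ p) n"
    using div by blast
  define x' where "x' = x(Suc n := v)"
  have "ghost_sum p x' (Suc n) = ghost_sum p (\<lambda>i. x i ^ p) n + of_nat p ^ Suc n * v"
    unfolding ghost_sum_Suc by (simp add: x'_def ghost_sum_def)
  hence "ghost_sum p x' (Suc n) \<approx> t (Suc n)"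
    using eqv_add[OF eqv_refl[of "ghost_sum p (\<lambda>i. x i ^ p) n"] v] by simp
  moreover have "ghost_sum p x' k \<approx> t k" if "k \<le> n" for k
    using x[OF that] that by (simp add: x'_def ghost_sum_def)
  ultimately show ?case by (auto simp: le_Suc_eq)
qed (auto intro: exI[of _ t])

text \<open>
  The series have sums by completeness. Since \<open>p\<close> is invertible, there is a Witt vector with any
  prescribed ghost components; those of \<open>x\<^sub>n\<close> are the sums of the series.
\<close>

lemma rel_exists:
  assumes "bnd G y" "envelope p G"
  shows "\<exists>x. xfam x \<and> rel y x"
proof -
  obtain g where g: "\<And>m. tends (psum y m) (g m)" using psum_converges[OF assms] by metis
  have "\<exists>x. \<forall>k\<le>n. ghost_sum p x k \<approx> g (n - k)" for n by (rule ghost_sum_surj)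
  then obtain x where x: "\<And>n k. k \<le> n \<Longrightarrow> ghost_sum p (x n) k \<approx> g (n - k)" by metis
  have "xfam x"
    unfolding xfam_def
  proof (intro allI impI)
    fix n k :: nat assume k: "k \<le> n"
    have "g (n - k) \<approx> ghost_sum p (x (Suc n)) (Suc k)"
      using eqv_sym[OF x[of "Suc k" "Suc n"]] k by simp
    with x[OF k] show "ghost_sum p (x n) k \<approx> ghost_sum p (x (Suc n)) (Suc k)"
      by (rule eqv_trans)
  qed
  moreover have "rel y x"
    unfolding rel_def
  proof
    fix m
    have "g m \<approx> x m 0" using eqv_sym[OF x[of 0 m]] by simp
    thus "tends (psum y m) (x m 0)"
      by (rule tends_eqv[OF g[of m], rotated]) (simp add: always_eventually)
  qed
  ultimately show ?thesis by blast
qed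

text \<open>
  The ghost components of \<open>x\<^sub>n\<close> and \<open>y\<^sub>n\<close> of index \<open>k\<close> differ by the tail of a series, which is bounded
  in terms of \<open>G\<^sub>k\<^sub>+\<^sub>1\<close>. So the components differ by at most \<open>p\<^sup>-\<^sup>1\<close> times the \<open>p\<^sup>n\<^sup>-\<^sup>k\<close>-th root of \<open>G\<^sub>k\<^sub>+\<^sub>1\<close>, and
  \<open>G\<^sub>k\<^sub>+\<^sub>1 \<le> p G\<^sub>k\<close> makes this as good as the bound for \<open>y\<^sub>n\<^sub>,\<^sub>k\<close>.
\<close>

lemma rel_bnd:
  assumes "xfam x" "yfam y" "rel y x" "bnd G y" "envelope p G"
  shows "bnd G x"
  unfolding bnd_def
proof (intro allI impI)
  fix n k :: nat assume k: "k \<le> n"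
  define d where "d k = rt (n - k) (G (Suc k))" for k
  note G0 = envelope_nonneg[OF assms(5)]
  have yG: "N (y n i) \<le> rt (n - i) (G i)" if "i \<le> n" for i
    using bnd_rt[OF assms(4), of "n - i" i] that by simp
  have "N (x n k - y n k) \<le> d k / p"
  proof (rule N_diff_of_ghost_sum[OF _ _ _ k])
    fix i assume i: "i \<le> n"
    have "ghost_sum p (x n) i - ghost_sum p (y n) i \<approx> x (n - i) 0 - psum y (n - i) (Suc i)"
      by (intro eqv_diff xfam_ghost ghost_sum_yfam assms i)
    from eqv_N[OF this] show "N (ghost_sum p (x n) i - ghost_sum p (y n) i) \<le> d i / real p ^ Suc i"
      using psum_tail[OF assms(4,5), of "n - i" "x (n - i) 0" "Suc i"] assms(3) by (simp add: rel_def d_def)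
    show "N (y n i) \<le> d i"
      unfolding d_def using yG[OF i] rt_mono[OF envelope_incr[OF assms(5), of i "Suc i"], of "n - i"] by simp
  next
    fix i assume i: "i < n"
    hence "d i ^ p = rt (n - Suc i) (G (Suc i))"
      using rt_add_power[OF G0, of "n - Suc i" 1 "Suc i"] by (simp add: d_def Suc_diff_Suc)
    thus "d i ^ p \<le> d (Suc i)"
      unfolding d_def using rt_mono[OF envelope_incr[OF assms(5), of "Suc i" "Suc (Suc i)"]] by simp
  qed
  hence le: "N (x n k) \<le> max (d k / p) (N (y n k))"
    using N_add[of "x n k - y n k" "y n k"] by simp
  have "N (x n k) ^ p ^ (n - k) \<le> max (G k) (G k)"
  proof (rule max_power_le[OF _ le])
    have "(d k / p) ^ p ^ (n - k) = G (Suc k) / real p ^ p ^ (n - k)"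
      using real_root_pow_pos2[OF p_power_pos G0, of "n - k" "Suc k"] by (simp add: d_def power_divide)
    also have "\<dots> \<le> G (Suc k) / real p ^ 1"
      using p_gt G0 p_power_pos[of "n - k"] by (intro divide_left_mono power_increasing) (auto simp: Suc_leI)
    also have "\<dots> \<le> G k"
    proof -
      have "G (Suc k) \<le> p * G k" using assms(5) unfolding envelope_def by blast
      thus ?thesis using p_gt by (simp add: divide_le_eq mult.commute)
    qed
    finally show "(d k / p) ^ p ^ (n - k) \<le> G k" .
    show "N (y n k) ^ p ^ (n - k) \<le> G k" using assms(4) k by (simp add: bnd_def)
  qed simp
  thus "N (x n k) ^ p ^ (n - k) \<le> G k" by simp
qed

lemma rel_unique_x:
  assumes "xfam x" "xfam x'" "rel y x" "rel y x'" "k \<le> n"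
  shows "x n k \<approx> x' n k"
proof (rule eqv_of_ghost_sum[OF _ assms(5)])
  fix i assume i: "i \<le> n"
  have "x (n - i) 0 \<approx> x' (n - i) 0"
    using assms(3,4) tends_unique unfolding rel_def by blast
  thus "ghost_sum p (x n) i \<approx> ghost_sum p (x' n) i"
    using xfam_ghost[OF assms(1) i] xfam_ghost[OF assms(2) i] eqv_trans eqv_sym by blast
qed

text \<open>
  If the coefficients of index less than \<open>k\<close> agree, then by the bounds for tails those of index \<open>k\<close> are
  close to each other at all levels \<open>n + l\<close>. Taking powers with exponent \<open>p\<^sup>l\<close> brings them back to level
  \<open>n\<close> and makes the distance arbitrarily small.
\<close>

lemma rel_unique_y:
  assumes y: "yfam y" "bnd G y" "rel y x" and y': "yfam y'" "bnd G y'" "rel y' x"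
    and G: "envelope p G" and "k \<le> n"
  shows "y n k \<approx> y' n k"
  using \<open>k \<le> n\<close>
proof (induction k arbitrary: n rule: less_induct)
  case (less k)
  note G0 = envelope_nonneg[OF G]
  have diff: "N (y (m + k) k - y' (m + k) k) \<le> rt m (G (Suc k)) / p" for m
  proof -
    have "psum y m k \<approx> psum y' m k"
      unfolding psum_def by (intro eqv_sum eqv_mult less.IH) auto
    hence "psum y m (Suc k) - psum y' m (Suc k) \<approx> of_nat p ^ k * (y (m + k) k - y' (m + k) k)"
      using eqv_diff[of "psum y m (Suc k) - psum y' m (Suc k)" _ "psum y m k - psum y' m k" 0]
      by (simp add: psum_def eqv_def algebra_simps)
    from eqv_N[OF this] have "N (y (m + k) k - y' (m + k) k) / real p ^ k = N (psum y m (Suc k) - psum y' m (Suc k))"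
      by (simp add: N_p_power)
    also have "\<dots> \<le> rt m (G (Suc k)) / real p ^ Suc k"
      using psum_tail[OF y(2) G, of m "x m 0" "Suc k"] psum_tail[OF y'(2) G, of m "x m 0" "Suc k"] y(3) y'(3)
        N_trans[of "psum y m (Suc k)" "psum y' m (Suc k)" "x m 0"] N_commute[of "psum y m (Suc k)" "x m 0"]
      by (simp add: rel_def)
    also have "\<dots> = (rt m (G (Suc k)) / p) / real p ^ k" by simp
    finally show ?thesis using p_gt by (simp only: divide_le_cancel) simp
  qed
  have "N (y n k - y' n k) \<le> rt (n - k) (G (Suc k)) / real p ^ Suc l" for l
  proof -
    define m where "m = n - k + l"
    have m: "m + k = n + l" using less.prems by (simp add: m_def)
    have "N (y (n + l) k ^ p ^ l - y' (n + l) k ^ p ^ l) \<le> rt m (G (Suc k)) ^ p ^ l / real p ^ Suc l"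
    proof (rule N_power_diff)
      show "N (y (n + l) k - y' (n + l) k) \<le> rt m (G (Suc k)) / p" using diff[of m] m by simp
      show "N (y' (n + l) k) \<le> rt m (G (Suc k))"
        using bnd_rt[OF y'(2), of m k] rt_mono[OF envelope_incr[OF G, of k "Suc k"], of m] m by simp
    qed
    also have "rt m (G (Suc k)) ^ p ^ l = rt (n - k) (G (Suc k))"
      unfolding m_def by (rule rt_add_power[OF G0])
    also have "N (y (n + l) k ^ p ^ l - y' (n + l) k ^ p ^ l) = N (y n k - y' n k)"
      by (intro eqv_N eqv_diff yfam_power y y' less.prems)
    finally show ?thesis .
  qed
  hence "N (y n k - y' n k) \<le> 0"
    by (intro LIMSEQ_le_const[OF p_power_tendsto_0]) auto
  thus ?case by (simp add: eqv_def N_le_0)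
qed


subsection \<open>The inverse of the expansion\<close>

lemma tends_offset: "tends (\<lambda>l. s (l + k)) z \<Longrightarrow> tends s z"
  unfolding tends_def by (rule LIMSEQ_offset)

lemma rt_div_le:
  assumes "envelope p G"
  shows "rt m (G (j + i)) / real p ^ i \<le> rt m (G j)"
proof -
  have "rt m (G (j + i)) \<le> rt m (real p ^ i * G j)"
    using envelope_add_le[OF assms] p_gt by (intro rt_mono) auto
  also have "\<dots> \<le> real p ^ i * rt m (G j)"
    using p_gt envelope_nonneg[OF assms] by (intro rt_mult_le) (auto simp: one_le_power)
  finally show ?thesis using p_gt by (simp add: divide_le_eq mult.commute)
qed

text \<open>
  Since \<open>F\<close> raises components to the power \<open>p\<close> modulo \<open>p\<close>, the components of \<open>x\<^sub>n\<close> are close to the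
  \<open>p\<close>-th powers of those of \<open>x\<^sub>n\<^sub>+\<^sub>1\<close>, and the powers of \<open>x\<^sub>n\<^sub>+\<^sub>M\<^sub>,\<^sub>k\<close> to the \<open>p\<^sup>M\<close> converge as \<open>M\<close> increases. Here
  the bound \<open>G\<^sub>n\<close> is at first the same for all components of \<open>x\<^sub>n\<close>; the limits satisfy the better
  bounds \<open>G\<^sub>k\<close>, because they are determined by their values for \<open>n = k\<close>.
\<close>

context
  fixes x G
  assumes x: "xfam x" and G: "envelope p G"
    and bound: "\<And>n k. k \<le> n \<Longrightarrow> N (x n k) ^ p ^ (n - k) \<le> G n"
begin

lemma xfam_bound: "k \<le> n \<Longrightarrow> N (x n k) \<le> rt (n - k) (G n)"
  by (rule rt_le[OF bound]) auto

lemma xfam_bound_power: "k \<le> n \<Longrightarrow> N (x (Suc n) k ^ p) \<le> rt (n - k) (G (Suc n))"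
  using N_power_mono[OF xfam_bound[of k "Suc n"], of p]
    rt_add_power[OF envelope_nonneg[OF G], of "n - k" 1 "Suc n"] by (simp add: Suc_diff_le)

lemma xfam_step:
  assumes "k \<le> n"
  shows "N (x (Suc n) k ^ p - x n k) \<le> rt (n - k) (G (Suc n)) / p"
proof -
  have "N (x n k - x (Suc n) k ^ p) \<le> rt (n - k) (G (Suc n)) / p"
  proof (rule N_diff_of_ghost_sum[OF _ _ _ assms, where d = "\<lambda>k. rt (n - k) (G (Suc n))"])
    fix i assume i: "i \<le> n"
    have "ghost_sum p (x n) i \<approx> ghost_sum p (x (Suc n)) (Suc i)"
      using x i by (simp add: xfam_def)
    from eqv_N[OF eqv_diff[OF this eqv_refl, of "ghost_sum p (\<lambda>k. x (Suc n) k ^ p) i"]]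
    have "N (ghost_sum p (x n) i - ghost_sum p (\<lambda>k. x (Suc n) k ^ p) i) = N (of_nat p ^ Suc i * x (Suc n) (Suc i))"
      unfolding ghost_sum_Suc by simp
    also have "\<dots> \<le> rt (n - i) (G (Suc n)) / real p ^ Suc i"
      unfolding N_p_power using xfam_bound[of "Suc i" "Suc n"] i by (intro divide_right_mono) auto
    finally show "N (ghost_sum p (x n) i - ghost_sum p (\<lambda>k. x (Suc n) k ^ p) i) \<le> \<dots>" .
    show "N (x (Suc n) i ^ p) \<le> rt (n - i) (G (Suc n))"
      by (rule xfam_bound_power[OF i])
  next
    fix i assume "i < n"
    thus "rt (n - i) (G (Suc n)) ^ p \<le> rt (n - Suc i) (G (Suc n))"
      using rt_add_power[OF envelope_nonneg[OF G], of "n - Suc i" 1 "Suc n"] by (simp add: Suc_diff_Suc)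
  qed
  thus ?thesis by (simp add: N_commute)
qed

lemma xfam_power_step:
  assumes "k \<le> n"
  shows "N (x (n + Suc M) k ^ p ^ Suc M - x (n + M) k ^ p ^ M) \<le> rt (n - k) (G (n + Suc M)) / real p ^ Suc M"
proof -
  have "x (n + Suc M) k ^ p ^ Suc M - x (n + M) k ^ p ^ M =
     - (x (n + M) k ^ p ^ M - (x (Suc (n + M)) k ^ p) ^ p ^ M)"
    by (simp add: power_mult)
  also have "N \<dots> = N (x (n + M) k ^ p ^ M - (x (Suc (n + M)) k ^ p) ^ p ^ M)" by (rule N_uminus)
  also have "\<dots> \<le> rt (n + M - k) (G (Suc (n + M))) ^ p ^ M / real p ^ Suc M"
    by (rule N_power_diff)
      (use assms xfam_step[of k "n + M"] xfam_bound_power[of k "n + M"] N_commute[of "x (n + M) k"] in auto)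
  also have "rt (n + M - k) (G (Suc (n + M))) ^ p ^ M = rt (n - k) (G (n + Suc M))"
    using rt_add_power[OF envelope_nonneg[OF G], of "n - k" M] assms by simp
  finally show ?thesis .
qed

lemma xfam_power_bound:
  assumes "k \<le> n"
  shows "N (x (n + M) k ^ p ^ M) \<le> rt (n - k) (G n)"
proof (induction M)
  case 0
  thus ?case using xfam_bound[OF assms] by simp
next
  case (Suc M)
  have "N (x (n + Suc M) k ^ p ^ Suc M - x (n + M) k ^ p ^ M) \<le> rt (n - k) (G n)"
    by (rule order_trans[OF xfam_power_step[OF assms] rt_div_le[OF G]])
  thus ?case
    using Suc N_add[of "x (n + Suc M) k ^ p ^ Suc M - x (n + M) k ^ p ^ M" "x (n + M) k ^ p ^ M"] by simp
qed

lemma xfam_power_converges: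
  assumes "k \<le> n"
  shows "\<exists>z. tends (\<lambda>M. x (n + M) k ^ p ^ M) z"
proof (rule complete)
  have "(\<lambda>M. rt (n - k) (G (n + Suc M)) / real p ^ Suc M) \<longlonglongrightarrow> 0"
    using LIMSEQ_Suc[OF envelope_rt_tendsto_0[OF G, of "n - k" n]] by simp
  thus "(\<lambda>M. N (x (n + Suc M) k ^ p ^ Suc M - x (n + M) k ^ p ^ M)) \<longlonglongrightarrow> 0"
    by (rule tendsto_sandwich[OF _ _ tendsto_const, rotated 2])
      (use xfam_power_step[OF assms] in \<open>auto intro!: always_eventually\<close>)
qed

lemma rel_exists_y: "\<exists>y. yfam y \<and> bnd G y \<and> rel y x"
proof -
  have "\<exists>z. k \<le> n \<longrightarrow> tends (\<lambda>M. x (n + M) k ^ p ^ M) z" for n k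
    using xfam_power_converges[of k n] by blast
  then obtain y where y: "\<And>n k. k \<le> n \<Longrightarrow> tends (\<lambda>M. x (n + M) k ^ p ^ M) (y n k)" by metis
  have yfam: "yfam y"
    unfolding yfam_def
  proof (intro allI impI)
    fix n k :: nat assume k: "k \<le> n"
    have "tends (\<lambda>M. (x (Suc n + M) k ^ p ^ M) ^ p) (y (Suc n) k ^ p)"
      by (intro tends_power y) (use k in simp)
    moreover have "tends (\<lambda>M. x (n + Suc M) k ^ p ^ Suc M) (y n k)"
      using tends_subseq[OF y[OF k], of Suc] by (simp add: strict_mono_def)
    ultimately show "y (Suc n) k ^ p \<approx> y n k"
      by (intro tends_unique[of "\<lambda>M. x (n + Suc M) k ^ p ^ Suc M"])
        (simp_all add: power_mult[symmetric] mult.commute)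
  qed
  have "bnd G y"
    unfolding bnd_def
  proof (intro allI impI)
    fix n k :: nat assume k: "k \<le> n"
    have "y (k + (n - k)) k ^ p ^ (n - k) \<approx> y k k"
      by (rule yfam_power[OF yfam]) simp
    hence "N (y n k) ^ p ^ (n - k) = N (y k k)"
      using eqv_N[of "y n k ^ p ^ (n - k)" "y k k"] N_power[OF p_power_pos, of "y n k" "n - k"] k by simp
    also have "\<dots> \<le> G k"
      by (rule tends_N_le[OF y]) (use xfam_power_bound[of k k] in auto)
    finally show "N (y n k) ^ p ^ (n - k) \<le> G k" .
  qed
  moreover have "rel y x"
    unfolding rel_def
  proof
    fix m
    \<comment> \<open>The first components are the ghost components of index \<open>M\<close> of \<open>x\<^sub>m\<^sub>+\<^sub>M\<close>, whose terms converge to those of the series.\<close>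
    show "tends (psum y m) (x m 0)"
    proof (rule tendsI[OF _ envelope_rt_tendsto_0[OF G, of m m]], rule tends_le)
      fix K
      have "tends (\<lambda>M. x (m + M) k ^ p ^ (M - k)) (y (m + k) k)" for k
        by (rule tends_offset[of _ k]) (use y[of k "m + k"] in \<open>simp add: ac_simps\<close>)
      thus "tends (\<lambda>M. \<Sum>k<K. of_nat p ^ k * x (m + M) k ^ p ^ (M - k)) (psum y m K)"
        unfolding psum_def by (intro tends_sum tends_mult tends_const)
      show "eventually (\<lambda>M. N ((\<Sum>k<K. of_nat p ^ k * x (m + M) k ^ p ^ (M - k)) - x m 0)
          \<le> rt m (G (m + K)) / real p ^ K) sequentially"
        using eventually_ge_at_top[of K]
      proof eventually_elim
        case (elim M)
        let ?t = "\<lambda>k. of_nat p ^ k * x (m + M) k ^ p ^ (M - k)"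
        have "x m 0 \<approx> ghost_sum p (x (m + M)) M"
          using eqv_sym[OF xfam_ghost[OF x, of M "m + M"]] by simp
        hence "(\<Sum>k<K. ?t k) - x m 0 \<approx> (\<Sum>k<K. ?t k) - ghost_sum p (x (m + M)) M"
          by (intro eqv_diff) auto
        also have "(\<Sum>k<K. ?t k) - ghost_sum p (x (m + M)) M = - (\<Sum>k\<in>{K..M}. ?t k)"
        proof -
          have eq: "{..M} = {..<K} \<union> {K..M}" using elim by auto
          have "ghost_sum p (x (m + M)) M = (\<Sum>k<K. ?t k) + (\<Sum>k\<in>{K..M}. ?t k)"
            unfolding ghost_sum_def eq by (rule sum.union_disjoint) auto
          thus ?thesis by simp
        qed
        finally have "N ((\<Sum>k<K. ?t k) - x m 0) = N (- (\<Sum>k\<in>{K..M}. ?t k))"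
          by (rule eqv_N)
        also have "\<dots> = N (\<Sum>k\<in>{K..M}. ?t k)" by (rule N_uminus)
        also have "\<dots> \<le> rt m (G (m + K)) / real p ^ K"
        proof (rule N_sum)
          fix k assume k: "k \<in> {K..M}"
          have "N (?t k) \<le> rt m (G (m + k)) / real p ^ k"
            using xfam_power_bound[of k "m + k" "M - k"] k
            by (auto simp: N_p_power intro!: divide_right_mono)
          also have "\<dots> = rt m (G (m + K + (k - K))) / real p ^ (k - K) / real p ^ K"
            using k p_gt power_add[of "real p" "k - K" K] by simp
          also have "\<dots> \<le> rt m (G (m + K)) / real p ^ K"
            by (intro divide_right_mono rt_div_le G) auto
          finally show "N (?t k) \<le> rt m (G (m + K)) / real p ^ K" .
        qed (use rt_nonneg envelope_nonneg[OF G] in auto)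
        finally show ?case .
      qed
    qed
  qed
  ultimately show ?thesis using yfam by blast
qed

end

subsection \<open>Compatibility with the ring operations\<close>

text \<open>
  Truncation leaves finitely many of the values \<open>|y\<^sub>k\<^sub>,\<^sub>k|\<close>, which then have a common bound.
\<close>

definition trunc :: "nat \<Rightarrow> (nat \<Rightarrow> nat \<Rightarrow> 'r) \<Rightarrow> nat \<Rightarrow> nat \<Rightarrow> 'r" where
  "trunc K y n k = (if k < K then y n k else 0)"

lemma ghost_sum_trunc:
  assumes "yfam y" "K \<le> M"
  shows "ghost_sum p (trunc K y (m + M)) M \<approx> psum y m K"
proof -
  have "ghost_sum p (trunc K y (m + M)) M = (\<Sum>k<K. of_nat p ^ k * trunc K y (m + M) k ^ p ^ (M - k))"
    unfolding ghost_sum_def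
    by (rule sum.mono_neutral_right) (use assms zero_power[OF p_power_pos, where ?'a = 'r] in \<open>auto simp: trunc_def\<close>)
  also have "\<dots> \<approx> psum y m K"
    unfolding psum_def
  proof (intro eqv_sum eqv_mult eqv_refl)
    fix k assume "k \<in> {..<K}"
    thus "trunc K y (m + M) k ^ p ^ (M - k) \<approx> y (m + k) k"
      using yfam_power[OF assms(1), of k "m + k" "M - k"] assms(2) by (simp add: trunc_def)
  qed
  finally show ?thesis .
qed

lemma trunc_bounded:
  assumes "yfam y"
  shows "\<exists>C\<ge>1. \<forall>n i. i \<le> n \<longrightarrow> N (trunc K y n i) \<le> rt n C ^ p ^ i"
proof -
  define C where "C = (\<Sum>i<K. N (y i i)) + 1"
  have C1: "C \<ge> 1" by (simp add: C_def sum_nonneg)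
  have "N (trunc K y n i) \<le> rt n C ^ p ^ i" if i: "i \<le> n" for n i
  proof -
    have eq: "rt n C ^ p ^ i = rt (n - i) C"
      using rt_add_power[of C "n - i" i] i C1 by simp
    show ?thesis
    proof (cases "i < K")
      case True
      have "y (i + (n - i)) i ^ p ^ (n - i) \<approx> y i i"
        by (rule yfam_power[OF assms]) simp
      hence "N (y n i) ^ p ^ (n - i) = N (y i i)"
        using eqv_N[of "y n i ^ p ^ (n - i)" "y i i"] N_power[OF p_power_pos, of "y n i" "n - i"] i by simp
      also have "\<dots> \<le> C"
        using member_le_sum[of i "{..<K}" "\<lambda>i. N (y i i)"] True by (simp add: C_def)
      finally show ?thesis unfolding eq trunc_def using True by (auto intro: rt_le)
    next
      case False
      thus ?thesis unfolding eq trunc_def using C1 by (simp add: rt_nonneg)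
    qed
  qed
  with C1 show ?thesis by blast
qed

text \<open>
  The sum and product of expansions are limits of ghost components of Witt vectors, computed with
  the same polynomials as the sum and product in the characteristic \<open>p\<close> ring. Limit and
  summation may be exchanged when all but finitely many components of the operands vanish. So the
  operands are truncated at \<open>K\<close>, where \<open>q K\<close> is the result of the operation on truncated operands in
  the characteristic \<open>p\<close> ring; its components of index at least \<open>K\<close> contribute at most \<open>eps m K\<close>.
\<close>

lemma rel_op:
  fixes P :: "nat \<Rightarrow> (nat + nat) zpoly"
  assumes ghost: "\<And>(u :: nat \<Rightarrow> 'r) v n. ghost_sum p (\<lambda>k. peval (case_sum u v) (P k)) n = op (ghost_sum p u n) (ghost_sum p v n)"
    and homog: "\<And>n. homog (witt_wt p) ({..n} <+> {..n}) (e * p ^ n) (P n)"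
    and op_tends: "\<And>s t z w. tends s z \<Longrightarrow> tends t w \<Longrightarrow> tends (\<lambda>l. op (s l) (t l)) (op z w)"
    and y: "yfam y" "yfam y'" "rel y x" "rel y' x'"
    and q: "\<And>K n k. k \<le> n \<Longrightarrow> tends (\<lambda>l. peval (case_sum (trunc K y (n + l)) (trunc K y' (n + l))) (P k) ^ p ^ l) (q K n k)"
    and qQ: "\<And>K n k. k < K \<Longrightarrow> k \<le> n \<Longrightarrow> q K n k \<approx> Q n k"
    and tail: "\<And>m k K. K \<le> k \<Longrightarrow> N (q K (m + k) k) \<le> real p ^ k * eps m K"
    and eps: "\<And>m. eps m \<longlonglongrightarrow> 0" "\<And>m K. eps m K \<ge> 0"
  shows "tends (psum Q m) (op (x m 0) (x' m 0))"
proof -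
  have op_eqv: "op a b \<approx> op a' b'" if "a \<approx> a'" "b \<approx> b'" for a b a' b'
  proof (rule tends_unique)
    have "tends (\<lambda>_. a) a'" "tends (\<lambda>_. b) b'"
      using that by (auto simp: tends_def eqv_def)
    from op_tends[OF this] show "tends (\<lambda>_. op a b) (op a' b')" .
    show "tends (\<lambda>_. op a b) (op a b)" by (rule tends_const)
  qed
  have main: "N (psum Q m K - op (psum y m K) (psum y' m K)) \<le> eps m K" for K
  proof -
    let ?u = "\<lambda>M. trunc K y (m + M)" and ?v = "\<lambda>M. trunc K y' (m + M)"
    let ?P = "\<lambda>M k. peval (case_sum (?u M) (?v M)) (P k) ^ p ^ (M - k)"
    obtain C1 where C1: "C1 \<ge> 1" "\<And>n i. i \<le> n \<Longrightarrow> N (trunc K y n i) \<le> rt n C1 ^ p ^ i"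
      using trunc_bounded[OF y(1)] by blast
    obtain C2 where C2: "C2 \<ge> 1" "\<And>n i. i \<le> n \<Longrightarrow> N (trunc K y' n i) \<le> rt n C2 ^ p ^ i"
      using trunc_bounded[OF y(2)] by blast
    define C where "C = max C1 C2"
    have C: "C \<ge> 1" using C1 by (simp add: C_def)
    have uv: "N (trunc K y n i) \<le> rt n C ^ p ^ i" "N (trunc K y' n i) \<le> rt n C ^ p ^ i" if "i \<le> n" for n i
      using C1 C2 that rt_nonneg
      by (auto simp: C_def intro!: order_trans[OF C1(2)] order_trans[OF C2(2)] power_mono rt_mono)
    have bound: "N (?P M k) \<le> C ^ e" if "k \<le> M" for M k
    proof -
      have "N (peval (case_sum (?u M) (?v M)) (P k)) \<le> rt (m + M) C ^ (e * p ^ k)"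
        by (rule N_peval_homog[OF homog]) (use that uv C rt_nonneg in auto)
      hence "N (?P M k) \<le> (rt (m + M) C ^ (e * p ^ k)) ^ p ^ (M - k)"
        by (rule N_power_mono)
      also have "\<dots> = (rt (m + M) C ^ p ^ M) ^ e"
      proof -
        have "e * p ^ k * p ^ (M - k) = p ^ M * e"
          using that by (simp add: mult.commute flip: power_add)
        thus ?thesis by (simp only: power_mult[symmetric])
      qed
      also have "rt (m + M) C ^ p ^ M = rt m C" using C by (intro rt_add_power) simp
      also have "rt m C ^ e \<le> C ^ e"
      proof (rule power_mono)
        have "rt m C \<le> rt m (C ^ p ^ m)"
          using C p_power_pos power_increasing[of 1 "p ^ m" C] by (intro rt_mono) (auto simp: Suc_leI)
        also have "\<dots> = C" using C p_power_pos by (simp add: real_root_power_cancel)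
        finally show "rt m C \<le> C" .
      qed (use C rt_nonneg in auto)
      finally show ?thesis .
    qed
    have opP: "op (psum y m K) (psum y' m K) \<approx> (\<Sum>k\<le>M. of_nat p ^ k * ?P M k)" if "K \<le> M" for M
    proof -
      have "op (psum y m K) (psum y' m K) \<approx> op (ghost_sum p (?u M) M) (ghost_sum p (?v M) M)"
        by (intro op_eqv eqv_sym[OF ghost_sum_trunc] y that)
      thus ?thesis unfolding ghost[symmetric] by (simp add: ghost_sum_def)
    qed
    show ?thesis
    proof (rule field_le_epsilon)
      fix eta :: real assume "eta > 0"
      have "(\<lambda>l. C ^ e / real p ^ Suc l) \<longlonglongrightarrow> 0" by (rule p_power_tendsto_0)
      from order_tendstoD(2)[OF this \<open>eta > 0\<close>]
      obtain L0 where L0: "\<And>l. l \<ge> L0 \<Longrightarrow> C ^ e / real p ^ Suc l < eta"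
        by (auto simp: eventually_sequentially)
      \<comment> \<open>Beyond \<open>L\<close>, the terms of the ghost components are small uniformly in \<open>M\<close>.\<close>
      define L where "L = Suc (max L0 K)"
      have L: "K \<le> L" "C ^ e / real p ^ L < eta" using L0[of "max L0 K"] by (auto simp: L_def)
      have "N ((\<Sum>k<L. of_nat p ^ k * q K (m + k) k) - op (psum y m K) (psum y' m K)) \<le> eta"
      proof (rule tends_le)
        have "tends (\<lambda>M. ?P M k) (q K (m + k) k)" for k
          by (rule tends_offset[of _ k]) (use q[of k "m + k" K] in \<open>simp add: ac_simps\<close>)
        thus "tends (\<lambda>M. \<Sum>k<L. of_nat p ^ k * ?P M k) (\<Sum>k<L. of_nat p ^ k * q K (m + k) k)"
          by (intro tends_sum tends_mult tends_const)
        show "eventually (\<lambda>M. N ((\<Sum>k<L. of_nat p ^ k * ?P M k) - op (psum y m K) (psum y' m K)) \<le> eta) sequentially"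
          using eventually_ge_at_top[of L]
        proof eventually_elim
          case (elim M)
          have eq: "{..M} = {..<L} \<union> {L..M}" using elim by auto
          have split: "(\<Sum>k\<le>M. of_nat p ^ k * ?P M k) =
              (\<Sum>k<L. of_nat p ^ k * ?P M k) + (\<Sum>k\<in>{L..M}. of_nat p ^ k * ?P M k)"
            unfolding eq by (rule sum.union_disjoint) auto
          have "N ((\<Sum>k<L. of_nat p ^ k * ?P M k) - op (psum y m K) (psum y' m K)) =
             N ((\<Sum>k<L. of_nat p ^ k * ?P M k) - (\<Sum>k\<le>M. of_nat p ^ k * ?P M k))"
            using opP[of M] L elim by (intro eqv_N eqv_diff) auto
          also have "\<dots> = N (\<Sum>k\<in>{L..M}. of_nat p ^ k * ?P M k)"
            unfolding split by (simp add: N_commute)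
          also have "\<dots> \<le> eta"
          proof (rule N_sum)
            fix k assume k: "k \<in> {L..M}"
            have "N (of_nat p ^ k * ?P M k) \<le> C ^ e / real p ^ k"
              unfolding N_p_power using bound[of k M] k by (intro divide_right_mono) auto
            also have "\<dots> \<le> C ^ e / real p ^ L"
              using k p_gt C by (intro divide_left_mono power_increasing) auto
            finally show "N (of_nat p ^ k * ?P M k) \<le> eta" using L by simp
          qed (use \<open>eta > 0\<close> in simp)
          finally show ?case .
        qed
      qed
      moreover have "N (psum Q m K - (\<Sum>k<L. of_nat p ^ k * q K (m + k) k)) \<le> eps m K"
      proof -
        have eq: "{..<L} = {..<K} \<union> {K..<L}" using L by auto
        have "(\<Sum>k<L. of_nat p ^ k * q K (m + k) k) =
           (\<Sum>k<K. of_nat p ^ k * q K (m + k) k) + (\<Sum>k\<in>{K..<L}. of_nat p ^ k * q K (m + k) k)"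
          unfolding eq by (rule sum.union_disjoint) auto
        moreover have "(\<Sum>k<K. of_nat p ^ k * q K (m + k) k) \<approx> psum Q m K"
          unfolding psum_def by (intro eqv_sum eqv_mult qQ) auto
        ultimately have "psum Q m K - (\<Sum>k<L. of_nat p ^ k * q K (m + k) k) \<approx>
            0 - (\<Sum>k\<in>{K..<L}. of_nat p ^ k * q K (m + k) k)"
          by (simp add: eqv_def N_commute)
        from eqv_N[OF this] have "N (psum Q m K - (\<Sum>k<L. of_nat p ^ k * q K (m + k) k)) =
            N (\<Sum>k\<in>{K..<L}. of_nat p ^ k * q K (m + k) k)" by simp
        also have "\<dots> \<le> eps m K"
        proof (rule N_sum)
          fix k assume "k \<in> {K..<L}"
          thus "N (of_nat p ^ k * q K (m + k) k) \<le> eps m K"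
            unfolding N_p_power using tail[of K k m] p_gt by (simp add: divide_le_eq mult.commute)
        qed (rule eps)
        finally show ?thesis .
      qed
      ultimately show "N (psum Q m K - op (psum y m K) (psum y' m K)) \<le> eps m K + eta"
        using N_trans[of "psum Q m K" "op (psum y m K) (psum y' m K)" "\<Sum>k<L. of_nat p ^ k * q K (m + k) k"]
          \<open>eta > 0\<close> eps(2)[of m K] by linarith
    qed
  qed
  have lim: "tends (\<lambda>K. op (psum y m K) (psum y' m K)) (op (x m 0) (x' m 0))"
    using y by (intro op_tends) (auto simp: rel_def)
  show ?thesis
  proof (rule tendsI)
    fix K
    show "N (psum Q m K - op (x m 0) (x' m 0)) \<le>
        eps m K + N (op (psum y m K) (psum y' m K) - op (x m 0) (x' m 0))"
      using main[of K] N_trans[of "psum Q m K" "op (x m 0) (x' m 0)" "op (psum y m K) (psum y' m K)"]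
        N_nonneg[of "op (psum y m K) (psum y' m K) - op (x m 0) (x' m 0)"] eps(2)[of m K] by linarith
    show "(\<lambda>K. eps m K + N (op (psum y m K) (psum y' m K) - op (x m 0) (x' m 0))) \<longlonglongrightarrow> 0"
      using tendsto_add[OF eps(1)[of m] lim[unfolded tends_def]] by simp
  qed
qed

end


section \<open>The \<open>p\<close>-adic seminorm\<close>

locale complete_p_normal =
  fixes p :: nat and A R :: "('a, 'm) ring_scheme"
  assumes prime: "Factorial_Ring.prime p"
    and cring_A: "cring A"
    and inverting: "is_inverting_p p A R"
    and normal: "p_normal p A R"
    and complete_A: "p_adically_complete p A"
begin

lemma R: "cring R"
  using inverting by (simp add: is_inverting_p_def)

sublocale R: cring R by (rule R)

sublocale A: cring A by (rule cring_A)

lemma A_eq: "A = R\<lparr>carrier := carrier A\<rparr>"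
  using inverting by (simp add: is_inverting_p_def)

lemma A_sub: "carrier A \<subseteq> carrier R"
  using inverting subringE(1)[of "carrier A" R] by (simp add: is_inverting_p_def)

lemma A_ops: "mult A = mult R" "add A = add R" "one A = one R" "zero A = zero R"
proof -
  show "mult A = mult R" by (subst A_eq) simp
  show "add A = add R" by (subst A_eq) simp
  show "one A = one R" by (subst A_eq) simp
  show "zero A = zero R" by (subst A_eq) simp
qed

lemma A_a_inv: "x \<in> carrier A \<Longrightarrow> \<ominus>\<^bsub>A\<^esub> x = \<ominus>\<^bsub>R\<^esub> x"
proof -
  assume x: "x \<in> carrier A"
  have "\<ominus>\<^bsub>A\<^esub> x \<oplus>\<^bsub>R\<^esub> x = \<zero>\<^bsub>R\<^esub>"
    using A.l_neg[OF x] by (simp add: A_ops)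
  moreover have "x \<in> carrier R" "\<ominus>\<^bsub>A\<^esub> x \<in> carrier R" using x A_sub A.a_inv_closed by auto
  ultimately show ?thesis by (rule R.minus_equality[symmetric])
qed

lemma A_minus: "y \<in> carrier A \<Longrightarrow> x \<ominus>\<^bsub>A\<^esub> y = x \<ominus>\<^bsub>R\<^esub> y"
  by (simp add: a_minus_def A_ops A_a_inv)

lemma A_pow: "x [^]\<^bsub>A\<^esub> (n::nat) = x [^]\<^bsub>R\<^esub> n"
  by (subst A_eq) (simp add: nat_pow_def)

lemma A_p_elem: "p_elem p A = p_elem p R"
  by (subst A_eq) (simp add: p_elem_def add_pow_def nat_pow_def)

lemma id_hom: "(\<lambda>x. x) \<in> ring_hom A R"
  by (rule ring_hom_memI) (use A_sub in \<open>auto simp: A_ops\<close>)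

abbreviation ev :: "'a zpoly \<Rightarrow> 'a" where "ev \<equiv> cover R"

sublocale ev: ring_cover R ev
  by (rule ring_cover_cover[OF R])

lemma ev_X [simp]: "a \<in> carrier R \<Longrightarrow> ev (X a) = a"
  by (rule cover_X[OF R])

definition mem :: "'a zpoly \<Rightarrow> bool" where
  "mem a \<longleftrightarrow> ev a \<in> carrier A"

lemma mem_cong: "ev a = ev b \<Longrightarrow> mem a \<longleftrightarrow> mem b"
  by (simp add: mem_def)

lemma mem_mult: "mem a \<Longrightarrow> mem b \<Longrightarrow> mem (a * b)"
  using A.m_closed[of "ev a" "ev b"] by (simp add: mem_def A_ops)

lemma mem_diff: "mem a \<Longrightarrow> mem b \<Longrightarrow> mem (a - b)"
  using A.minus_closed[of "ev a" "ev b"] by (simp add: mem_def A_minus)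

lemma mem_0: "mem 0" and mem_1: "mem 1"
  using A.zero_closed A.one_closed by (simp_all add: mem_def A_ops)

lemma mem_uminus: "mem a \<Longrightarrow> mem (- a)"
  using mem_diff[OF mem_0, of a] by simp

lemma mem_add: "mem a \<Longrightarrow> mem b \<Longrightarrow> mem (a + b)"
  using mem_diff[of a "- b"] mem_uminus by simp

lemma mem_sum: "(\<And>i. i \<in> I \<Longrightarrow> mem (f i)) \<Longrightarrow> mem (\<Sum>i\<in>I. f i)"
  by (induction I rule: infinite_finite_induct) (auto simp: mem_0 intro: mem_add)

lemma mem_of_nat: "mem (of_nat n)"
  by (induction n) (auto simp: mem_0 mem_1 intro: mem_add simp del: ev.of_nat)

lemma mem_power: "mem a \<Longrightarrow> mem (a ^ n)"
  by (induction n) (auto simp: mem_1 intro: mem_mult)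

text \<open>
  Integral closedness is applied to the equation \<open>T\<^sup>n - a\<^sup>n = 0\<close>.
\<close>

lemma mem_power_cancel:
  assumes "mem (a ^ n)" "n > 0"
  shows "mem a"
proof -
  let ?x = "ev a"
  have xn: "?x [^]\<^bsub>R\<^esub> n \<in> carrier A" using assms by (simp add: mem_def)
  define c where "c i = (if 0 = i then \<ominus>\<^bsub>R\<^esub> (?x [^]\<^bsub>R\<^esub> n) else \<zero>\<^bsub>R\<^esub>)" for i :: nat
  have "c i \<in> carrier A" for i
    using A.a_inv_closed[OF xn] A_a_inv[OF xn] A.zero_closed by (simp add: c_def A_ops)
  moreover have "(\<Oplus>\<^bsub>R\<^esub>i\<in>{..<n}. c i \<otimes>\<^bsub>R\<^esub> ?x [^]\<^bsub>R\<^esub> i) =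
      (\<Oplus>\<^bsub>R\<^esub>i\<in>{..<n}. if 0 = i then \<ominus>\<^bsub>R\<^esub> (?x [^]\<^bsub>R\<^esub> n) else \<zero>\<^bsub>R\<^esub>)"
    by (rule R.finsum_cong') (auto simp: c_def)
  moreover have "\<dots> = \<ominus>\<^bsub>R\<^esub> (?x [^]\<^bsub>R\<^esub> n)"
    using R.add.finprod_singleton[of 0 "{..<n}" "\<lambda>_. \<ominus>\<^bsub>R\<^esub> (?x [^]\<^bsub>R\<^esub> n)"] assms(2) by simp
  ultimately have "integral_over A R ?x"
    unfolding integral_over_def by (intro exI[of _ n] exI[of _ c]) (simp add: R.r_neg)
  thus ?thesis
    using normal unfolding p_normal_def mem_def by auto
qed

lemma p_gt: "p > 0" "real p > 0" "real p > 1"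
  using prime_gt_1_nat[OF prime] by auto

lemma ev_p: "ev (of_nat p) = p_elem p R"
  by (simp add: p_elem_def)

definition pinv :: "'a zpoly" where "pinv = X (inv\<^bsub>R\<^esub> (p_elem p R))"

lemma p_unit: "p_elem p R \<in> Units R"
  using inverting by (simp add: is_inverting_p_def)

lemma ev_pinv: "ev (pinv * of_nat p) = ev 1"
  unfolding ev.mult ev_p pinv_def using p_unit by simp

lemma ev_pinv_power: "ev (pinv ^ n * of_nat p ^ n) = ev 1"
proof -
  have "ev ((pinv * of_nat p) ^ n) = ev (1 ^ n)"
    unfolding ev.power ev_pinv ..
  thus ?thesis by (simp only: power_mult_distrib power_one)
qed

lemma ev_mult_cong: "ev a = ev a' \<Longrightarrow> ev b = ev b' \<Longrightarrow> ev (a * b) = ev (a' * b')"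
  by simp

lemma ev_pinv_power': "ev (pinv ^ n * (of_nat p ^ n * a)) = ev a" "ev (of_nat p ^ n * (pinv ^ n * a)) = ev a"
  using ev_mult_cong[OF ev_pinv_power refl, of n a] by (simp_all only: ac_simps mult_1_left)

text \<open>
  This is \<open>p\<^sup>-\<^sup>c\<close>; with this sign, \<open>x\<close> has seminorm at most \<open>p\<close> to the \<open>-c/d\<close> if \<open>pw c * x\<^sup>d\<close> is in \<open>A\<close>.
\<close>

definition pw :: "int \<Rightarrow> 'a zpoly" where
  "pw c = (if c \<ge> 0 then pinv ^ nat c else of_nat p ^ nat (- c))"

lemma ev_pw_diff: "ev (pw (int m - int n)) = ev (pinv ^ m * of_nat p ^ n)"
proof (cases "n \<le> m")
  case True
  hence "nat (int m - int n) = m - n" "pinv ^ m * of_nat p ^ n = pinv ^ (m - n) * (pinv ^ n * of_nat p ^ n)"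
    by (simp_all flip: mult.assoc power_add)
  thus ?thesis
    using True ev_mult_cong[OF refl ev_pinv_power, of "pinv ^ (m - n)" n] by (simp add: pw_def del: ev.mult)
next
  case False
  hence "of_nat p ^ n = (of_nat p ^ m * of_nat p ^ (n - m) :: 'a zpoly)"
    by (simp flip: power_add)
  hence "pinv ^ m * of_nat p ^ n = (pinv ^ m * of_nat p ^ m) * of_nat p ^ (n - m)"
    by (simp add: mult.assoc)
  moreover have "nat (- (int m - int n)) = n - m" using False by simp
  ultimately show ?thesis
    using False ev_mult_cong[OF ev_pinv_power refl, of m "of_nat p ^ (n - m)"]
    by (simp add: pw_def del: ev.mult ev.power ev.of_nat)
qed

lemma ev_pw_add: "ev (pw (c + d)) = ev (pw c * pw d)"
proof -
  obtain m n where c: "c = int m - int n" using int_diff_cases by blast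
  obtain k l where d: "d = int k - int l" using int_diff_cases by blast
  have "ev (pw (c + d)) = ev (pinv ^ (m + k) * of_nat p ^ (n + l))"
    using ev_pw_diff[of "m + k" "n + l"] by (simp add: c d algebra_simps)
  also have "pinv ^ (m + k) * of_nat p ^ (n + l) = (pinv ^ m * of_nat p ^ n) * (pinv ^ k * of_nat p ^ l)"
    by (simp add: power_add ac_simps)
  also have "ev \<dots> = ev (pw c * pw d)"
    unfolding c d by (intro ev_mult_cong ev_pw_diff[symmetric])
  finally show ?thesis .
qed

lemma pw_0 [simp]: "pw 0 = 1" and pw_neg: "pw (- int n) = of_nat p ^ n" and pw_pos: "pw (int n) = pinv ^ n"
  by (auto simp: pw_def)

lemma ev_pw_power: "ev (pw (c * int n)) = ev (pw c ^ n)"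
proof (induction n)
  case (Suc n)
  have "ev (pw (c * int (Suc n))) = ev (pw c * pw (c * int n))"
    using ev_pw_add[of c "c * int n"] by (simp add: algebra_simps)
  also have "\<dots> = ev (pw c * pw c ^ n)" by (rule ev_mult_cong[OF refl Suc])
  finally show ?case by simp
qed simp

lemma mem_pw: "c \<le> 0 \<Longrightarrow> mem (pw c)"
  by (auto simp: pw_def mem_1 intro: mem_power mem_of_nat)

lemma inv_p_power: "inv\<^bsub>R\<^esub> (p_elem p R [^]\<^bsub>R\<^esub> n) = ev (pinv ^ n)"
proof -
  have "ev (of_nat p ^ n * pinv ^ n) = ev 1"
    using ev_pinv_power[of "n"] by (simp only: mult.commute)
  hence "ev (of_nat p ^ n) \<otimes>\<^bsub>R\<^esub> ev (pinv ^ n) = \<one>\<^bsub>R\<^esub>"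
    by (simp only: ev.mult ev.one)
  hence "inv\<^bsub>R\<^esub> ev (of_nat p ^ n) = ev (pinv ^ n)"
    by (rule R.comm_inv_char[rotated 2]) (rule ev.closed)+
  thus ?thesis by (simp only: ev.power ev_p)
qed

lemma ev_pw: "ev (pw c) = p_elem p R [^]\<^bsub>R\<^esub> (- c)"
proof (cases c rule: int_cases2)
  case (nonneg n)
  show ?thesis
  proof (cases "n = 0")
    case False
    hence "p_elem p R [^]\<^bsub>R\<^esub> (- c) = inv\<^bsub>R\<^esub> (p_elem p R [^]\<^bsub>R\<^esub> n)"
      unfolding int_pow_def2 nonneg by simp
    thus ?thesis unfolding inv_p_power nonneg pw_pos by (rule sym)
  qed (simp add: nonneg)
next
  case (nonpos n)
  have "p_elem p R [^]\<^bsub>R\<^esub> (- c) = p_elem p R [^]\<^bsub>R\<^esub> n"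
    unfolding int_pow_def2 nonpos by simp
  thus ?thesis unfolding nonpos pw_neg by (simp only: ev.power ev_p)
qed

abbreviation nu :: "'a \<Rightarrow> real" where "nu \<equiv> p_adic_seminorm p A R"

definition N :: "'a zpoly \<Rightarrow> real" where "N x = nu (ev x)"

definition vals :: "'a zpoly \<Rightarrow> real set" where
  "vals x = {real p powr (- (real_of_int c / real d)) | (c::int) (d::nat). d > 0 \<and> mem (pw c * x ^ d)}"

lemma N_Inf: "N x = Inf (vals x)"
  by (simp add: N_def p_adic_seminorm_def vals_def mem_def ev_pw)

lemma vals_nonempty: "vals x \<noteq> {}"
proof -
  obtain n :: nat where "p_elem p R [^]\<^bsub>R\<^esub> n \<otimes>\<^bsub>R\<^esub> ev x \<in> carrier A"
    using inverting ev.closed[of x] unfolding is_inverting_p_def by blast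
  hence "mem (pw (- int n) * x ^ 1)" by (simp add: pw_neg mem_def ev_p[symmetric] del: ev.of_nat)
  hence "real p powr (- (real_of_int (- int n) / real 1)) \<in> vals x"
    unfolding vals_def by (intro CollectI exI[of _ "- int n"] exI[of _ 1]) simp
  thus ?thesis by blast
qed

lemma vals_bdd: "bdd_below (vals x)"
  by (rule bdd_belowI[of _ 0]) (auto simp: vals_def)

lemma N_le: "d > 0 \<Longrightarrow> mem (pw c * x ^ d) \<Longrightarrow> N x \<le> real p powr (- (real_of_int c / real d))"
  unfolding N_Inf by (rule cInf_lower[OF _ vals_bdd]) (auto simp: vals_def)

lemma N_ge: 
  assumes "\<And>c d. d > 0 \<Longrightarrow> mem (pw c * x ^ d) \<Longrightarrow> b \<le> real p powr (- (real_of_int c / real d))"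
  shows "b \<le> N x"
  unfolding N_Inf by (rule cInf_greatest[OF vals_nonempty]) (use assms in \<open>auto simp: vals_def\<close>)

lemma N_less:
  assumes "N x < b"
  obtains c d where "d > 0" "mem (pw c * x ^ d)" "real p powr (- (real_of_int c / real d)) < b"
  using cInf_lessD[OF vals_nonempty assms[unfolded N_Inf]] that by (auto simp: vals_def)

lemma N_nonneg: "N x \<ge> 0"
  by (rule N_ge) simp

lemma N_cong: "ev x = ev y \<Longrightarrow> N x = N y"
  by (simp add: N_def)

lemma mem_N_le: "mem x \<Longrightarrow> N x \<le> 1"
  using N_le[of 1 0 x] p_gt by simp

text \<open>
  Some power of \<open>x\<close> is in \<open>A\<close>, hence \<open>x\<close> is.
\<close>

lemma N_less_mem:
  assumes "N x < 1"
  shows "mem x"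
proof -
  obtain c d where cd: "d > 0" "mem (pw c * x ^ d)" "real p powr (- (real_of_int c / real d)) < 1"
    using N_less[OF assms] by blast
  have "c > 0"
  proof (rule ccontr)
    assume "\<not> c > 0"
    hence "- (real_of_int c / real d) \<ge> 0" using cd(1) by (simp add: divide_nonpos_pos)
    hence "real p powr (- (real_of_int c / real d)) \<ge> 1" using p_gt by (intro ge_one_powr_ge_zero) auto
    thus False using cd by simp
  qed
  have "ev (x ^ d) = ev (of_nat p ^ nat c * (pw c * x ^ d))"
    using ev_pinv_power'(2)[of "nat c" "x ^ d"] \<open>c > 0\<close> by (simp add: pw_def del: ev.mult ev.power ev.of_nat)
  moreover have "mem (of_nat p ^ nat c * (pw c * x ^ d))"
    by (intro mem_mult mem_power mem_of_nat cd)
  ultimately have "mem (x ^ d)" using mem_cong by blast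
  thus ?thesis using mem_power_cancel cd(1) by blast
qed

lemma N_zero: "N 0 = 0"
proof -
  have "N 0 \<le> inverse (real p) ^ n" for n
    using N_le[of 1 "int n" 0] p_gt by (simp add: mem_0 powr_minus powr_realpow power_inverse)
  moreover have "(\<lambda>n. inverse (real p) ^ n) \<longlonglongrightarrow> 0"
    using p_gt by (intro LIMSEQ_power_zero) (simp add: field_simps)
  ultimately have "N 0 \<le> 0" by (intro LIMSEQ_le_const) auto
  thus ?thesis using N_nonneg[of 0] by simp
qed

text \<open>
  This allows for testing two elements with a common exponent.
\<close>

lemma mem_rescale:
  assumes "mem (pw c * x ^ d)" "C \<le> c * int n"
  shows "mem (pw C * x ^ (d * n))"
proof -
  have eq: "ev (pw C * x ^ (d * n)) = ev (pw (C - c * int n) * (pw c * x ^ d) ^ n)"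
  proof -
    have "ev (pw C) = ev (pw (C - c * int n) * pw c ^ n)"
      using ev_pw_add[of "C - c * int n" "c * int n"] ev_pw_power[of c n] by simp
    from ev_mult_cong[OF this refl] show ?thesis
      by (simp only: power_mult power_mult_distrib mult.assoc)
  qed
  have "mem (pw (C - c * int n) * (pw c * x ^ d) ^ n)"
    by (rule mem_mult[OF mem_pw mem_power[OF assms(1)]]) (use assms in simp)
  thus ?thesis using mem_cong[OF eq] by simp
qed

text \<open>
  Rescaling exponents, one may compare \<open>x\<^sup>D\<close> and \<open>y\<^sup>D\<close>. If both are in \<open>p\<^sup>C A\<close>, then so are all
  mixed products \<open>x\<^sup>l y\<^sup>D\<^sup>-\<^sup>l\<close>, because their \<open>D\<close>-th powers are in \<open>p\<^sup>C\<^sup>D A\<close> and \<open>A\<close> is integrally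
  closed. So \<open>(x - y)\<^sup>D\<close> is in \<open>p\<^sup>C A\<close>.
\<close>

lemma N_diff_le: "N (x - y) \<le> max (N x) (N y)"
proof (rule field_le_epsilon)
  fix e :: real assume "e > 0"
  have "N x < N x + e" using \<open>e > 0\<close> by simp
  then obtain c d where x: "d > 0" "mem (pw c * x ^ d)" "real p powr (- (real_of_int c / real d)) < N x + e"
    by (rule N_less)
  have "N y < N y + e" using \<open>e > 0\<close> by simp
  then obtain c' d' where y: "d' > 0" "mem (pw c' * y ^ d')" "real p powr (- (real_of_int c' / real d')) < N y + e"
    by (rule N_less)
  define C D where "C = min (c * int d') (c' * int d)" and "D = d * d'"
  have D: "D > 0" using x y by (simp add: D_def)
  have mx: "mem (pw C * x ^ D)"
    unfolding D_def by (rule mem_rescale[OF x(2)]) (simp add: C_def)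
  have my: "mem (pw C * (- y) ^ D)"
  proof -
    have "mem (pw c' * (- y) ^ d')"
      using y(2) mem_uminus by (cases "even d'") auto
    hence "mem (pw C * (- y) ^ (d' * d))" by (rule mem_rescale) (simp add: C_def)
    thus ?thesis by (simp add: D_def mult.commute)
  qed
  have "mem (pw C * (x - y) ^ D)"
  proof -
    have "(x + (- y)) ^ D = (\<Sum>l\<le>D. of_nat (D choose l) * x ^ l * (- y) ^ (D - l))"
      by (rule binomial_ring)
    hence eq: "pw C * (x - y) ^ D = (\<Sum>l\<le>D. of_nat (D choose l) * (pw C * (x ^ l * (- y) ^ (D - l))))"
      by (simp add: sum_distrib_left ac_simps)
    show ?thesis
      unfolding eq
    proof (intro mem_sum mem_mult[OF mem_of_nat])
      fix l assume "l \<in> {..D}"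
      hence l: "l + (D - l) = D" by simp
      have "(pw C * (x ^ l * (- y) ^ (D - l))) ^ D = pw C ^ (l + (D - l)) * (x ^ l * (- y) ^ (D - l)) ^ D"
        unfolding l by (rule power_mult_distrib)
      also have "\<dots> = (pw C * x ^ D) ^ l * (pw C * (- y) ^ D) ^ (D - l)"
        by (simp add: power_mult_distrib power_add ac_simps flip: power_mult)
      also have "mem \<dots>"
        by (intro mem_mult mem_power mx my)
      finally show "mem (pw C * (x ^ l * (- y) ^ (D - l)))"
        using D by (rule mem_power_cancel)
    qed
  qed
  from N_le[OF D this] have "N (x - y) \<le> real p powr (- (real_of_int C / real D))" .
  also have "\<dots> \<le> max (N x) (N y) + e"
  proof (cases "c * int d' \<le> c' * int d")
    case True
    hence "real_of_int C / real D = real_of_int c / real d" using x y by (simp add: C_def D_def)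
    thus ?thesis using x by simp
  next
    case False
    hence "real_of_int C / real D = real_of_int c' / real d'" using x y by (simp add: C_def D_def)
    thus ?thesis using y by simp
  qed
  finally show "N (x - y) \<le> max (N x) (N y) + e" .
qed

lemma N_mult_le: "N (x * y) \<le> N x * N y"
proof -
  have *: "N (x * y) \<le> (N x + e) * (N y + e)" if "e > 0" for e
  proof -
    have "N x < N x + e" using \<open>e > 0\<close> by simp
    then obtain c d where x: "d > 0" "mem (pw c * x ^ d)" "real p powr (- (real_of_int c / real d)) < N x + e"
      by (rule N_less)
    have "N y < N y + e" using \<open>e > 0\<close> by simp
    then obtain c' d' where y: "d' > 0" "mem (pw c' * y ^ d')" "real p powr (- (real_of_int c' / real d')) < N y + e"
      by (rule N_less)
    have "mem (pw (c * int d') * x ^ (d * d'))" by (rule mem_rescale[OF x(2)]) simp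
    moreover have "mem (pw (c' * int d) * y ^ (d' * d))" by (rule mem_rescale[OF y(2)]) simp
    ultimately have "mem ((pw (c * int d') * x ^ (d * d')) * (pw (c' * int d) * y ^ (d' * d)))"
      by (rule mem_mult)
    moreover have "ev ((pw (c * int d') * x ^ (d * d')) * (pw (c' * int d) * y ^ (d' * d))) =
        ev (pw (c * int d' + c' * int d) * (x * y) ^ (d * d'))"
      using ev_mult_cong[OF ev_pw_add[of "c * int d'" "c' * int d"] refl, of "(x * y) ^ (d * d')"]
      by (simp only: power_mult_distrib ac_simps)
    ultimately have "mem (pw (c * int d' + c' * int d) * (x * y) ^ (d * d'))"
      using mem_cong by blast
    hence "N (x * y) \<le> real p powr (- (real_of_int (c * int d' + c' * int d) / real (d * d')))"
      by (rule N_le[rotated]) (use x y in simp)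
    also have "- (real_of_int (c * int d' + c' * int d) / real (d * d')) =
        - (real_of_int c / real d) + - (real_of_int c' / real d')"
      using x y by (simp add: field_simps)
    also have "real p powr \<dots> = real p powr (- (real_of_int c / real d)) * real p powr (- (real_of_int c' / real d'))"
      by (rule powr_add)
    also have "\<dots> \<le> (N x + e) * (N y + e)"
      using x y N_nonneg[of x] \<open>e > 0\<close> by (intro mult_mono) auto
    finally show ?thesis .
  qed
  have "((\<lambda>e. (N x + e) * (N y + e)) \<longlongrightarrow> (N x + 0) * (N y + 0)) (at_right 0)"
    by (intro tendsto_intros)
  hence "N (x * y) \<le> (N x + 0) * (N y + 0)"
    by (rule tendsto_lowerbound) (use * in \<open>auto simp: eventually_at_right_less intro!: eventually_mono[OF eventually_at_right_less]\<close>)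
  thus ?thesis by simp
qed

lemma N_power_eq:
  assumes "n > 0"
  shows "N (x ^ n) = N x ^ n"
proof (rule antisym)
  show "N (x ^ n) \<le> N x ^ n"
    using assms
  proof (induction n rule: nat_induct_non_zero)
    case (Suc n)
    have "N (x ^ Suc n) \<le> N x * N (x ^ n)" using N_mult_le[of x "x ^ n"] by simp
    also have "\<dots> \<le> N x * N x ^ n" using Suc N_nonneg by (intro mult_left_mono) auto
    finally show ?case by simp
  qed simp
  show "N x ^ n \<le> N (x ^ n)"
  proof (rule N_ge)
    fix c d assume cd: "d > 0" "mem (pw c * (x ^ n) ^ d)"
    hence "N x \<le> real p powr (- (real_of_int c / real (n * d)))"
      using assms by (intro N_le) (auto simp: power_mult)
    hence "N x ^ n \<le> (real p powr (- (real_of_int c / real (n * d)))) ^ n"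
      using N_nonneg by (intro power_mono) auto
    also have "\<dots> = real p powr (- (real_of_int c / real (n * d)) * real n)"
      using p_gt by (simp add: powr_powr flip: powr_realpow)
    also have "- (real_of_int c / real (n * d)) * real n = - (real_of_int c / real d)"
      using assms by simp
    finally show "N x ^ n \<le> real p powr (- (real_of_int c / real d))" .
  qed
qed

lemma N_p_eq: "N (of_nat p * x) = N x / p"
proof (rule antisym)
  have powr: "real p powr (- (real_of_int (c + int d) / real d)) = real p powr (- (real_of_int c / real d)) / p"
    if "d > 0" for c d
  proof -
    have "- (real_of_int (c + int d) / real d) = - (real_of_int c / real d) + - 1"
      using that by (simp add: field_simps)
    thus ?thesis using p_gt by (simp only: powr_add powr_minus) (simp add: divide_inverse)
  qed
  have mem: "mem (pw (c + int d) * (of_nat p * x) ^ d) \<longleftrightarrow> mem (pw c * x ^ d)" for c d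
  proof (rule mem_cong)
    have "ev (pw (c + int d) * (of_nat p * x) ^ d) = ev ((pw c * pw (int d)) * (of_nat p * x) ^ d)"
      by (intro ev_mult_cong ev_pw_add refl)
    also have "(pw c * pw (int d)) * (of_nat p * x) ^ d = pinv ^ d * (of_nat p ^ d * (pw c * x ^ d))"
      unfolding pw_pos by (simp add: power_mult_distrib ac_simps)
    also have "ev \<dots> = ev (pw c * x ^ d)" by (rule ev_pinv_power')
    finally show "ev (pw (c + int d) * (of_nat p * x) ^ d) = ev (pw c * x ^ d)" .
  qed
  have "p * N (of_nat p * x) \<le> N x"
  proof (rule N_ge)
    fix c d assume "d > 0" "mem (pw c * x ^ d)"
    hence "N (of_nat p * x) \<le> real p powr (- (real_of_int c / real d)) / p"
      using N_le[of d "c + int d" "of_nat p * x"] mem powr by simp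
    thus "p * N (of_nat p * x) \<le> real p powr (- (real_of_int c / real d))"
      using p_gt by (simp add: pos_le_divide_eq mult.commute)
  qed
  thus "N (of_nat p * x) \<le> N x / p"
    using p_gt by (simp add: pos_le_divide_eq mult.commute)
  show "N x / p \<le> N (of_nat p * x)"
  proof (rule N_ge)
    fix c d assume d: "d > 0" "mem (pw c * (of_nat p * x) ^ d)"
    hence "N x \<le> real p powr (- (real_of_int (c - int d) / real d))"
      using mem[of "c - int d" d] by (intro N_le) auto
    thus "N x / p \<le> real p powr (- (real_of_int c / real d))"
      using powr[OF d(1), of "c - int d"] p_gt by (simp add: divide_le_cancel)
  qed
qed

sublocale N: p_seminorm N p
  by unfold_locales (auto simp: N_nonneg N_zero N_diff_le N_mult_le N_power_eq prime N_p_eq)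

text \<open>
  Since \<open>p\<close> is invertible in \<open>R\<close>, membership in \<open>p\<^sup>j A\<close> can be tested by dividing by \<open>p\<^sup>j\<close>.
\<close>

definition memp :: "nat \<Rightarrow> 'a zpoly \<Rightarrow> bool" where
  "memp j a \<longleftrightarrow> mem (pinv ^ j * a)"

lemma memp_0 [simp]: "memp 0 a \<longleftrightarrow> mem a"
  by (simp add: memp_def)

lemma memp_cong: "ev a = ev b \<Longrightarrow> memp j a \<longleftrightarrow> memp j b"
  unfolding memp_def by (intro mem_cong ev_mult_cong refl)

lemma memp_p_power: "memp j (of_nat p ^ j * a) \<longleftrightarrow> mem a"
  unfolding memp_def by (intro mem_cong ev_pinv_power')

sublocale memp: p_filtration p memp
proof
  show "memp 1 (of_nat p)"
    using memp_p_power[of 1 1] mem_1 by simp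
  show "memp j (a - b)" if "memp j a" "memp j b" for j a b
    using mem_diff that by (simp add: memp_def right_diff_distrib)
  show "memp (i + j) (a * b)" if "memp i a" "memp j b" for i j a b
    using mem_mult[of "pinv ^ i * a" "pinv ^ j * b"] that by (simp add: memp_def power_add ac_simps del: ev.mult)
  show "memp j a" if "memp (Suc j) a" for j a
  proof -
    have "mem (of_nat p ^ 1 * (pinv ^ Suc j * a))"
      using mem_mult[OF mem_power[OF mem_of_nat], OF that[unfolded memp_def]] .
    moreover have "ev (of_nat p ^ 1 * (pinv ^ Suc j * a)) = ev (pinv ^ j * a)"
      using ev_pinv_power'(2)[of 1 "pinv ^ j * a"] by (simp add: mult.assoc del: ev.mult ev.power ev.of_nat)
    ultimately show ?thesis unfolding memp_def using mem_cong by blast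
  qed
  show "memp j a" if "memp (k + j) (of_nat p ^ k * a)" for k j a
  proof -
    have "ev (pinv ^ (k + j) * (of_nat p ^ k * a)) = ev (pinv ^ j * a)"
      using ev_mult_cong[OF refl ev_pinv_power'(1), of "pinv ^ j" k a] by (simp only: power_add ac_simps)
    thus ?thesis using that unfolding memp_def using mem_cong by blast
  qed
qed (auto simp: prime mem_1 memp_def mem_0)

lemma N_memp: "memp j a \<Longrightarrow> N a \<le> 1 / real p ^ j"
proof -
  assume a: "memp j a"
  have "N a = N (of_nat p ^ j * (pinv ^ j * a))" by (intro N_cong ev_pinv_power'(2)[symmetric])
  also have "\<dots> \<le> 1 / real p ^ j"
    unfolding N.N_p_power using mem_N_le[OF a[unfolded memp_def]] by (intro divide_right_mono) auto
  finally show ?thesis .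
qed

lemma N_less_memp:
  assumes "N a < 1 / real p ^ j"
  shows "memp j a"
proof -
  have "N a = N (pinv ^ j * a) / real p ^ j"
    using N_cong[OF ev_pinv_power'(2), of j a] by (simp add: N.N_p_power)
  hence "N (pinv ^ j * a) < 1" using assms p_gt by (simp add: divide_less_cancel)
  thus ?thesis unfolding memp_def by (rule N_less_mem)
qed

lemma PIdl_iff:
  assumes "mem a"
  shows "ev a \<in> PIdl\<^bsub>A\<^esub> (p_elem p A [^]\<^bsub>A\<^esub> n) \<longleftrightarrow> memp n a"
proof
  assume "ev a \<in> PIdl\<^bsub>A\<^esub> (p_elem p A [^]\<^bsub>A\<^esub> n)"
  then obtain b where b: "b \<in> carrier A" "ev a = b \<otimes>\<^bsub>R\<^esub> p_elem p R [^]\<^bsub>R\<^esub> n"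
    by (auto simp: cgenideal_def A_ops A_p_elem A_pow)
  hence "ev a = ev (of_nat p ^ n * X b)"
    using A_sub by (simp add: ev_p[symmetric] R.m_comm subset_iff)
  moreover have "mem (X b)" using b A_sub by (simp add: mem_def subset_iff)
  ultimately show "memp n a" using memp_cong memp_p_power by blast
next
  assume "memp n a"
  hence "ev (pinv ^ n * a) \<in> carrier A" by (simp add: memp_def mem_def)
  moreover have "ev a = ev (pinv ^ n * a) \<otimes>\<^bsub>R\<^esub> p_elem p R [^]\<^bsub>R\<^esub> n"
    using ev_pinv_power'(2)[of n a] by (simp add: ev_p[symmetric] R.m_comm R.m_assoc)
  ultimately show "ev a \<in> PIdl\<^bsub>A\<^esub> (p_elem p A [^]\<^bsub>A\<^esub> n)"
    unfolding cgenideal_def A_ops A_p_elem A_pow by blast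
qed

lemma A_limit:
  assumes "\<And>n. mem (a n)" "\<And>n. memp n (a (Suc n) - a n)"
  obtains x where "mem x" "\<And>n. memp n (x - a n)"
    "\<And>y. mem y \<Longrightarrow> (\<And>n. memp n (y - a n)) \<Longrightarrow> ev y = ev x"
proof -
  let ?P = "\<lambda>x. x \<in> carrier A \<and> (\<forall>n. x \<ominus>\<^bsub>A\<^esub> ev (a n) \<in> PIdl\<^bsub>A\<^esub> (p_elem p A [^]\<^bsub>A\<^esub> n))"
  have P: "?P (ev x) \<longleftrightarrow> (\<forall>n. memp n (x - a n))" if "mem x" for x
  proof -
    have "ev x \<ominus>\<^bsub>A\<^esub> ev (a n) = ev (x - a n)" for n
      using assms(1)[of n] that by (simp add: mem_def A_minus)
    thus ?thesis using that assms(1) by (simp add: PIdl_iff mem_diff mem_def[symmetric] del: ev.diff)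
  qed
  have "\<exists>!x. ?P x"
  proof (rule complete_A[unfolded p_adically_complete_def, rule_format], intro conjI allI)
    fix n
    show "ev (a n) \<in> carrier A" using assms(1) by (simp add: mem_def)
    have "ev (a (Suc n)) \<ominus>\<^bsub>A\<^esub> ev (a n) = ev (a (Suc n) - a n)"
      using assms(1)[of n] by (simp add: mem_def A_minus)
    thus "ev (a (Suc n)) \<ominus>\<^bsub>A\<^esub> ev (a n) \<in> PIdl\<^bsub>A\<^esub> (p_elem p A [^]\<^bsub>A\<^esub> n)"
      using assms PIdl_iff[OF mem_diff] by (simp del: ev.diff)
  qed
  then obtain x where x: "?P x" and unique: "\<And>y. ?P y \<Longrightarrow> y = x" by blast
  have ev_x: "ev (X x) = x" using x A_sub by auto
  show ?thesis
  proof (rule that[of "X x"])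
    show mem_x: "mem (X x)" using x ev_x by (simp add: mem_def)
    show "memp n (X x - a n)" for n using P[OF mem_x] x ev_x by simp
    show "ev y = ev (X x)" if y: "mem y" "\<And>n. memp n (y - a n)" for y
      unfolding ev_x by (rule unique) (use P[OF y(1)] y(2) in blast)
  qed
qed

text \<open>
  An element of seminorm zero is in \<open>p\<^sup>n A\<close> for all \<open>n\<close>, and \<open>A\<close> is \<open>p\<close>-adically separated.
\<close>

lemma N_eq_0_iff: "N a = 0 \<longleftrightarrow> ev a = \<zero>\<^bsub>R\<^esub>"
proof
  assume "N a = 0"
  hence a: "memp n a" for n using p_gt by (intro N_less_memp) auto
  show "ev a = \<zero>\<^bsub>R\<^esub>"
  proof (rule A_limit[of "\<lambda>_. 0"])
    fix x assume x: "\<And>y. mem y \<Longrightarrow> (\<And>n. memp n (y - 0)) \<Longrightarrow> ev y = ev x"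
    have "mem a" using a[of 0] by simp
    hence "ev a = ev x" by (rule x) (use a in simp)
    also have "ev x = ev 0" by (rule x[symmetric]) (simp_all add: mem_0 memp.Q_0)
    finally show ?thesis by simp
  qed (simp_all add: mem_0 memp.Q_0)
next
  assume "ev a = \<zero>\<^bsub>R\<^esub>"
  thus "N a = 0" using N_cong[of a 0] N_zero by simp
qed

lemma eqv_iff: "N.eqv a b \<longleftrightarrow> ev a = ev b"
  unfolding N.eqv_def N_eq_0_iff by (simp add: R.r_right_minus_eq)

text \<open>
  After passing to a subsequence and subtracting the first term, the sequence is in \<open>A\<close>, and successive
  terms are congruent modulo increasing powers of \<open>p\<close>.
\<close>

lemma complete_N:
  assumes lim: "(\<lambda>l. N (s (Suc l) - s l)) \<longlonglongrightarrow> 0"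
  shows "\<exists>z. N.tends s z"
proof -
  have "\<exists>L. \<forall>l\<ge>L. N (s (Suc l) - s l) < 1 / real p ^ n" for n
    using order_tendstoD(2)[OF lim, of "1 / real p ^ n"] p_gt by (simp add: eventually_sequentially)
  then obtain L0 where L0: "\<And>n l. l \<ge> L0 n \<Longrightarrow> N (s (Suc l) - s l) < 1 / real p ^ n" by metis
  define L where "L n = (\<Sum>i\<le>n. L0 i)" for n
  have L_ge: "L0 n \<le> L n" for n by (simp add: L_def member_le_sum)
  have L_mono: "L n \<le> L (Suc n)" "L 0 \<le> L n" for n
    by (simp add: L_def) (simp add: L_def member_le_sum[of 0 "{..n}" L0])
  have diff: "N (s l - s (L n)) < 1 / real p ^ n" if "l \<ge> L n" for n l
    using that
  proof (induction l rule: dec_induct)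
    case base
    thus ?case using p_gt by (simp add: N_zero)
  next
    case (step l)
    have "N (s (Suc l) - s l) < 1 / real p ^ n" using L_ge[of n] step by (intro L0) simp
    thus ?case using N.N_trans[of "s (Suc l)" "s (L n)" "s l"] step by simp
  qed
  define a where "a n = s (L n) - s (L 0)" for n
  obtain x where x: "\<And>n. memp n (x - a n)"
  proof (rule A_limit[of a], rule_tac [3] that)
    show "mem (a n)" for n using diff[of 0 "L n"] L_mono by (intro N_less_mem) (simp add: a_def)
    show "memp n (a (Suc n) - a n)" for n
      using diff[of n "L (Suc n)"] L_mono by (intro N_less_memp) (simp add: a_def)
  qed assumption
  have le: "N (s l - (x + s (L 0))) \<le> 1 / real p ^ n" if "l \<ge> L n" for l n
  proof -
    have "x - a n = (x + s (L 0)) - s (L n)" by (simp add: a_def)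
    with N_memp[OF x[of n]] have "N ((x + s (L 0)) - s (L n)) \<le> 1 / real p ^ n" by simp
    thus ?thesis
      using diff[OF that] N.N_trans[of "s l" "x + s (L 0)" "s (L n)"]
        N.N_commute[of "x + s (L 0)" "s (L n)"] by linarith
  qed
  have "N.tends s (x + s (L 0))"
    unfolding N.tends_def
  proof (rule LIMSEQ_I)
    fix r :: real assume "r > 0"
    have "eventually (\<lambda>n. 1 / real p ^ Suc n < r) sequentially"
      using order_tendstoD(2)[OF N.p_power_tendsto_0 \<open>r > 0\<close>, of 1] .
    then obtain n where n: "1 / real p ^ Suc n < r" by (auto simp: eventually_sequentially)
    show "\<exists>no. \<forall>l\<ge>no. norm (N (s l - (x + s (L 0))) - 0) < r"
      using le[of "Suc n"] n N_nonneg by (intro exI[of _ "L (Suc n)"]) (auto intro: order_le_less_trans)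
  qed
  thus ?thesis by blast
qed

sublocale N: p_banach N p
proof
  show "\<exists>y. N.eqv (of_nat p * y) x" for x
    using ev_pinv_power'(2)[of 1 x] by (intro exI[of _ "pinv * x"]) (simp add: eqv_iff del: ev.mult ev.of_nat)
qed (rule complete_N)

end


section \<open>The ring \<open>R'\<close>\<close>

context complete_p_normal
begin

abbreviation R' :: "(nat \<Rightarrow> 'a) ring" where "R' \<equiv> R_prime p R nu"
abbreviation nu' :: "(nat \<Rightarrow> 'a) \<Rightarrow> real" where "nu' \<equiv> R_prime_norm nu"

abbreviation lift :: "(nat \<Rightarrow> 'a) \<Rightarrow> nat \<Rightarrow> 'a zpoly" where "lift s \<equiv> (\<lambda>m. X (s m))"

lemma R'_simps [simp]:
  "carrier R' = p_power_seqs p R"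
  "one R' = (\<lambda>m. \<one>\<^bsub>R\<^esub>)" "zero R' = (\<lambda>m. \<zero>\<^bsub>R\<^esub>)"
  "mult R' = (\<lambda>x y m. x m \<otimes>\<^bsub>R\<^esub> y m)"
  by (simp_all add: R_prime_def)

lemma R'_closed: "s \<in> p_power_seqs p R \<Longrightarrow> s m \<in> carrier R"
  by (simp add: p_power_seqs_def)

lemma R'_power: "s \<in> p_power_seqs p R \<Longrightarrow> s (Suc m) [^]\<^bsub>R\<^esub> p = s m"
  by (simp add: p_power_seqs_def)

lemma ev_lift [simp]: "s \<in> p_power_seqs p R \<Longrightarrow> ev (X (s m)) = s m"
  by (simp add: R'_closed)

lemma pseq_lift: "s \<in> p_power_seqs p R \<Longrightarrow> N.pseq (lift s)"
  by (simp add: N.pseq_def eqv_iff R'_power)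

lemma pbounded_lift: "s \<in> p_power_seqs p R \<Longrightarrow> N.pbounded (lift s)"
  using pseq_lift N.pseq_pbounded by blast

lemma X_ev: "N.eqv (X (ev a)) a"
  by (simp add: eqv_iff)

text \<open>
  The results of ring operations in \<open>R'\<close> are close to those of termwise operations. As an element of
  \<open>R'\<close> is determined by any sequence close to it, the ring laws of \<open>R'\<close> follow from those of \<open>R\<close>.
\<close>

lemma R'_eqI:
  assumes "s \<in> p_power_seqs p R" "t \<in> p_power_seqs p R" "N.pclose (lift s) (lift t)"
  shows "s = t"
proof
  fix m
  have "N.eqv (lift s m) (lift t m)"
    by (rule N.pseq_unique) (use assms pseq_lift in auto)
  thus "s m = t m" using assms by (simp add: eqv_iff)
qed

lemma R'_exists:
  assumes "N.pbounded a" "N.pclose (\<lambda>m. a (Suc m) ^ p) a"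
  shows "\<exists>s\<in>p_power_seqs p R. N.pclose (lift s) a"
proof -
  obtain s where s: "N.pseq s" "N.pclose s a" using N.pseq_exists[OF assms] by blast
  have "(\<lambda>m. ev (s m)) \<in> p_power_seqs p R"
    using s(1) by (simp add: p_power_seqs_def N.pseq_def eqv_iff)
  moreover have "N.pclose (lift (\<lambda>m. ev (s m))) a"
    by (rule N.pclose_trans[OF N.pclose_refl s(2)]) (rule X_ev)
  ultimately show ?thesis by (rule bexI[where x = "\<lambda>m. ev (s m)", rotated])
qed

lemma seq_lim_eq:
  assumes "N.tends s (X z)" "z \<in> carrier R" "\<And>l. t l = ev (s l)"
  shows "seq_lim R nu t = z"
  unfolding seq_lim_def
proof (rule the_equality)
  have *: "N.tends s (X w) \<longleftrightarrow> (\<lambda>l. nu (t l \<ominus>\<^bsub>R\<^esub> w)) \<longlonglongrightarrow> 0" if "w \<in> carrier R" for w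
    using that by (simp add: N.tends_def N_def assms(3))
  show "z \<in> carrier R \<and> (\<lambda>l. nu (t l \<ominus>\<^bsub>R\<^esub> z)) \<longlonglongrightarrow> 0" using assms * by blast
  fix w assume "w \<in> carrier R \<and> (\<lambda>l. nu (t l \<ominus>\<^bsub>R\<^esub> w)) \<longlonglongrightarrow> 0"
  hence "w \<in> carrier R" "N.eqv (X w) (X z)" using * assms N.tends_unique by blast+
  thus "w = z" using assms by (simp add: eqv_iff)
qed

lemma R'_add:
  assumes s: "s \<in> p_power_seqs p R" and t: "t \<in> p_power_seqs p R"
  shows "s \<oplus>\<^bsub>R'\<^esub> t \<in> p_power_seqs p R"
    and "N.pclose (lift (s \<oplus>\<^bsub>R'\<^esub> t)) (\<lambda>m. lift s m + lift t m)"
proof -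
  let ?a = "\<lambda>m. lift s m + lift t m"
  have bdd: "N.pbounded ?a" by (intro N.pbounded_add pbounded_lift s t)
  have "N.pclose (\<lambda>m. ?a (Suc m) ^ p) (\<lambda>m. lift s (Suc m) ^ p + lift t (Suc m) ^ p)"
    by (intro N.pclose_prime_power_add pbounded_lift s t)
  moreover have "N.pclose (\<lambda>m. lift s (Suc m) ^ p + lift t (Suc m) ^ p) ?a"
    by (intro N.pclose_refl N.eqv_add) (use pseq_lift s t in \<open>auto simp: N.pseq_def\<close>)
  ultimately have "N.pclose (\<lambda>m. ?a (Suc m) ^ p) ?a" by (rule N.pclose_trans)
  from R'_exists[OF bdd this] obtain r where r: "r \<in> p_power_seqs p R" "N.pclose (lift r) ?a" by blast
  have "s \<oplus>\<^bsub>R'\<^esub> t = r"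
  proof
    fix m
    have "N.tends (\<lambda>l. ?a (m + l) ^ p ^ l) (X (r m))"
      by (rule N.pseq_limit[OF pseq_lift r(2) bdd]) fact
    hence "seq_lim R nu (\<lambda>l. (s (m + l) \<oplus>\<^bsub>R\<^esub> t (m + l)) [^]\<^bsub>R\<^esub> (p ^ l)) = r m"
      by (rule seq_lim_eq) (use r s t in \<open>simp_all add: R'_closed\<close>)
    thus "(s \<oplus>\<^bsub>R'\<^esub> t) m = r m" by (simp add: R_prime_def)
  qed
  thus "s \<oplus>\<^bsub>R'\<^esub> t \<in> p_power_seqs p R" "N.pclose (lift (s \<oplus>\<^bsub>R'\<^esub> t)) ?a" using r by auto
qed

lemma R'_add_pclose:
  assumes "s \<in> p_power_seqs p R" "t \<in> p_power_seqs p R" "N.pclose (lift s) a" "N.pclose (lift t) b"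
  shows "N.pclose (lift (s \<oplus>\<^bsub>R'\<^esub> t)) (\<lambda>m. a m + b m)"
  by (rule N.pclose_trans[OF R'_add(2)[OF assms(1,2)] N.pclose_add[OF assms(3,4)]])

lemma R'_mult:
  assumes "s \<in> p_power_seqs p R" "t \<in> p_power_seqs p R"
  shows "(\<lambda>m. s m \<otimes>\<^bsub>R\<^esub> t m) \<in> p_power_seqs p R"
    and "N.pclose (lift (\<lambda>m. s m \<otimes>\<^bsub>R\<^esub> t m)) (\<lambda>m. lift s m * lift t m)"
proof -
  show "(\<lambda>m. s m \<otimes>\<^bsub>R\<^esub> t m) \<in> p_power_seqs p R"
    using assms by (simp add: p_power_seqs_def R.nat_pow_distrib)
  show "N.pclose (lift (\<lambda>m. s m \<otimes>\<^bsub>R\<^esub> t m)) (\<lambda>m. lift s m * lift t m)"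
    by (rule N.pclose_refl) (use assms in \<open>simp add: eqv_iff R'_closed\<close>)
qed

lemma R'_one: "(\<lambda>m. \<one>\<^bsub>R\<^esub>) \<in> p_power_seqs p R" "N.pclose (lift (\<lambda>m. \<one>\<^bsub>R\<^esub>)) (\<lambda>m. 1)"
  by (simp add: p_power_seqs_def) (rule N.pclose_refl, simp add: eqv_iff)

lemma R'_mult_pclose:
  assumes "s \<in> p_power_seqs p R" "t \<in> p_power_seqs p R" "N.pclose (lift s) a" "N.pclose (lift t) b"
  shows "N.pclose (lift (\<lambda>m. s m \<otimes>\<^bsub>R\<^esub> t m)) (\<lambda>m. a m * b m)"
  by (rule N.pclose_trans[OF R'_mult(2)[OF assms(1,2)] N.pclose_mult[OF assms(3,4)]])
    (use N.pclose_pbounded[OF N.pclose_sym] assms pbounded_lift in blast)+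

lemma R'_zero: "(\<lambda>m. \<zero>\<^bsub>R\<^esub>) \<in> p_power_seqs p R" "N.pclose (lift (\<lambda>m. \<zero>\<^bsub>R\<^esub>)) (\<lambda>m. 0)"
  using p_gt by (simp add: p_power_seqs_def R.nat_pow_zero) (rule N.pclose_refl, simp add: eqv_iff)

text \<open>
  For odd \<open>p\<close> the negatives could be taken termwise, but not for \<open>p = 2\<close>.
\<close>

lemma R'_neg_exists:
  assumes s: "s \<in> p_power_seqs p R"
  shows "\<exists>r\<in>p_power_seqs p R. N.pclose (lift r) (\<lambda>m. - lift s m)"
proof (rule R'_exists)
  show bdd: "N.pbounded (\<lambda>m. - lift s m)"
    using pbounded_lift[OF s] by (simp add: N.pbounded_def)
  have "N.pclose (\<lambda>m. (lift s (Suc m) + - lift s (Suc m)) ^ p) (\<lambda>m. lift s (Suc m) ^ p + (- lift s (Suc m)) ^ p)"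
    using N.pclose_prime_power_add[OF pbounded_lift[OF s] bdd] .
  hence "N.pclose (\<lambda>m. lift s (Suc m) ^ p + (- lift s (Suc m)) ^ p) (\<lambda>m. 0)"
    by (rule N.pclose_sym[OF back_subst[of "\<lambda>a. N.pclose a _"]]) (simp add: zero_power p_gt)
  hence "N.pclose (\<lambda>m. (lift s (Suc m) ^ p + (- lift s (Suc m)) ^ p) - lift s (Suc m) ^ p) (\<lambda>m. 0 - lift s m)"
    by (rule N.pclose_diff) (rule N.pclose_refl, use pseq_lift[OF s] in \<open>simp add: N.pseq_def\<close>)
  thus "N.pclose (\<lambda>m. (- lift s (Suc m)) ^ p) (\<lambda>m. - lift s m)" by simp
qed

lemma R'_cring: "cring R'"
proof (rule cringI)
  have trans2: "N.pclose a b \<Longrightarrow> N.pclose c b \<Longrightarrow> N.pclose a c" for a b c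
    using N.pclose_trans N.pclose_sym by blast
  have refl: "N.pclose a a" for a by (rule N.pclose_refl) simp
  show "abelian_group R'"
  proof (rule abelian_groupI; (unfold R'_simps)?)
    fix s t u assume s: "s \<in> p_power_seqs p R" and t: "t \<in> p_power_seqs p R" and u: "u \<in> p_power_seqs p R"
    show "s \<oplus>\<^bsub>R'\<^esub> t \<in> p_power_seqs p R" by (rule R'_add[OF s t])
    show "s \<oplus>\<^bsub>R'\<^esub> t \<oplus>\<^bsub>R'\<^esub> u = s \<oplus>\<^bsub>R'\<^esub> (t \<oplus>\<^bsub>R'\<^esub> u)"
    proof (rule R'_eqI)
      have "N.pclose (lift (s \<oplus>\<^bsub>R'\<^esub> t \<oplus>\<^bsub>R'\<^esub> u)) (\<lambda>m. (lift s m + lift t m) + lift u m)"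
        by (rule R'_add_pclose[OF R'_add(1)[OF s t] u R'_add(2)[OF s t] refl])
      moreover have "N.pclose (lift (s \<oplus>\<^bsub>R'\<^esub> (t \<oplus>\<^bsub>R'\<^esub> u))) (\<lambda>m. lift s m + (lift t m + lift u m))"
        by (rule R'_add_pclose[OF s R'_add(1)[OF t u] refl R'_add(2)[OF t u]])
      ultimately show "N.pclose (lift (s \<oplus>\<^bsub>R'\<^esub> t \<oplus>\<^bsub>R'\<^esub> u)) (lift (s \<oplus>\<^bsub>R'\<^esub> (t \<oplus>\<^bsub>R'\<^esub> u)))"
        unfolding add.assoc by (rule trans2)
    qed (intro R'_add s t u)+
    show "s \<oplus>\<^bsub>R'\<^esub> t = t \<oplus>\<^bsub>R'\<^esub> s"
    proof (rule R'_eqI[OF R'_add(1)[OF s t] R'_add(1)[OF t s]], rule trans2[OF R'_add(2)[OF s t]])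
      show "N.pclose (lift (t \<oplus>\<^bsub>R'\<^esub> s)) (\<lambda>m. lift s m + lift t m)"
        using R'_add(2)[OF t s] by (simp add: add.commute)
    qed
  next
    show "(\<lambda>m. \<zero>\<^bsub>R\<^esub>) \<in> p_power_seqs p R" by (rule R'_zero)
    fix s assume s: "s \<in> p_power_seqs p R"
    show "(\<lambda>m. \<zero>\<^bsub>R\<^esub>) \<oplus>\<^bsub>R'\<^esub> s = s"
    proof (rule R'_eqI)
      have "N.pclose (lift ((\<lambda>m. \<zero>\<^bsub>R\<^esub>) \<oplus>\<^bsub>R'\<^esub> s)) (\<lambda>m. 0 + lift s m)"
        by (rule R'_add_pclose[OF R'_zero(1) s R'_zero(2) refl])
      thus "N.pclose (lift ((\<lambda>m. \<zero>\<^bsub>R\<^esub>) \<oplus>\<^bsub>R'\<^esub> s)) (lift s)" by simp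
    qed (intro R'_add R'_zero s)+
    obtain r where r: "r \<in> p_power_seqs p R" "N.pclose (lift r) (\<lambda>m. - lift s m)"
      using R'_neg_exists[OF s] by blast
    show "\<exists>y\<in>p_power_seqs p R. y \<oplus>\<^bsub>R'\<^esub> s = (\<lambda>m. \<zero>\<^bsub>R\<^esub>)"
    proof (rule bexI[OF R'_eqI r(1)])
      have "N.pclose (lift (r \<oplus>\<^bsub>R'\<^esub> s)) (\<lambda>m. - lift s m + lift s m)"
        by (rule R'_add_pclose[OF r(1) s r(2) refl])
      thus "N.pclose (lift (r \<oplus>\<^bsub>R'\<^esub> s)) (lift (\<lambda>m. \<zero>\<^bsub>R\<^esub>))"
        by (intro trans2[OF _ R'_zero(2)]) simp
    qed (intro R'_add R'_zero s r)+
  qed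
  show "comm_monoid R'"
    by (rule comm_monoidI) (auto simp: R'_mult R'_one R'_closed R.m_assoc R.m_comm R.m_lcomm fun_eq_iff)
  fix s t u assume "s \<in> carrier R'" "t \<in> carrier R'" "u \<in> carrier R'"
  hence s: "s \<in> p_power_seqs p R" and t: "t \<in> p_power_seqs p R" and u: "u \<in> p_power_seqs p R" by auto
  have "(\<lambda>m. (s \<oplus>\<^bsub>R'\<^esub> t) m \<otimes>\<^bsub>R\<^esub> u m) = (\<lambda>m. s m \<otimes>\<^bsub>R\<^esub> u m) \<oplus>\<^bsub>R'\<^esub> (\<lambda>m. t m \<otimes>\<^bsub>R\<^esub> u m)"
  proof (rule R'_eqI)
    have "N.pclose (lift (\<lambda>m. (s \<oplus>\<^bsub>R'\<^esub> t) m \<otimes>\<^bsub>R\<^esub> u m)) (\<lambda>m. (lift s m + lift t m) * lift u m)"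
      by (rule R'_mult_pclose[OF R'_add(1)[OF s t] u R'_add(2)[OF s t] refl])
    moreover have "N.pclose (lift ((\<lambda>m. s m \<otimes>\<^bsub>R\<^esub> u m) \<oplus>\<^bsub>R'\<^esub> (\<lambda>m. t m \<otimes>\<^bsub>R\<^esub> u m)))
        (\<lambda>m. lift s m * lift u m + lift t m * lift u m)"
      by (rule R'_add_pclose[OF R'_mult(1)[OF s u] R'_mult(1)[OF t u] R'_mult(2)[OF s u] R'_mult(2)[OF t u]])
    ultimately show "N.pclose (lift (\<lambda>m. (s \<oplus>\<^bsub>R'\<^esub> t) m \<otimes>\<^bsub>R\<^esub> u m))
       (lift ((\<lambda>m. s m \<otimes>\<^bsub>R\<^esub> u m) \<oplus>\<^bsub>R'\<^esub> (\<lambda>m. t m \<otimes>\<^bsub>R\<^esub> u m)))"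
      unfolding distrib_right by (rule trans2)
  qed (intro R'_add R'_mult s t u)+
  thus "(s \<oplus>\<^bsub>R'\<^esub> t) \<otimes>\<^bsub>R'\<^esub> u = s \<otimes>\<^bsub>R'\<^esub> u \<oplus>\<^bsub>R'\<^esub> t \<otimes>\<^bsub>R'\<^esub> u" by simp
qed

sublocale R': cring R' by (rule R'_cring)

lemma R'_minus:
  assumes s: "s \<in> p_power_seqs p R" and t: "t \<in> p_power_seqs p R"
  shows "N.pclose (lift (s \<ominus>\<^bsub>R'\<^esub> t)) (\<lambda>m. lift s m - lift t m)"
proof -
  let ?r = "s \<ominus>\<^bsub>R'\<^esub> t"
  have r: "?r \<in> p_power_seqs p R" using R'.minus_closed[of s t] s t by simp
  have "?r \<oplus>\<^bsub>R'\<^esub> t = s"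
    using R'.add.inv_solve_right[of ?r s t] s t r by (simp add: a_minus_def)
  hence "N.pclose (lift s) (\<lambda>m. lift ?r m + lift t m)" using R'_add(2)[OF r t] by simp
  hence "N.pclose (\<lambda>m. lift s m - lift t m) (\<lambda>m. (lift ?r m + lift t m) - lift t m)"
    by (rule N.pclose_diff) (rule N.pclose_refl, simp)
  thus ?thesis using N.pclose_sym by simp
qed

lemma zpoly_eval_R'_pclose:
  assumes "\<And>v. z v \<in> p_power_seqs p R"
  shows "N.pclose (lift (zpoly_eval R' z P)) (\<lambda>m. peval (\<lambda>v. X (z v m)) P)"
proof -
  have z: "z v \<in> carrier R'" for v using assms by simp
  note closed = R'.zpoly_eval_closed[of z, OF z, simplified]
  show ?thesis
  proof (induction P rule: zpoly_induct)
    case zero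
    show ?case unfolding R'.zpoly_eval_0[of z, OF z] using R'_zero by simp
  next
    case one
    show ?case unfolding R'.zpoly_eval_1[of z, OF z] using R'_one by simp
  next
    case (X v)
    show ?case unfolding R'.zpoly_eval_X[of z, OF z] by (rule N.pclose_refl) simp
  next
    case (diff P P')
    show ?case
      unfolding R'.zpoly_eval_diff[of z, OF z] peval_simps
      by (rule N.pclose_trans[OF R'_minus N.pclose_diff]) (use closed diff in auto)
  next
    case (mult P P')
    show ?case
      unfolding R'.zpoly_eval_mult[of z, OF z] peval_simps R'_simps
      by (rule R'_mult_pclose) (use closed mult in auto)
  qed
qed

lemma peval_cong:
  assumes "\<And>v. v \<in> zpoly_vars P \<Longrightarrow> f v = g v"
  shows "peval f P = peval g P"
  unfolding peval_def
  by (rule cring.zpoly_eval_cong[OF cring_type_ring]) (use assms in auto)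

lemma eqv_peval_vars:
  assumes "\<And>v. v \<in> zpoly_vars P \<Longrightarrow> N.eqv (f v) (g v)"
  shows "N.eqv (peval f P) (peval g P)"
proof -
  have "peval f P = peval (\<lambda>v. if v \<in> zpoly_vars P then f v else 0) P"
    "peval g P = peval (\<lambda>v. if v \<in> zpoly_vars P then g v else 0) P"
    by (rule peval_cong; simp)+
  thus ?thesis using assms by (simp only:) (rule N.eqv_peval, simp)
qed

lemma zpoly_eval_R'_limit:
  assumes "\<And>v. v \<in> zpoly_vars P \<Longrightarrow> z v \<in> p_power_seqs p R"
  shows "N.tends (\<lambda>l. peval (\<lambda>v. X (z v (m + l))) P ^ p ^ l) (X (zpoly_eval R' z P m))"
proof -
  define z' where "z' v = (if z v \<in> carrier R' then z v else \<zero>\<^bsub>R'\<^esub>)" for v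
  have z': "z' v \<in> p_power_seqs p R" for v using R'_zero by (simp add: z'_def)
  have eq: "zpoly_eval R' z P = zpoly_eval R' z' P"
    unfolding z'_def by (rule R'.zpoly_eval_restrict) (use assms in simp)
  have peq: "peval (\<lambda>v. X (z v m)) P = peval (\<lambda>v. X (z' v m)) P" for m
    by (rule peval_cong) (use assms in \<open>simp add: z'_def\<close>)
  have closed: "zpoly_eval R' z' P \<in> p_power_seqs p R"
    using R'.zpoly_eval_closed[of z' P] z' by simp
  have close: "N.pclose (lift (zpoly_eval R' z' P)) (\<lambda>m. peval (\<lambda>v. X (z' v m)) P)"
    using z' by (rule zpoly_eval_R'_pclose)
  show ?thesis
    unfolding eq peq
    by (rule N.pseq_limit[OF pseq_lift[OF closed] close N.pclose_pbounded[OF N.pclose_sym[OF close]]])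
      (rule pbounded_lift[OF closed])
qed

subsection \<open>The seminorm on \<open>R'\<close>\<close>

abbreviation ev' :: "(nat \<Rightarrow> 'a) zpoly \<Rightarrow> (nat \<Rightarrow> 'a)" where "ev' \<equiv> cover R'"

sublocale ev': ring_cover R' ev'
  by (rule ring_cover_cover[OF R'_cring])

lemma ev'_seq: "ev' a \<in> p_power_seqs p R"
  using ev'.closed[of a] by simp

definition N' :: "(nat \<Rightarrow> 'a) zpoly \<Rightarrow> real" where "N' a = nu' (ev' a)"

lemma N'_eq: "N' a = N (X (ev' a 0))"
  by (simp add: N'_def R_prime_norm_def N_def ev'_seq)

lemma nu'_eq: "s \<in> p_power_seqs p R \<Longrightarrow> nu' s = N (X (s 0))"
  by (simp add: R_prime_norm_def N_def)

lemma nat_pow_R': "s \<in> p_power_seqs p R \<Longrightarrow> s [^]\<^bsub>R'\<^esub> (n::nat) = (\<lambda>m. s m [^]\<^bsub>R\<^esub> n)"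
  by (induction n) auto

lemma ev'_of_nat_pclose: "N.pclose (lift (ev' (of_nat n))) (\<lambda>m. of_nat n)"
proof (induction n)
  case 0
  show ?case using R'_zero by simp
next
  case (Suc n)
  have "ev' (of_nat (Suc n)) = ev' 1 \<oplus>\<^bsub>R'\<^esub> ev' (of_nat n)" by (simp del: ev'.of_nat)
  moreover have "N.pclose (lift (ev' 1 \<oplus>\<^bsub>R'\<^esub> ev' (of_nat n))) (\<lambda>m. 1 + of_nat n)"
    by (rule R'_add_pclose[OF ev'_seq ev'_seq _ Suc]) (use R'_one in simp)
  ultimately show ?case by simp
qed

text \<open>
  The constant sequence with value \<open>p\<close> is close to zero, as \<open>|p| \<le> p\<^sup>-\<^sup>1\<close>.
\<close>

lemma R'_char_p: "ev' (of_nat p) = \<zero>\<^bsub>R'\<^esub>"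
  unfolding R'_simps
proof (rule R'_eqI[OF ev'_seq R'_zero(1)])
  have "N.pclose (\<lambda>m. of_nat p) (\<lambda>m. 0)"
  proof (rule N.pcloseI[of _ _ 1])
    fix m
    have "N (of_nat p) \<le> 1 / p"
      using N.N_p[of 1] N.N_1 by (simp add: divide_right_mono)
    hence "p * N (of_nat p - 0) \<le> 1" using p_gt by (simp add: le_divide_eq mult.commute)
    thus "(p * N (of_nat p - 0)) ^ p ^ m \<le> 1" by (intro power_le_one) (auto simp: N_nonneg)
  qed
  from N.pclose_trans[OF ev'_of_nat_pclose this]
  show "N.pclose (lift (ev' (of_nat p))) (lift (\<lambda>m. \<zero>\<^bsub>R\<^esub>))"
    by (rule N.pclose_trans) (rule N.pclose_sym[OF R'_zero(2)])
qed

lemma N'_zero_iff: "N' a = 0 \<longleftrightarrow> ev' a = \<zero>\<^bsub>R'\<^esub>"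
proof
  assume "N' a = 0"
  hence "N (X (ev' a m)) ^ p ^ m = 0" for m
    using N.pseq_N[OF pseq_lift[OF ev'_seq], of a m] by (simp add: N'_eq)
  hence "N (X (ev' a m)) = 0" for m by (simp only: power_eq_0_iff)
  hence "ev' a m = \<zero>\<^bsub>R\<^esub>" for m by (simp add: N_eq_0_iff ev'_seq)
  thus "ev' a = \<zero>\<^bsub>R'\<^esub>" by (simp add: fun_eq_iff)
next
  assume "ev' a = \<zero>\<^bsub>R'\<^esub>"
  thus "N' a = 0" by (simp add: N'_eq N_eq_0_iff)
qed

sublocale N': seminorm N'
proof
  fix x y :: "(nat \<Rightarrow> 'a) zpoly"
  show "N' x \<ge> 0" by (simp add: N'_eq N_nonneg)
  show "N' 0 = 0" by (simp add: N'_zero_iff)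
  show "N' (x - y) \<le> max (N' x) (N' y)"
  proof -
    have "N.tends (\<lambda>l. (lift (ev' x) (0 + l) - lift (ev' y) (0 + l)) ^ p ^ l) (lift (ev' (x - y)) 0)"
      by (rule N.pseq_limit[OF pseq_lift[OF ev'_seq]])
        (use R'_minus[OF ev'_seq ev'_seq] N.pbounded_diff pbounded_lift[OF ev'_seq] in auto)
    hence "N (lift (ev' (x - y)) 0) \<le> max (N' x) (N' y)"
    proof (rule N.tends_N_le, intro always_eventually allI)
      fix l
      have "N ((lift (ev' x) l - lift (ev' y) l) ^ p ^ l) = N (lift (ev' x) l - lift (ev' y) l) ^ p ^ l"
        using N.p_power_pos by (rule N.N_power)
      also have "\<dots> \<le> max (N' x) (N' y)"
        by (rule N.max_power_le[OF _ N.N_diff])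
          (use N.pseq_N[OF pseq_lift[OF ev'_seq]] in \<open>auto simp: N'_eq N_nonneg\<close>)
      finally show "N ((lift (ev' x) (0 + l) - lift (ev' y) (0 + l)) ^ p ^ l) \<le> max (N' x) (N' y)" by simp
    qed
    thus ?thesis by (simp add: N'_eq del: ev'.diff)
  qed
  show "N' (x * y) \<le> N' x * N' y"
  proof -
    have "N' (x * y) = N (X (ev' x 0) * X (ev' y 0))"
      unfolding N'_eq by (rule N_cong) (simp add: ev'_seq R'_closed)
    thus ?thesis unfolding N'_eq using N.N_mult by simp
  qed
  show "N' (x ^ n) = N' x ^ n" if "n > 0" for n
  proof -
    have "N' (x ^ n) = N (X (ev' x 0) ^ n)"
      unfolding N'_eq by (rule N_cong) (simp add: ev'_seq nat_pow_R' R'_closed)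
    thus ?thesis unfolding N'_eq using N.N_power[OF that] by simp
  qed
qed

lemma N'_p: "N' (of_nat p) = 0"
  using R'_char_p N'_zero_iff by blast

lemma N'_X: "s \<in> p_power_seqs p R \<Longrightarrow> N' (X s) = N (X (s 0))"
  using cover_X[OF R'_cring, of s] by (simp add: N'_eq)

end

lemma zpoly_eval_cover_X:
  assumes "cring S" "\<And>v. v \<in> zpoly_vars P \<Longrightarrow> f v \<in> carrier S"
  shows "zpoly_eval S f P = cover S (peval (\<lambda>v. X (f v)) P)"
proof -
  interpret ring_cover S "cover S" by (rule ring_cover_cover) fact
  have "zpoly_eval S f P = zpoly_eval S (\<lambda>v. cover S (X (f v))) P"
    by (rule R.zpoly_eval_cong) (use assms in \<open>auto simp: cover_X\<close>)
  thus ?thesis by (simp add: zpoly_eval_cover)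
qed

subsection \<open>The ring \<open>A'\<close>\<close>

context complete_p_normal
begin

abbreviation A' :: "(nat \<Rightarrow> 'a set) ring" where "A' \<equiv> A_prime p A"
abbreviation red :: "'a \<Rightarrow> 'a set" where "red \<equiv> red_p p A"
abbreviation j :: "(nat \<Rightarrow> 'a set) \<Rightarrow> (nat \<Rightarrow> 'a)" where "j \<equiv> A_prime_to_R_prime p A R"

lemma ideal_p: "ideal (PIdl\<^bsub>A\<^esub> (p_elem p A)) A"
proof -
  have "ev (of_nat p) \<in> carrier A" using mem_of_nat unfolding mem_def .
  thus ?thesis using A.cgenideal_ideal by (simp only: ev_p A_p_elem)
qed

lemma red_hom: "red \<in> ring_hom A (mod_p p A)"
  using ideal.rcos_ring_hom[OF ideal_p] unfolding mod_p_def red_p_def[abs_def] .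

lemma mod_p_cring: "cring (mod_p p A)"
  unfolding mod_p_def using ideal.quotient_is_cring[OF ideal_p] cring_A by blast

lemma red_surj: "c \<in> carrier (mod_p p A) \<Longrightarrow> \<exists>a\<in>carrier A. red a = c"
  by (auto simp: mod_p_def red_p_def FactRing_def A_RCOSETS_def RCOSETS_def a_r_coset_def)

lemma red_eq_iff:
  assumes "mem a" "mem b"
  shows "red (ev a) = red (ev b) \<longleftrightarrow> memp 1 (a - b)"
proof -
  interpret I: ideal "PIdl\<^bsub>A\<^esub> (p_elem p A)" A by (rule ideal_p)
  have "red (ev a) = red (ev b) \<longleftrightarrow> ev a \<ominus>\<^bsub>A\<^esub> ev b \<in> PIdl\<^bsub>A\<^esub> (p_elem p A)"
    unfolding red_p_def using A.quotient_eq_iff_same_a_r_cos[OF ideal_p] assms by (simp add: mem_def)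
  also have "ev a \<ominus>\<^bsub>A\<^esub> ev b = ev (a - b)" using assms by (simp add: mem_def A_minus)
  also have "ev (a - b) \<in> PIdl\<^bsub>A\<^esub> (p_elem p A) \<longleftrightarrow> memp 1 (a - b)"
  proof -
    have "p_elem p A \<in> carrier A" using mem_of_nat[of p] by (simp add: mem_def ev_p A_p_elem del: ev.of_nat)
    thus ?thesis using PIdl_iff[OF mem_diff[OF assms], of 1] by (simp del: ev.diff)
  qed
  finally show ?thesis .
qed

text \<open>The elements of \<open>R'\<close> with first, and hence every, term in \<open>A\<close>.\<close>

definition SA :: "(nat \<Rightarrow> 'a) set" where
  "SA = {s \<in> p_power_seqs p R. s 0 \<in> carrier A}"

lemma SA_mem: "s \<in> SA \<Longrightarrow> mem (lift s m)"
proof -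
  assume s: "s \<in> SA"
  hence s': "s \<in> p_power_seqs p R" by (simp add: SA_def)
  have "ev (lift s m ^ p ^ m) = ev (lift s 0)"
    using N.pseq_power[OF pseq_lift[OF s'], of 0 m] by (simp only: eqv_iff add_0)
  hence "mem (lift s m ^ p ^ m)" using s s' mem_cong[of _ "lift s 0"] by (simp add: mem_def SA_def)
  thus ?thesis using mem_power_cancel N.p_power_pos by blast
qed

lemma SA_memI: "s \<in> p_power_seqs p R \<Longrightarrow> mem (lift s 0) \<Longrightarrow> s \<in> SA"
  by (simp add: SA_def mem_def)

text \<open>
  Sequences in \<open>A\<close> are close if they are congruent modulo \<open>p\<close>. So any lifts to \<open>A\<close> of the terms of an
  element of \<open>A'\<close> form a sequence that is close to a sequence of \<open>p\<close>-power roots, which is the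
  corresponding element of \<open>R'\<close>.
\<close>

lemma SA_limit:
  assumes a: "\<And>m. mem (a m)" and step: "\<And>m. memp 1 (a (Suc m) ^ p - a m)"
  obtains s where "s \<in> SA" "\<And>m. memp 1 (lift s m - a m)"
    "\<And>m. N.tends (\<lambda>l. a (m + l) ^ p ^ l) (lift s m)"
proof -
  have close: "N.pclose (\<lambda>m. a (Suc m) ^ p) a"
  proof (rule N.pcloseI[of _ _ 1])
    fix m
    have "p * N (a (Suc m) ^ p - a m) \<le> 1"
      using N_memp[OF step[of m]] p_gt by (simp add: le_divide_eq mult.commute)
    thus "(p * N (a (Suc m) ^ p - a m)) ^ p ^ m \<le> 1"
      by (intro power_le_one) (auto simp: N_nonneg)
  qed
  have bdd: "N.pbounded a"
    by (rule N.pboundedI[of _ 1]) (use mem_N_le[OF a] N_nonneg in \<open>auto intro: power_le_one\<close>)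
  obtain s where s: "s \<in> p_power_seqs p R" "N.pclose (lift s) a"
    using R'_exists[OF bdd close] by blast
  have lim: "N.tends (\<lambda>l. a (m + l) ^ p ^ l) (lift s m)" for m
    by (rule N.pseq_limit[OF pseq_lift[OF s(1)] s(2) bdd])
  have steps: "memp 1 (a (m + l) ^ p ^ l - a m)" for m l
  proof (induction l)
    case (Suc l)
    have "memp (Suc l) ((a (Suc (m + l)) ^ p) ^ p ^ l - a (m + l) ^ p ^ l)"
      by (rule memp.Q_power_diff[OF step]) (simp add: a)
    hence "memp 1 ((a (Suc (m + l)) ^ p) ^ p ^ l - a (m + l) ^ p ^ l)"
      by (rule memp.Q_mono) simp
    from memp.Q_add[OF this Suc] show ?case by (simp add: power_mult)
  qed (simp add: memp.Q_0)
  have cong: "memp 1 (lift s m - a m)" for m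
  proof -
    have "eventually (\<lambda>l. N (a (m + l) ^ p ^ l - lift s m) < 1 / real p ^ 1) sequentially"
      by (rule N.tendsD[OF lim]) (use p_gt in simp)
    then obtain l where "N (lift s m - a (m + l) ^ p ^ l) < 1 / real p ^ 1"
      using N.N_commute by (auto simp: eventually_sequentially)
    from memp.Q_add[OF N_less_memp[OF this] steps[of m l]] show ?thesis by simp
  qed
  have "mem (lift s 0)"
    using mem_add[OF memp.Q_mono[OF cong[of 0], of 0, simplified] a[of 0]] by simp
  with s have "s \<in> SA" by (intro SA_memI)
  from that[OF this cong lim] show ?thesis .
qed

lemma SA_unique:
  assumes "s \<in> SA" "t \<in> SA" "\<And>m. memp 1 (lift s m - lift t m)"
  shows "s = t"
proof (rule R'_eqI)
  show "N.pclose (lift s) (lift t)"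
  proof (rule N.pcloseI[of _ _ 1])
    fix m
    have "p * N (lift s m - lift t m) \<le> 1"
      using N_memp[OF assms(3)[of m]] p_gt by (simp add: le_divide_eq mult.commute)
    thus "(p * N (lift s m - lift t m)) ^ p ^ m \<le> 1"
      by (intro power_le_one) (auto simp: N_nonneg)
  qed
qed (use assms in \<open>auto simp: SA_def\<close>)

lemma SA_add:
  assumes s: "s \<in> SA" and t: "t \<in> SA"
  shows "s \<oplus>\<^bsub>R'\<^esub> t \<in> SA" "memp 1 (lift (s \<oplus>\<^bsub>R'\<^esub> t) m - (lift s m + lift t m))"
proof -
  have st: "s \<in> p_power_seqs p R" "t \<in> p_power_seqs p R" using s t by (auto simp: SA_def)
  let ?a = "\<lambda>m. lift s m + lift t m"
  have mem: "mem (?a m)" for m by (intro mem_add SA_mem s t)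
  have step: "memp 1 (?a (Suc m) ^ p - ?a m)" for m
  proof -
    have "memp 1 (?a (Suc m) ^ p - (lift s (Suc m) ^ p + lift t (Suc m) ^ p))"
      by (rule memp.Q_prime_power_add) (simp_all add: SA_mem s t)
    moreover have "ev (?a (Suc m) ^ p - (lift s (Suc m) ^ p + lift t (Suc m) ^ p)) = ev (?a (Suc m) ^ p - ?a m)"
      using st by (simp add: R'_power)
    ultimately show ?thesis using memp_cong by blast
  qed
  obtain r where r: "r \<in> SA" "\<And>m. memp 1 (lift r m - ?a m)"
    "\<And>m. N.tends (\<lambda>l. ?a (m + l) ^ p ^ l) (lift r m)"
    using SA_limit[of ?a, OF mem step] by blast
  have "s \<oplus>\<^bsub>R'\<^esub> t = r"
  proof
    fix m
    have "seq_lim R nu (\<lambda>l. (s (m + l) \<oplus>\<^bsub>R\<^esub> t (m + l)) [^]\<^bsub>R\<^esub> (p ^ l)) = r m"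
      by (rule seq_lim_eq[OF r(3)]) (use r(1) st in \<open>simp_all add: SA_def R'_closed\<close>)
    thus "(s \<oplus>\<^bsub>R'\<^esub> t) m = r m" by (simp add: R_prime_def)
  qed
  thus "s \<oplus>\<^bsub>R'\<^esub> t \<in> SA" "memp 1 (lift (s \<oplus>\<^bsub>R'\<^esub> t) m - ?a m)" using r by auto
qed


abbreviation SA_ring :: "(nat \<Rightarrow> 'a) ring" where "SA_ring \<equiv> R'\<lparr>carrier := SA\<rparr>"

lemma SA_sub: "SA \<subseteq> p_power_seqs p R"
  by (auto simp: SA_def)

lemma SA_mult: "s \<in> SA \<Longrightarrow> t \<in> SA \<Longrightarrow> (\<lambda>m. s m \<otimes>\<^bsub>R\<^esub> t m) \<in> SA"
  using A.m_closed[of "s 0" "t 0"] R'_mult(1)[of s t] by (simp add: SA_def A_ops)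

lemma SA_one: "(\<lambda>m. \<one>\<^bsub>R\<^esub>) \<in> SA"
  using A.one_closed R'_one by (simp add: SA_def A_ops)

lemma SA_zero: "(\<lambda>m. \<zero>\<^bsub>R\<^esub>) \<in> SA"
  using A.zero_closed R'_zero by (simp add: SA_def A_ops)

lemma SA_neg:
  assumes s: "s \<in> SA"
  shows "\<ominus>\<^bsub>R'\<^esub> s \<in> SA"
proof -
  have s': "s \<in> p_power_seqs p R" using s SA_sub by auto
  have step: "memp 1 ((- lift s (Suc m)) ^ p - (- lift s m))" for m
  proof -
    have "memp 1 ((lift s (Suc m) + - lift s (Suc m)) ^ p - (lift s (Suc m) ^ p + (- lift s (Suc m)) ^ p))"
      by (rule memp.Q_prime_power_add) (use SA_mem[OF s] mem_uminus in auto)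
    hence "memp 1 (- (0 - (lift s (Suc m) ^ p + (- lift s (Suc m)) ^ p)))"
      using p_gt by (intro memp.Q_uminus) (simp add: zero_power)
    moreover have "ev (- (0 - (lift s (Suc m) ^ p + (- lift s (Suc m)) ^ p))) = ev ((- lift s (Suc m)) ^ p - (- lift s m))"
    proof -
      have "ev (lift s (Suc m) ^ p) = ev (lift s m)" using s' by (simp add: R'_power)
      thus ?thesis using R.a_comm by (simp add: a_minus_def)
    qed
    ultimately show ?thesis using memp_cong by blast
  qed
  obtain r where r: "r \<in> SA" "\<And>m. memp 1 (lift r m - (- lift s m))"
    by (rule SA_limit[of "\<lambda>m. - lift s m", OF mem_uminus[OF SA_mem[OF s]] step]) blast
  have "r \<oplus>\<^bsub>R'\<^esub> s = (\<lambda>m. \<zero>\<^bsub>R\<^esub>)"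
  proof (rule SA_unique[OF SA_add(1)[OF r(1) s] SA_zero])
    fix m
    have "memp 1 ((lift (r \<oplus>\<^bsub>R'\<^esub> s) m - (lift r m + lift s m)) + (lift r m - (- lift s m)))"
      by (intro memp.Q_add SA_add r s)
    moreover have "ev ((lift (r \<oplus>\<^bsub>R'\<^esub> s) m - (lift r m + lift s m)) + (lift r m - (- lift s m))) =
        ev (lift (r \<oplus>\<^bsub>R'\<^esub> s) m - X \<zero>\<^bsub>R\<^esub>)"
    proof -
      have "(lift (r \<oplus>\<^bsub>R'\<^esub> s) m - (lift r m + lift s m)) + (lift r m - (- lift s m)) = lift (r \<oplus>\<^bsub>R'\<^esub> s) m"
        by simp
      thus ?thesis by (simp only: ev.diff ev_X[OF R.zero_closed]) (simp add: a_minus_def)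
    qed
    ultimately show "memp 1 (lift (r \<oplus>\<^bsub>R'\<^esub> s) m - X \<zero>\<^bsub>R\<^esub>)" using memp_cong by blast
  qed
  hence "\<ominus>\<^bsub>R'\<^esub> s = r"
    using R'.minus_equality[of r s] r(1) s SA_sub by auto
  thus ?thesis using r by simp
qed

lemma SA_cring: "cring SA_ring"
proof -
  have "subring SA R'"
    by (rule R'.subringI) (use SA_sub SA_one SA_neg SA_mult SA_add in auto)
  hence "subcring SA R'" by (rule R'.subcringI')
  thus ?thesis using R'.subcring_iff[of SA] SA_sub by simp
qed

definition rdc :: "(nat \<Rightarrow> 'a) \<Rightarrow> (nat \<Rightarrow> 'a set)" where
  "rdc s = (\<lambda>m. red (s m))"

lemma SA_A: "s \<in> SA \<Longrightarrow> s m \<in> carrier A"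
  using SA_mem[of s m] SA_sub by (auto simp: mem_def)

lemma red_eq_iff': "a \<in> carrier A \<Longrightarrow> b \<in> carrier A \<Longrightarrow> red a = red b \<longleftrightarrow> memp 1 (X a - X b)"
  using red_eq_iff[of "X a" "X b"] A_sub by (simp add: mem_def subset_iff)

lemma red_pow:
  assumes "a \<in> carrier A"
  shows "red (a [^]\<^bsub>A\<^esub> (n::nat)) = red a [^]\<^bsub>mod_p p A\<^esub> n"
proof -
  interpret S: cring "mod_p p A" by (rule mod_p_cring)
  interpret red: ring_hom_cring A "mod_p p A" red
    by unfold_locales (rule red_hom)
  show ?thesis using assms by (induction n) auto
qed

lemma rdc_iso: "rdc \<in> ring_iso SA_ring A'"
proof -
  interpret S: cring "mod_p p A" by (rule mod_p_cring)
  interpret red: ring_hom_cring A "mod_p p A" red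
    by unfold_locales (rule red_hom)
  have closed: "rdc s \<in> carrier A'" if s: "s \<in> SA" for s
  proof -
    have "red (s (Suc m)) [^]\<^bsub>mod_p p A\<^esub> p = red (s m)" for m
      using red_pow[OF SA_A[OF s], of "Suc m" p] R'_power[of s m] s SA_sub by (auto simp: A_pow)
    thus ?thesis using SA_A[OF s] by (simp add: A_prime_def p_power_seqs_def rdc_def)
  qed
  have add: "rdc (s \<oplus>\<^bsub>R'\<^esub> t) = rdc s \<oplus>\<^bsub>A'\<^esub> rdc t" if s: "s \<in> SA" and t: "t \<in> SA" for s t
  proof
    fix m
    have st: "s m \<in> carrier A" "t m \<in> carrier A" "(s \<oplus>\<^bsub>R'\<^esub> t) m \<in> carrier A"
      using SA_A s t SA_add(1)[OF s t] by auto
    have "memp 1 (lift (s \<oplus>\<^bsub>R'\<^esub> t) m - X (s m \<oplus>\<^bsub>A\<^esub> t m)) \<longleftrightarrow>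
        memp 1 (lift (s \<oplus>\<^bsub>R'\<^esub> t) m - (lift s m + lift t m))"
      by (rule memp_cong) (use st A_sub in \<open>simp add: A_ops subset_iff\<close>)
    hence "red ((s \<oplus>\<^bsub>R'\<^esub> t) m) = red (s m \<oplus>\<^bsub>A\<^esub> t m)"
      using st SA_add(2)[OF s t] by (subst red_eq_iff') auto
    thus "rdc (s \<oplus>\<^bsub>R'\<^esub> t) m = (rdc s \<oplus>\<^bsub>A'\<^esub> rdc t) m"
      using st by (simp add: rdc_def A_prime_def)
  qed
  have inj: "inj_on rdc SA"
  proof (rule inj_onI)
    fix s t assume st: "s \<in> SA" "t \<in> SA" "rdc s = rdc t"
    have "memp 1 (lift s m - lift t m)" for m
      using st red_eq_iff'[of "s m" "t m"] SA_A by (auto simp: rdc_def fun_eq_iff)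
    with st show "s = t" by (intro SA_unique)
  qed
  have surj: "\<exists>s\<in>SA. rdc s = y" if y: "y \<in> carrier A'" for y
  proof -
    have "\<exists>a\<in>carrier A. red a = y m" for m
      by (rule red_surj) (use y in \<open>simp add: A_prime_def p_power_seqs_def\<close>)
    then obtain a where a: "\<And>m. a m \<in> carrier A" "\<And>m. red (a m) = y m" by metis
    have aR: "a m \<in> carrier R" for m using a A_sub by auto
    have mem: "mem (X (a m))" for m using a aR by (simp add: mem_def)
    have step: "memp 1 (X (a (Suc m)) ^ p - X (a m))" for m
    proof -
      have "red (ev (X (a (Suc m)) ^ p)) = red (ev (X (a m)))"
        using red_pow[OF a(1), of "Suc m" p] a y aR by (simp add: A_pow A_prime_def p_power_seqs_def)
      thus ?thesis using red_eq_iff mem mem_power by blast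
    qed
    obtain s where s: "s \<in> SA" "\<And>m. memp 1 (lift s m - X (a m))"
      by (rule SA_limit[of "\<lambda>m. X (a m)", OF mem step]) blast
    have "rdc s = y"
      using s a SA_A[OF s(1)] by (simp add: rdc_def fun_eq_iff red_eq_iff' flip: a(2))
    thus ?thesis using s by blast
  qed
  show ?thesis
  proof (rule ring_iso_memI)
    show "bij_betw rdc (carrier SA_ring) (carrier A')"
      using inj closed surj by (auto simp: bij_betw_def)
  qed (use closed add SA_A in \<open>auto simp: rdc_def A_prime_def A_ops[symmetric] fun_eq_iff\<close>)
qed

lemma A'_cring: "cring A'"
proof -
  have "cring (A'\<lparr>zero := rdc \<zero>\<^bsub>SA_ring\<^esub>\<rparr>)"
    by (rule cring.ring_iso_imp_img_cring[OF SA_cring rdc_iso])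
  moreover have "rdc \<zero>\<^bsub>SA_ring\<^esub> = zero A'"
  proof -
    interpret S: cring "mod_p p A" by (rule mod_p_cring)
    interpret red: ring_hom_cring A "mod_p p A" red
      by unfold_locales (rule red_hom)
    show ?thesis using red.hom_zero by (simp add: rdc_def A_prime_def A_ops)
  qed
  ultimately show ?thesis by simp
qed

lemma j_rdc: "s \<in> SA \<Longrightarrow> j (rdc s) = s"
  unfolding A_prime_to_R_prime_def
proof (rule the_equality)
  assume s: "s \<in> SA"
  show "s \<in> p_power_seqs p R \<and> s 0 \<in> carrier A \<and> (\<forall>m. red (s m) = rdc s m)"
    using s by (simp add: SA_def rdc_def)
  fix t assume "t \<in> p_power_seqs p R \<and> t 0 \<in> carrier A \<and> (\<forall>m. red (t m) = rdc s m)"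
  hence "t \<in> SA" "rdc t = rdc s" by (auto simp: SA_def rdc_def)
  thus "t = s"
    using rdc_iso s by (auto simp: ring_iso_def bij_betw_def inj_on_def)
qed

lemma A'_cases:
  assumes "y \<in> carrier A'"
  obtains s where "s \<in> SA" "y = rdc s" "j y = s"
proof -
  have "y \<in> rdc ` SA" using rdc_iso assms by (simp add: ring_iso_def bij_betw_def)
  thus ?thesis using that j_rdc by auto
qed

lemma j_closed: "y \<in> carrier A' \<Longrightarrow> j y \<in> SA"
  by (erule A'_cases) simp

lemma rdc_j: "y \<in> carrier A' \<Longrightarrow> rdc (j y) = y"
  by (erule A'_cases) simp

lemma j_hom: "j \<in> ring_hom A' R'"
proof -
  note rdc = ring_iso_memE[OF rdc_iso]
  show ?thesis
  proof (rule ring_hom_memI)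
    fix x y assume x: "x \<in> carrier A'" and y: "y \<in> carrier A'"
    obtain s where s: "s \<in> SA" "x = rdc s" "j x = s" by (rule A'_cases[OF x])
    obtain t where t: "t \<in> SA" "y = rdc t" "j y = t" by (rule A'_cases[OF y])
    show "j x \<in> carrier R'" using s SA_sub by auto
    have "x \<otimes>\<^bsub>A'\<^esub> y = rdc (s \<otimes>\<^bsub>R'\<^esub> t)" using rdc(2)[of s t] s t by simp
    thus "j (x \<otimes>\<^bsub>A'\<^esub> y) = j x \<otimes>\<^bsub>R'\<^esub> j y" using s t j_rdc SA_mult by simp
    have "x \<oplus>\<^bsub>A'\<^esub> y = rdc (s \<oplus>\<^bsub>R'\<^esub> t)" using rdc(3)[of s t] s t by simp
    thus "j (x \<oplus>\<^bsub>A'\<^esub> y) = j x \<oplus>\<^bsub>R'\<^esub> j y" using s t j_rdc SA_add by simp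
  next
    have "\<one>\<^bsub>A'\<^esub> = rdc (\<lambda>m. \<one>\<^bsub>R\<^esub>)" using rdc(4) by simp
    thus "j \<one>\<^bsub>A'\<^esub> = \<one>\<^bsub>R'\<^esub>" using j_rdc SA_one by simp
  qed
qed

end

section \<open>The inverse limits of Witt vectors\<close>

text \<open>
  If the indices \<open>i\<close> and \<open>j\<close> add up to \<open>k\<close>, then at least one of them is not less than \<open>k div 2\<close>. So one of
  the factors \<open>G\<^sub>i / c\<^sup>i\<close> and \<open>G'\<^sub>j / c\<^sup>j\<close> tends to zero with increasing \<open>k\<close>, and the other one is bounded.
\<close>

lemma product_envelope:
  assumes c: "c > 1" and G: "envelope c G" and G': "envelope c G'"
  obtains T where "envelope c T" "\<And>i j k. i + j \<le> k \<Longrightarrow> G i * G' j \<le> T k"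
proof -
  define H where "H k = Max ((\<lambda>i. G i * G' (k - i)) ` {..k})" for k
  define g g' where "g k = G k / c ^ k" and "g' k = G' k / c ^ k" for k
  note nonneg = envelope_nonneg[OF G] envelope_nonneg[OF G']
  have g0: "g k \<ge> 0" "g' k \<ge> 0" for k using nonneg c by (auto simp: g_def g'_def)
  have dec: "g l \<le> g k" "g' l \<le> g' k" if "k \<le> l" for k l
  proof -
    have "G l \<le> c ^ (l - k) * G k" "G' l \<le> c ^ (l - k) * G' k"
      using envelope_add_le[OF G, of k "l - k"] envelope_add_le[OF G', of k "l - k"] c that by auto
    moreover have "c ^ l = c ^ (l - k) * c ^ k" using that by (simp flip: power_add)
    ultimately show "g l \<le> g k" "g' l \<le> g' k" using c by (simp_all add: g_def g'_def divide_le_eq mult.commute)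
  qed
  have H_ge: "G i * G' (k - i) \<le> H k" if "i \<le> k" for i k
    unfolding H_def by (rule Max_ge) (use that in auto)
  have H_le: "H k \<le> B" if "\<And>i. i \<le> k \<Longrightarrow> G i * G' (k - i) \<le> B" for k B
    unfolding H_def by (rule Max.boundedI) (use that in auto)
  have H0: "H k \<ge> 0" for k using order_trans[OF _ H_ge[of 0 k]] nonneg by simp
  have mono: "H k \<le> H (Suc k)" for k
  proof (rule H_le)
    fix i assume "i \<le> k"
    have "G i * G' (k - i) \<le> G i * G' (Suc k - i)"
      using nonneg envelope_incr[OF G', of "k - i" "Suc k - i"] by (intro mult_left_mono) auto
    also have "\<dots> \<le> H (Suc k)" using \<open>i \<le> k\<close> by (intro H_ge) auto
    finally show "G i * G' (k - i) \<le> H (Suc k)" .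
  qed
  have bound: "H k / c ^ k \<le> g (k div 2) * g' 0 + g 0 * g' (k div 2)" for k
  proof -
    have "H k \<le> c ^ k * (g (k div 2) * g' 0 + g 0 * g' (k div 2))"
    proof (rule H_le)
      fix i assume i: "i \<le> k"
      have "c ^ k = c ^ i * c ^ (k - i)" using i by (simp flip: power_add)
      hence "G i * G' (k - i) = c ^ k * (g i * g' (k - i))" using c by (simp add: g_def g'_def)
      also have "g i * g' (k - i) \<le> g (k div 2) * g' 0 + g 0 * g' (k div 2)"
      proof (cases "k div 2 \<le> i")
        case True
        hence "g i * g' (k - i) \<le> g (k div 2) * g' 0" using g0 dec by (intro mult_mono) auto
        thus ?thesis using g0 by (simp add: add_increasing2)
      next
        case False
        hence "k div 2 \<le> k - i" by simp
        hence "g i * g' (k - i) \<le> g 0 * g' (k div 2)" using g0 dec by (intro mult_mono) auto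
        thus ?thesis using g0 by (simp add: add_increasing)
      qed
      finally show "G i * G' (k - i) \<le> c ^ k * (g (k div 2) * g' 0 + g 0 * g' (k div 2))"
        using c by (simp add: mult_left_mono)
    qed
    thus ?thesis using c by (simp add: divide_le_eq mult.commute)
  qed
  have "g \<longlonglongrightarrow> 0" "g' \<longlonglongrightarrow> 0" using G G' by (simp_all add: envelope_def g_def[abs_def] g'_def[abs_def])
  hence "(\<lambda>k. g (k div 2) * g' 0 + g 0 * g' (k div 2)) \<longlonglongrightarrow> 0 * g' 0 + g 0 * 0"
    by (intro tendsto_intros filterlim_compose[OF _ filterlim_at_top_div_const_nat]) auto
  hence lim: "(\<lambda>k. H k / c ^ k) \<longlonglongrightarrow> 0"
    using bound H0 c
    by (intro tendsto_sandwich[of "\<lambda>_. 0" "\<lambda>k. H k / c ^ k" sequentially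
        "\<lambda>k. g (k div 2) * g' 0 + g 0 * g' (k div 2)" 0]) (auto intro!: always_eventually)
  show ?thesis
  proof (rule envelope_exists[OF c H0 mono lim], rule that)
    fix T and i j k :: nat assume T: "envelope c T" "\<And>n. H n \<le> T n"
    show "envelope c T" by fact
    assume ij: "i + j \<le> k"
    have "G i * G' j \<le> G i * G' (k - i)"
      using ij nonneg envelope_incr[OF G', of j "k - i"] by (intro mult_left_mono) auto
    also have "\<dots> \<le> T k" using order_trans[OF H_ge T(2), of i k] ij by simp
    finally show "G i * G' j \<le> T k" .
  qed
qed

context complete_p_normal
begin

subsection \<open>Heights\<close>

text \<open>
  The growth condition bounds the quotient of the height by \<open>p\<^sup>b\<^sup>n\<close>.
\<close>

definition height :: "(nat \<Rightarrow> nat \<Rightarrow> 'a zpoly) \<Rightarrow> nat \<Rightarrow> real" where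
  "height y n = witt_norm p N n (y n) ^ p ^ n"

lemma witt_norm_obtain:
  obtains k where "k \<le> n" "witt_norm p \<mu> n f = root (p ^ k) (\<mu> (f k))"
proof -
  have "witt_norm p \<mu> n f = Max ((\<lambda>k. root (p ^ k) (\<mu> (f k))) ` {..n})"
    unfolding witt_norm_def by (rule cSup_eq_Max) auto
  also have "\<dots> \<in> (\<lambda>k. root (p ^ k) (\<mu> (f k))) ` {..n}" by (rule Max_in) auto
  finally show ?thesis using that by blast
qed

lemma witt_norm_ge: "k \<le> n \<Longrightarrow> root (p ^ k) (\<mu> (f k)) \<le> witt_norm p \<mu> n f"
  unfolding witt_norm_def by (rule cSUP_upper) auto

lemma root_power_power:
  assumes "k \<le> n" "0 \<le> a"
  shows "root (p ^ k) a ^ p ^ n = a ^ p ^ (n - k)"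
proof -
  have "root (p ^ k) a ^ p ^ n = (root (p ^ k) a ^ p ^ k) ^ p ^ (n - k)"
    using assms by (simp flip: power_mult power_add)
  thus ?thesis using real_root_pow_pos2[OF N.p_power_pos assms(2)] by simp
qed

lemma root_N_nonneg: "0 \<le> root m (N a)"
  by (rule real_root_ge_zero[OF N_nonneg])

lemma height_ge: "k \<le> n \<Longrightarrow> N (y n k) ^ p ^ (n - k) \<le> height y n"
  unfolding height_def
  using power_mono[OF witt_norm_ge[of k n N "y n"] root_N_nonneg, of "p ^ n"]
  by (simp add: root_power_power N_nonneg)

lemma height_le:
  assumes "\<And>k. k \<le> n \<Longrightarrow> N (y n k) ^ p ^ (n - k) \<le> C"
  shows "height y n \<le> C"
proof -
  obtain k where "k \<le> n" "witt_norm p N n (y n) = root (p ^ k) (N (y n k))"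
    by (rule witt_norm_obtain)
  thus ?thesis using assms[of k] by (simp add: height_def root_power_power N_nonneg)
qed

lemma height_nonneg: "height y n \<ge> 0"
  using order_trans[OF _ height_ge[of 0 n y]] N_nonneg by simp

lemma height_bound:
  assumes "k \<le> n"
  shows "N (y n k) \<le> witt_norm p N n (y n) ^ p ^ k" "0 \<le> witt_norm p N n (y n)"
proof -
  have "0 \<le> root (p ^ 0) (N (y n 0))" by (simp add: N_nonneg)
  also have "\<dots> \<le> witt_norm p N n (y n)" by (rule witt_norm_ge) simp
  finally show "0 \<le> witt_norm p N n (y n)" .
  have "root (p ^ k) (N (y n k)) ^ p ^ k \<le> witt_norm p N n (y n) ^ p ^ k"
    by (intro power_mono witt_norm_ge assms root_N_nonneg)
  thus "N (y n k) \<le> witt_norm p N n (y n) ^ p ^ k"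
    using real_root_pow_pos2[OF N.p_power_pos N_nonneg] by simp
qed

lemma height_mono_yfam:
  assumes "N.yfam y"
  shows "height y n \<le> height y (Suc n)"
proof (rule height_le)
  fix k assume k: "k \<le> n"
  have "N (y n k) = N (y (Suc n) k) ^ p"
    using assms k N.eqv_N N.N_power[of p] p_gt unfolding N.yfam_def by metis
  hence "N (y n k) ^ p ^ (n - k) = N (y (Suc n) k) ^ p ^ (Suc n - k)"
    using k by (simp add: Suc_diff_le flip: power_mult)
  also have "\<dots> \<le> height y (Suc n)" by (rule height_ge) (use k in simp)
  finally show "N (y n k) ^ p ^ (n - k) \<le> height y (Suc n)" .
qed

lemma xfam_frob:
  assumes "N.xfam x" "k \<le> n"
  shows "N.eqv (peval (x (Suc n)) (witt_frob_poly p k)) (x n k)"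
proof (rule N.eqv_of_ghost_sum[OF _ assms(2)])
  fix i assume "i \<le> n"
  thus "N.eqv (ghost_sum p (\<lambda>k. peval (x (Suc n)) (witt_frob_poly p k)) i) (ghost_sum p (x n) i)"
    using assms(1) by (simp add: ghost_sum_witt_frob[OF prime] N.xfam_def N.eqv_sym)
qed

text \<open>
  The component of index \<open>k\<close> of \<open>F\<close> is homogeneous of degree \<open>p p\<^sup>k\<close>, so that the seminorm of \<open>F x\<close> is at
  most the \<open>p\<close>-th power of the seminorm of \<open>x\<close>.
\<close>

lemma height_mono_xfam:
  assumes "N.xfam x"
  shows "height x n \<le> height x (Suc n)"
proof (rule height_le)
  fix k assume k: "k \<le> n"
  let ?w = "witt_norm p N (Suc n) (x (Suc n))"
  have "N (x n k) = N (peval (x (Suc n)) (witt_frob_poly p k))"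
    by (rule N.eqv_N[OF N.eqv_sym[OF xfam_frob[OF assms k]]])
  also have "\<dots> \<le> ?w ^ (p * p ^ k)"
    by (rule N.N_peval_homog[OF homog_witt_frob_poly[OF prime]]) (use height_bound[of _ "Suc n" x] k in auto)
  finally have "N (x n k) ^ p ^ (n - k) \<le> (?w ^ (p * p ^ k)) ^ p ^ (n - k)"
    by (intro power_mono N_nonneg)
  also have "\<dots> = height x (Suc n)"
  proof -
    have "p * p ^ k * p ^ (n - k) = p ^ Suc n"
      using k by (simp add: mult.assoc flip: power_add)
    thus ?thesis by (simp only: height_def flip: power_mult)
  qed
  finally show "N (x n k) ^ p ^ (n - k) \<le> height x (Suc n)" .
qed

definition grows :: "real \<Rightarrow> (nat \<Rightarrow> nat \<Rightarrow> 'a zpoly) \<Rightarrow> bool" where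
  "grows b y \<longleftrightarrow> (\<lambda>n. height y n / (p powr b) ^ n) \<longlonglongrightarrow> 0"

lemma powr_b:
  assumes "0 < b" "b \<le> 1"
  shows "1 < p powr b" "p powr b \<le> p"
  using assms p_gt powr_mono[of b 1 "real p"] by (auto simp: gr_one_powr)

lemma yfam_bnd:
  assumes "N.yfam y" "\<And>n. height y n \<le> G n"
  shows "N.bnd G y"
  unfolding N.bnd_def
proof (intro allI impI)
  fix n k :: nat assume k: "k \<le> n"
  have "N.eqv (y (k + (n - k)) k ^ p ^ (n - k)) (y k k)"
    by (rule N.yfam_power[OF assms(1)]) simp
  hence "N (y n k) ^ p ^ (n - k) = N (y k k)"
    using N.eqv_N[of "y n k ^ p ^ (n - k)" "y k k"] N.N_power[OF N.p_power_pos, of "y n k" "n - k"] k by simp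
  also have "\<dots> \<le> height y k" using height_ge[of k k y] by simp
  also have "\<dots> \<le> G k" by fact
  finally show "N (y n k) ^ p ^ (n - k) \<le> G k" .
qed

lemma bnd_height:
  assumes "N.bnd G y" "envelope c G"
  shows "height y n \<le> G n"
proof (rule height_le)
  fix k assume "k \<le> n"
  thus "N (y n k) ^ p ^ (n - k) \<le> G n"
    using assms(1) envelope_incr[OF assms(2)] unfolding N.bnd_def by (meson order_trans)
qed

lemma bnd_grows:
  assumes "N.bnd G y" "envelope (p powr b) G"
  shows "grows b y"
  unfolding grows_def
proof (rule tendsto_sandwich[OF _ _ tendsto_const])
  show "(\<lambda>k. G k / (p powr b) ^ k) \<longlonglongrightarrow> 0" using assms by (simp add: envelope_def)
  show "\<forall>\<^sub>F n in sequentially. height y n / (p powr b) ^ n \<le> G n / (p powr b) ^ n"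
    using bnd_height[OF assms] by (intro always_eventually allI divide_right_mono) auto
qed (simp add: height_nonneg)

text \<open>
  The heights increase with \<open>n\<close>, hence have an envelope; because of \<open>b \<le> 1\<close> it is also one for the ratio
  \<open>p\<close>, as needed for the expansion in powers of \<open>p\<close>.
\<close>

lemma grows_envelope:
  assumes b: "0 < b" "b \<le> 1" and "grows b y" "\<And>n. height y n \<le> height y (Suc n)"
  shows "\<exists>G. envelope (p powr b) G \<and> envelope p G \<and> (\<forall>n. height y n \<le> G n) \<and>
    (\<forall>M n. (\<forall>l. height y l / (p powr b) ^ l \<le> M) \<longrightarrow> G n / (p powr b) ^ n \<le> M)"
proof (rule envelope_exists[OF powr_b(1)[OF b] height_nonneg assms(4) assms(3)[unfolded grows_def]])
  fix G assume G: "envelope (p powr b) G" "\<And>n. height y n \<le> G n"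
    "\<And>M n. (\<And>l. height y l / (p powr b) ^ l \<le> M) \<Longrightarrow> G n / (p powr b) ^ n \<le> M"
  show ?thesis
    using G(1) envelope_mono[OF G(1) powr_b[OF b]] G(2,3) by (intro exI[of _ G]) simp
qed

lemma grows_yx:
  assumes b: "0 < b" "b \<le> 1" and y: "N.yfam y" "grows b y"
  shows "\<exists>x. N.xfam x \<and> N.rel y x"
proof -
  obtain G where "envelope p G" "\<And>n. height y n \<le> G n"
    using grows_envelope[OF b y(2) height_mono_yfam[OF y(1)]] by blast
  thus ?thesis using N.rel_exists yfam_bnd[OF y(1)] by blast
qed

lemma grows_yx_bound:
  assumes b: "0 < b" "b \<le> 1" and y: "N.yfam y" "grows b y" and x: "N.xfam x" "N.rel y x"
  shows "grows b x" "(\<And>l. height y l / (p powr b) ^ l \<le> M) \<Longrightarrow> height x n / (p powr b) ^ n \<le> M"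
proof -
  obtain G where G: "envelope (p powr b) G" "envelope p G" "\<And>n. height y n \<le> G n"
    "\<And>M n. (\<And>l. height y l / (p powr b) ^ l \<le> M) \<Longrightarrow> G n / (p powr b) ^ n \<le> M"
    using grows_envelope[OF b y(2) height_mono_yfam[OF y(1)]] by blast
  have bnd: "N.bnd G x"
    by (rule N.rel_bnd[OF x(1) y(1) x(2) yfam_bnd[OF y(1) G(3)] G(2)])
  show "grows b x" by (rule bnd_grows[OF bnd G(1)])
  assume "\<And>l. height y l / (p powr b) ^ l \<le> M"
  hence "G n / (p powr b) ^ n \<le> M" by (rule G(4))
  moreover have "height x n / (p powr b) ^ n \<le> G n / (p powr b) ^ n"
    using bnd_height[OF bnd G(1)] by (intro divide_right_mono) auto
  ultimately show "height x n / (p powr b) ^ n \<le> M" by linarith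
qed

lemma grows_xy:
  assumes b: "0 < b" "b \<le> 1" and x: "N.xfam x" "grows b x"
  shows "\<exists>y. N.yfam y \<and> N.rel y x \<and> grows b y \<and>
    (\<forall>M n. (\<forall>l. height x l / (p powr b) ^ l \<le> M) \<longrightarrow> height y n / (p powr b) ^ n \<le> M)"
proof -
  obtain G where G: "envelope (p powr b) G" "envelope p G" "\<And>n. height x n \<le> G n"
    "\<And>M n. (\<And>l. height x l / (p powr b) ^ l \<le> M) \<Longrightarrow> G n / (p powr b) ^ n \<le> M"
    using grows_envelope[OF b x(2) height_mono_xfam[OF x(1)]] by blast
  have "N (x n k) ^ p ^ (n - k) \<le> G n" if "k \<le> n" for n k
    using height_ge[OF that, of x] G(3)[of n] by linarith
  then obtain y where y: "N.yfam y" "N.bnd G y" "N.rel y x"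
    using N.rel_exists_y[OF x(1) G(2)] by blast
  show ?thesis
  proof (intro exI conjI allI impI)
    show "N.yfam y" "N.rel y x" "grows b y" using y bnd_grows[OF y(2) G(1)] by auto
    fix M n assume "\<forall>l. height x l / (p powr b) ^ l \<le> M"
    hence "G n / (p powr b) ^ n \<le> M" using G(4) by simp
    moreover have "height y n / (p powr b) ^ n \<le> G n / (p powr b) ^ n"
      using bnd_height[OF y(2) G(1)] by (intro divide_right_mono) auto
    ultimately show "height y n / (p powr b) ^ n \<le> M" by linarith
  qed
qed

lemma grows_y_unique:
  assumes b: "0 < b" "b \<le> 1" and y: "N.yfam y" "grows b y" "N.rel y x"
    and y': "N.yfam y'" "grows b y'" "N.rel y' x" and k: "k \<le> n"
  shows "N.eqv (y n k) (y' n k)"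
proof -
  obtain G where G: "envelope p G" "\<And>n. height y n \<le> G n"
    using grows_envelope[OF b y(2) height_mono_yfam[OF y(1)]] by blast
  obtain G' where G': "envelope p G'" "\<And>n. height y' n \<le> G' n"
    using grows_envelope[OF b y'(2) height_mono_yfam[OF y'(1)]] by blast
  have 1: "height y n \<le> G n + G' n" for n using G(2)[of n] envelope_nonneg[OF G'(1), of n] by linarith
  have 2: "height y' n \<le> G n + G' n" for n using G'(2)[of n] envelope_nonneg[OF G(1), of n] by linarith
  show ?thesis
    by (rule N.rel_unique_y[OF y(1) yfam_bnd[OF y(1) 1] y(3) y'(1) yfam_bnd[OF y'(1) 2] y'(3)
        envelope_add[OF G(1) G'(1)] k])
qed


subsection \<open>Elements of the inverse limits\<close>

text \<open>
  Representatives of elements of the inverse limits over \<open>R\<close> and \<open>R'\<close> in the polynomial ring.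
\<close>

abbreviation hat :: "(nat \<Rightarrow> nat \<Rightarrow> 'a) \<Rightarrow> nat \<Rightarrow> nat \<Rightarrow> 'a zpoly" where
  "hat x \<equiv> (\<lambda>n k. X (x n k))"

abbreviation sharp :: "(nat \<Rightarrow> nat \<Rightarrow> nat \<Rightarrow> 'a) \<Rightarrow> nat \<Rightarrow> nat \<Rightarrow> 'a zpoly" where
  "sharp z \<equiv> (\<lambda>n k. X (z n k 0))"

lemma vars_frob: "v \<in> zpoly_vars (witt_frob_poly p k) \<Longrightarrow> v \<le> Suc k"
  using homog_vars[OF homog_witt_frob_poly[OF prime, of k]] by auto

lemma witt_F_eq_iff:
  assumes "f \<in> {..n} \<rightarrow>\<^sub>E C"
  shows "witt_F p S n u = f \<longleftrightarrow> (\<forall>k\<le>n. witt_F p S n u k = f k)"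
proof
  assume *: "\<forall>k\<le>n. witt_F p S n u k = f k"
  show "witt_F p S n u = f"
    by (rule extensionalityI[of _ "{..n}"]) (use assms * in \<open>auto simp: witt_F_def PiE_iff\<close>)
qed simp

lemma witt_lim_R_iff:
  "x \<in> carrier (witt_lim p R) \<longleftrightarrow> (\<forall>n. x n \<in> {..n} \<rightarrow>\<^sub>E carrier R) \<and> N.xfam (hat x)"
proof -
  have "(\<forall>n. witt_F p R n (x (Suc n)) = x n) \<longleftrightarrow> N.xfam (hat x)" if x: "\<And>n. x n \<in> {..n} \<rightarrow>\<^sub>E carrier R"
  proof -
    have comp: "witt_F p R n (x (Suc n)) k = x n k \<longleftrightarrow>
        N.eqv (peval (hat x (Suc n)) (witt_frob_poly p k)) (hat x n k)" if "k \<le> n" for n k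
    proof -
      have "zpoly_eval R (x (Suc n)) (witt_frob_poly p k) = ev (peval (hat x (Suc n)) (witt_frob_poly p k))"
        by (rule zpoly_eval_cover_X[OF R]) (use vars_frob[of _ k] x[of "Suc n"] that in fastforce)
      moreover have "x n k \<in> carrier R" using PiE_mem[OF x[of n], of k] that by simp
      ultimately show ?thesis using that by (simp add: witt_F_def eqv_iff)
    qed
    have "witt_F p R n (x (Suc n)) = x n \<longleftrightarrow>
        (\<forall>k\<le>n. N.eqv (ghost_sum p (hat x n) k) (ghost_sum p (hat x (Suc n)) (Suc k)))" for n
    proof -
      have "witt_F p R n (x (Suc n)) = x n \<longleftrightarrow> (\<forall>k\<le>n. witt_F p R n (x (Suc n)) k = x n k)"
        by (rule witt_F_eq_iff[OF x])
      also have "\<dots> \<longleftrightarrow> (\<forall>k\<le>n. N.eqv (peval (hat x (Suc n)) (witt_frob_poly p k)) (hat x n k))"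
        using comp by blast
      also have "\<dots> \<longleftrightarrow> (\<forall>k\<le>n. N.eqv (ghost_sum p (\<lambda>k. peval (hat x (Suc n)) (witt_frob_poly p k)) k)
          (ghost_sum p (hat x n) k))"
      proof (intro iffI allI impI)
        fix k assume *: "\<forall>k\<le>n. N.eqv (peval (hat x (Suc n)) (witt_frob_poly p k)) (hat x n k)" and "k \<le> n"
        thus "N.eqv (ghost_sum p (\<lambda>k. peval (hat x (Suc n)) (witt_frob_poly p k)) k) (ghost_sum p (hat x n) k)"
          by (intro N.eqv_ghost_sum) simp
      next
        fix k assume *: "\<forall>k\<le>n. N.eqv (ghost_sum p (\<lambda>k. peval (hat x (Suc n)) (witt_frob_poly p k)) k)
          (ghost_sum p (hat x n) k)" and "k \<le> n"
        show "N.eqv (peval (hat x (Suc n)) (witt_frob_poly p k)) (hat x n k)"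
          by (rule N.eqv_of_ghost_sum[OF _ \<open>k \<le> n\<close>]) (use * in blast)
      qed
      also have "\<dots> \<longleftrightarrow> (\<forall>k\<le>n. N.eqv (ghost_sum p (hat x n) k) (ghost_sum p (hat x (Suc n)) (Suc k)))"
        unfolding ghost_sum_witt_frob[OF prime] using N.eqv_sym by blast
      finally show ?thesis .
    qed
    thus ?thesis by (simp add: N.xfam_def)
  qed
  thus ?thesis by (auto simp: witt_lim_def witt_def)
qed

lemma witt_lim_R'_iff:
  "z \<in> carrier (witt_lim p R') \<longleftrightarrow> (\<forall>n. z n \<in> {..n} \<rightarrow>\<^sub>E p_power_seqs p R) \<and>
     (\<forall>n k m. k \<le> n \<longrightarrow> z (Suc n) k m [^]\<^bsub>R\<^esub> p = z n k m)"
proof -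
  have "witt_F p R' n (z (Suc n)) = z n \<longleftrightarrow> (\<forall>k m. k \<le> n \<longrightarrow> z (Suc n) k m [^]\<^bsub>R\<^esub> p = z n k m)"
    if z: "\<And>n. z n \<in> {..n} \<rightarrow>\<^sub>E p_power_seqs p R" for n
  proof -
    have zk: "z n k \<in> p_power_seqs p R" if "k \<le> n" for n k using PiE_mem[OF z[of n]] that by simp
    have comp: "zpoly_eval R' (z (Suc n)) (witt_frob_poly p k) = (\<lambda>m. z (Suc n) k m [^]\<^bsub>R\<^esub> p)" if "k \<le> n" for k
    proof -
      have "zpoly_eval R' (z (Suc n)) (witt_frob_poly p k) = ev' (peval (\<lambda>v. X (z (Suc n) v)) (witt_frob_poly p k))"
        by (rule zpoly_eval_cover_X[OF R'_cring]) (use vars_frob[of _ k] zk[of _ "Suc n"] that in fastforce)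
      also have "\<dots> = ev' (X (z (Suc n) k) ^ p)"
        using N'.N_witt_frob_char_p[OF prime N'_p, of "\<lambda>v. X (z (Suc n) v)" k]
        unfolding N'_zero_iff ev'.diff R'.r_right_minus_eq[OF ev'.closed ev'.closed] .
      also have "\<dots> = (\<lambda>m. z (Suc n) k m [^]\<^bsub>R\<^esub> p)"
        using zk[of k "Suc n"] that cover_X[OF R'_cring, of "z (Suc n) k"] by (simp add: nat_pow_R')
      finally show ?thesis .
    qed
    have "witt_F p R' n (z (Suc n)) = z n \<longleftrightarrow> (\<forall>k\<le>n. witt_F p R' n (z (Suc n)) k = z n k)"
      by (rule witt_F_eq_iff[OF z])
    thus ?thesis using comp by (auto simp: witt_F_def fun_eq_iff)
  qed
  thus ?thesis by (auto simp: witt_lim_def witt_def)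
qed

context
  fixes z assumes z: "z \<in> carrier (witt_lim p R')"
begin

lemma z_seq: "k \<le> n \<Longrightarrow> z n k \<in> p_power_seqs p R"
  using z PiE_mem[of "z n" "{..n}" "\<lambda>_. p_power_seqs p R" k] by (simp add: witt_lim_R'_iff)

lemma z_power: "k \<le> n \<Longrightarrow> z (Suc n) k m [^]\<^bsub>R\<^esub> p = z n k m"
  using z by (simp add: witt_lim_R'_iff)

text \<open>
  On \<open>R'\<close>, raising to the power \<open>p\<close> shifts the sequence, and it takes \<open>z\<^sub>n\<^sub>+\<^sub>1\<^sub>,\<^sub>k\<close> to \<open>z\<^sub>n\<^sub>,\<^sub>k\<close>. So \<open>z\<close> is determined by
  first entries.
\<close>

lemma z_entry: "k \<le> n \<Longrightarrow> z n k m = z (n + m) k 0"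
proof (induction m arbitrary: n)
  case (Suc m)
  have "z n k (Suc m) = z (Suc n) k (Suc m) [^]\<^bsub>R\<^esub> p" using z_power Suc.prems by simp
  also have "\<dots> = z (Suc n) k m" by (rule R'_power[OF z_seq]) (use Suc.prems in simp)
  also have "\<dots> = z (Suc n + m) k 0" by (rule Suc.IH) (use Suc.prems in simp)
  finally show ?case by simp
qed simp

lemma yfam_sharp: "N.yfam (sharp z)"
  using z_power z_seq by (auto simp: N.yfam_def eqv_iff)

end

lemma from_yfam:
  assumes "N.yfam y"
  obtains z where "z \<in> carrier (witt_lim p R')" "\<And>n k. k \<le> n \<Longrightarrow> N.eqv (sharp z n k) (y n k)"
proof -
  define z where "z n = (\<lambda>k\<in>{..n}. \<lambda>m. ev (y (n + m) k))" for n
  have power: "ev (y (Suc n) k) [^]\<^bsub>R\<^esub> p = ev (y n k)" if "k \<le> n" for n k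
    using assms that unfolding N.yfam_def eqv_iff by simp
  have "z n \<in> {..n} \<rightarrow>\<^sub>E p_power_seqs p R" for n
    using power by (auto simp: z_def p_power_seqs_def)
  moreover have "z (Suc n) k m [^]\<^bsub>R\<^esub> p = z n k m" if "k \<le> n" for n k m
    using power[of k "n + m"] that by (simp add: z_def)
  ultimately have "z \<in> carrier (witt_lim p R')" by (simp add: witt_lim_R'_iff)
  moreover have "N.eqv (sharp z n k) (y n k)" if "k \<le> n" for n k
    using that X_ev by (simp add: z_def)
  ultimately show ?thesis using that by blast
qed

lemma from_xfam:
  assumes "N.xfam x"
  obtains x' where "x' \<in> carrier (witt_lim p R)" "\<And>n k. k \<le> n \<Longrightarrow> N.eqv (hat x' n k) (x n k)"
proof -
  define x' where "x' n = (\<lambda>k\<in>{..n}. ev (x n k))" for n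
  have eqv: "N.eqv (hat x' n k) (x n k)" if "k \<le> n" for n k
    using that X_ev by (simp add: x'_def)
  have "N.xfam (hat x')"
    unfolding N.xfam_def
  proof (intro allI impI)
    fix n k :: nat assume k: "k \<le> n"
    have "N.eqv (ghost_sum p (hat x' n) k) (ghost_sum p (x n) k)"
      by (rule N.eqv_ghost_sum) (use eqv k in simp)
    also have "N.eqv \<dots> (ghost_sum p (x (Suc n)) (Suc k))"
      using assms k by (simp add: N.xfam_def)
    also have "N.eqv \<dots> (ghost_sum p (hat x' (Suc n)) (Suc k))"
      by (rule N.eqv_ghost_sum[OF N.eqv_sym[OF eqv]]) (use k in simp)
    finally show "N.eqv (ghost_sum p (hat x' n) k) (ghost_sum p (hat x' (Suc n)) (Suc k))" .
  qed
  hence "x' \<in> carrier (witt_lim p R)" by (auto simp: witt_lim_R_iff x'_def)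
  thus ?thesis using that eqv by blast
qed

lemma psum_eqv: "(\<And>n k. k \<le> n \<Longrightarrow> N.eqv (y n k) (y' n k)) \<Longrightarrow> N.eqv (N.psum y m K) (N.psum y' m K)"
  unfolding N.psum_def by (intro N.eqv_sum N.eqv_mult N.eqv_refl) auto

lemma rel_cong:
  assumes "N.rel y x" "\<And>n k. k \<le> n \<Longrightarrow> N.eqv (y n k) (y' n k)" "\<And>n k. k \<le> n \<Longrightarrow> N.eqv (x n k) (x' n k)"
  shows "N.rel y' x'"
  unfolding N.rel_def
proof
  fix m
  show "N.tends (N.psum y' m) (x' m 0)"
    by (rule N.tends_eqv[of "N.psum y m" "x m 0"])
      (use assms psum_eqv[of y y' m] in \<open>auto simp: N.rel_def\<close>)
qed

lemma height_cong:
  assumes "\<And>n k. k \<le> n \<Longrightarrow> N.eqv (y n k) (y' n k)"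
  shows "height y = height y'"
proof
  fix n
  have eq: "N (y n k) = N (y' n k)" if "k \<le> n" for k
    by (rule N.eqv_N[OF assms[OF that]])
  have "witt_norm p N n (y n) = witt_norm p N n (y' n)"
    unfolding witt_norm_def by (intro arg_cong[of _ _ Sup] image_cong) (use eq in auto)
  thus "height y n = height y' n" by (simp add: height_def)
qed

lemma term_R:
  assumes "x \<in> carrier (witt_lim p R)"
  shows "witt_lim_term p b nu x n = height (hat x) n / (p powr b) ^ n"
proof -
  have x: "k \<le> n \<Longrightarrow> x n k \<in> carrier R" for k
    using assms PiE_mem[of "x n" "{..n}" "\<lambda>_. carrier R" k] by (simp add: witt_lim_R_iff)
  have "witt_norm p nu n (x n) = witt_norm p N n (hat x n)"
    unfolding witt_norm_def by (intro arg_cong[of _ _ Sup] image_cong) (use x in \<open>auto simp: N_def\<close>)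
  moreover have "real p powr (- b * real n) = 1 / (p powr b) ^ n"
    using p_gt by (simp add: powr_minus_divide powr_powr powr_realpow[symmetric])
  ultimately show ?thesis by (simp add: witt_lim_term_def height_def)
qed

lemma term_R':
  assumes "z \<in> carrier (witt_lim p R')"
  shows "witt_lim_term p b nu' z n = height (sharp z) n / (p powr b) ^ n"
proof -
  have "witt_norm p nu' n (z n) = witt_norm p N n (sharp z n)"
    unfolding witt_norm_def
    by (intro arg_cong[of _ _ Sup] image_cong) (use z_seq[OF assms] in \<open>auto simp: nu'_eq\<close>)
  moreover have "real p powr (- b * real n) = 1 / (p powr b) ^ n"
    using p_gt by (simp add: powr_minus_divide powr_powr powr_realpow[symmetric])
  ultimately show ?thesis by (simp add: witt_lim_term_def height_def)
qed

lemma witt_lim_b_R: "x \<in> carrier (witt_lim_b p b R nu) \<longleftrightarrow> x \<in> carrier (witt_lim p R) \<and> grows b (hat x)"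
proof -
  have "witt_lim_term p b nu x = (\<lambda>n. height (hat x) n / (p powr b) ^ n)" if "x \<in> carrier (witt_lim p R)"
    using term_R[OF that] by auto
  thus ?thesis by (auto simp: witt_lim_b_def grows_def)
qed

lemma witt_lim_b_R': "z \<in> carrier (witt_lim_b p b R' nu') \<longleftrightarrow> z \<in> carrier (witt_lim p R') \<and> grows b (sharp z)"
proof -
  have "witt_lim_term p b nu' z = (\<lambda>n. height (sharp z) n / (p powr b) ^ n)" if "z \<in> carrier (witt_lim p R')"
    using term_R'[OF that] by auto
  thus ?thesis by (auto simp: witt_lim_b_def grows_def)
qed

subsection \<open>The correspondence\<close>

text \<open>
  A relation rather than a function, because the series need not converge without the growth condition.
\<close>

definition corr :: "(nat \<Rightarrow> nat \<Rightarrow> nat \<Rightarrow> 'a) \<Rightarrow> (nat \<Rightarrow> nat \<Rightarrow> 'a) \<Rightarrow> bool" where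
  "corr z x \<longleftrightarrow> x \<in> carrier (witt_lim p R) \<and> N.rel (sharp z) (hat x)"

lemma corr_unique:
  assumes "corr z x" "corr z x'"
  shows "x = x'"
proof (intro ext)
  fix n k
  have x: "x n \<in> {..n} \<rightarrow>\<^sub>E carrier R" "x' n \<in> {..n} \<rightarrow>\<^sub>E carrier R"
    using assms by (auto simp: corr_def witt_lim_R_iff)
  show "x n k = x' n k"
  proof (cases "k \<le> n")
    case True
    have "N.eqv (hat x n k) (hat x' n k)"
      by (rule N.rel_unique_x[of _ _ "sharp z"]) (use assms True in \<open>auto simp: corr_def witt_lim_R_iff\<close>)
    thus ?thesis using PiE_mem[OF x(1), of k] PiE_mem[OF x(2), of k] True by (simp add: eqv_iff)
  next
    case False
    thus ?thesis using PiE_arb[OF x(1), of k] PiE_arb[OF x(2), of k] by simp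
  qed
qed

lemma corr_exists:
  assumes b: "0 < b" "b \<le> 1" and z: "z \<in> carrier (witt_lim_b p b R' nu')"
  shows "\<exists>x. corr z x"
proof -
  have z': "z \<in> carrier (witt_lim p R')" "grows b (sharp z)" using z by (auto simp: witt_lim_b_R')
  obtain x where x: "N.xfam x" "N.rel (sharp z) x"
    using grows_yx[OF b yfam_sharp[OF z'(1)] z'(2)] by blast
  obtain x' where x': "x' \<in> carrier (witt_lim p R)" "\<And>n k. k \<le> n \<Longrightarrow> N.eqv (hat x' n k) (x n k)"
    using from_xfam[OF x(1)] by blast
  have "N.rel (sharp z) (hat x')"
    by (rule rel_cong[OF x(2)]) (use N.eqv_sym[OF x'(2)] in auto)
  thus ?thesis using x'(1) by (auto simp: corr_def)
qed

lemma corr_bound: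
  assumes b: "0 < b" "b \<le> 1" and z: "z \<in> carrier (witt_lim_b p b R' nu')" and "corr z x"
  shows "x \<in> carrier (witt_lim_b p b R nu)"
    and "(\<And>l. witt_lim_term p b nu' z l \<le> M) \<Longrightarrow> witt_lim_term p b nu x n \<le> M"
proof -
  have z': "z \<in> carrier (witt_lim p R')" "grows b (sharp z)" using z by (auto simp: witt_lim_b_R')
  have x: "x \<in> carrier (witt_lim p R)" "N.rel (sharp z) (hat x)" using assms(4) by (auto simp: corr_def)
  have "N.xfam (hat x)" using x by (simp add: witt_lim_R_iff)
  note bound = grows_yx_bound[OF b yfam_sharp[OF z'(1)] z'(2) this x(2)]
  show "x \<in> carrier (witt_lim_b p b R nu)" using x bound(1) by (simp add: witt_lim_b_R)
  show "(\<And>l. witt_lim_term p b nu' z l \<le> M) \<Longrightarrow> witt_lim_term p b nu x n \<le> M"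
    unfolding term_R[OF x(1)] term_R'[OF z'(1)] by (rule bound(2))
qed

lemma corr_inj:
  assumes b: "0 < b" "b \<le> 1" and z: "z \<in> carrier (witt_lim_b p b R' nu')" "z' \<in> carrier (witt_lim_b p b R' nu')"
    and corr: "corr z x" "corr z' x"
  shows "z = z'"
proof (intro ext)
  fix n k m
  have zl: "z \<in> carrier (witt_lim p R')" "grows b (sharp z)" and zl': "z' \<in> carrier (witt_lim p R')" "grows b (sharp z')"
    using z by (auto simp: witt_lim_b_R')
  show "z n k m = z' n k m"
  proof (cases "k \<le> n")
    case True
    have "N.eqv (sharp z (n + m) k) (sharp z' (n + m) k)"
      using corr True
      by (intro grows_y_unique[OF b yfam_sharp[OF zl(1)] zl(2) _ yfam_sharp[OF zl'(1)] zl'(2)])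
        (auto simp: corr_def)
    hence "z (n + m) k 0 = z' (n + m) k 0"
      using z_seq[OF zl(1), of k "n + m"] z_seq[OF zl'(1), of k "n + m"] True by (simp add: eqv_iff)
    thus ?thesis using z_entry[OF zl(1) True, of m] z_entry[OF zl'(1) True, of m] by simp
  next
    case False
    hence "z n k = undefined" "z' n k = undefined"
      using zl(1) zl'(1) PiE_arb[of "z n" "{..n}" _ k] PiE_arb[of "z' n" "{..n}" _ k]
      by (auto simp: witt_lim_R'_iff)
    thus ?thesis by simp
  qed
qed

lemma corr_surj:
  assumes b: "0 < b" "b \<le> 1" and x: "x \<in> carrier (witt_lim_b p b R nu)"
  shows "\<exists>z \<in> carrier (witt_lim_b p b R' nu'). corr z x \<and>
    (\<forall>M n. (\<forall>l. witt_lim_term p b nu x l \<le> M) \<longrightarrow> witt_lim_term p b nu' z n \<le> M)"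
proof -
  have x': "x \<in> carrier (witt_lim p R)" "grows b (hat x)" using x by (auto simp: witt_lim_b_R)
  have xfam: "N.xfam (hat x)" using x' by (simp add: witt_lim_R_iff)
  obtain y where y: "N.yfam y" "N.rel y (hat x)" "grows b y"
    "\<forall>M n. (\<forall>l. height (hat x) l / (p powr b) ^ l \<le> M) \<longrightarrow> height y n / (p powr b) ^ n \<le> M"
    using grows_xy[OF b xfam x'(2)] by blast
  obtain z where z: "z \<in> carrier (witt_lim p R')" "\<And>n k. k \<le> n \<Longrightarrow> N.eqv (sharp z n k) (y n k)"
    by (rule from_yfam[OF y(1)]) (rule that)
  have h: "height (sharp z) = height y" by (rule height_cong) (rule z(2))
  show ?thesis
  proof (intro bexI[of _ z] conjI)
    show "z \<in> carrier (witt_lim_b p b R' nu')" using z(1) y(3) by (simp add: witt_lim_b_R' grows_def h)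
    have "N.rel (sharp z) (hat x)"
      by (rule rel_cong[OF y(2)]) (use N.eqv_sym[OF z(2)] in auto)
    thus "corr z x" using x' by (simp add: corr_def)
    show "\<forall>M n. (\<forall>l. witt_lim_term p b nu x l \<le> M) \<longrightarrow> witt_lim_term p b nu' z n \<le> M"
      unfolding term_R[OF x'(1)] term_R'[OF z(1)] h by (rule y(4))
  qed
qed

subsection \<open>Compatibility with the ring structures\<close>

lemma vars_le:
  assumes "homog wt ({..k} <+> {..k}) d P" "v \<in> zpoly_vars P"
  obtains i where "i \<le> k" "v = Inl i" | i where "i \<le> k" "v = Inr i"
  using homog_vars[OF assms(1)] assms(2) by auto

text \<open>
  The common part of compatibility with sums and products. The operations differ in the hypothesis
  \<open>bound\<close>, which controls the tails in terms of bounds for the operands. It takes roots because the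
  component of index \<open>i\<close> at level \<open>n\<close> is bounded by the \<open>p\<^sup>n\<^sup>-\<^sup>i\<close>-th root of \<open>G\<^sub>i\<close>.
\<close>

lemma corr_op:
  fixes P :: "nat \<Rightarrow> (nat + nat) zpoly" and op :: "'a zpoly \<Rightarrow> 'a zpoly \<Rightarrow> 'a zpoly"
  assumes ghost: "\<And>(u :: nat \<Rightarrow> 'a zpoly) v n. ghost_sum p (\<lambda>k. peval (case_sum u v) (P k)) n = op (ghost_sum p u n) (ghost_sum p v n)"
    and homog: "\<And>n. homog (witt_wt p) ({..n} <+> {..n}) (e * p ^ n) (P n)"
    and op_tends: "\<And>s t z w. N.tends s z \<Longrightarrow> N.tends t w \<Longrightarrow> N.tends (\<lambda>l. op (s l) (t l)) (op z w)"
    and op_eqv: "\<And>a a' b b'. N.eqv a a' \<Longrightarrow> N.eqv b b' \<Longrightarrow> N.eqv (op a b) (op a' b')"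
    and bound: "\<And>G G'. envelope p G \<Longrightarrow> envelope p G' \<Longrightarrow> \<exists>T. envelope p T \<and> (\<forall>u v n k. k \<le> n \<longrightarrow>
       (\<forall>i\<le>k. N' (u i) \<le> N.rt n (G i) ^ p ^ i) \<longrightarrow> (\<forall>i\<le>k. N' (v i) \<le> N.rt n (G' i) ^ p ^ i) \<longrightarrow>
       N' (peval (case_sum u v) (P k)) \<le> N.rt n (T k) ^ p ^ k)"
    and b: "0 < b" "b \<le> 1" 
    and z: "z \<in> carrier (witt_lim_b p b R' nu')" and z': "z' \<in> carrier (witt_lim_b p b R' nu')"
    and corr: "corr z x" "corr z' x'"
  shows "corr (\<lambda>n. \<lambda>k\<in>{..n}. zpoly_eval R' (case_sum (z n) (z' n)) (P k))
    (\<lambda>n. \<lambda>k\<in>{..n}. zpoly_eval R (case_sum (x n) (x' n)) (P k))"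
proof -
  let ?z = "\<lambda>n. \<lambda>k\<in>{..n}. zpoly_eval R' (case_sum (z n) (z' n)) (P k)"
  let ?x = "\<lambda>n. \<lambda>k\<in>{..n}. zpoly_eval R (case_sum (x n) (x' n)) (P k)"
  have zl: "z \<in> carrier (witt_lim p R')" "grows b (sharp z)" and zl': "z' \<in> carrier (witt_lim p R')" "grows b (sharp z')"
    using z z' by (auto simp: witt_lim_b_R')
  have xl: "x \<in> carrier (witt_lim p R)" "N.rel (sharp z) (hat x)" and xl': "x' \<in> carrier (witt_lim p R)" "N.rel (sharp z') (hat x')"
    using corr by (auto simp: corr_def)
  have xc: "x n k \<in> carrier R" "x' n k \<in> carrier R" if "k \<le> n" for n k
    using xl(1) xl'(1) PiE_mem[of "x n" "{..n}" "\<lambda>_. carrier R" k] PiE_mem[of "x' n" "{..n}" "\<lambda>_. carrier R" k] that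
    by (auto simp: witt_lim_R_iff)
  have x_eval: "zpoly_eval R (case_sum (x n) (x' n)) (P k) = ev (peval (case_sum (hat x n) (hat x' n)) (P k))"
    if "k \<le> n" for n k
  proof -
    have "zpoly_eval R (case_sum (x n) (x' n)) (P k) = ev (peval (\<lambda>v. X (case_sum (x n) (x' n) v)) (P k))"
      by (rule zpoly_eval_cover_X[OF R]) (use xc that in \<open>auto elim!: vars_le[OF homog]\<close>)
    also have "(\<lambda>v. X (case_sum (x n) (x' n) v)) = case_sum (hat x n) (hat x' n)"
      by (rule ext) (simp split: sum.split)
    finally show ?thesis .
  qed
  have x_eqv: "N.eqv (hat ?x n k) (peval (case_sum (hat x n) (hat x' n)) (P k))" if "k \<le> n" for n k
    using that x_eval[OF that] X_ev by simp
  have x_ghost: "N.eqv (ghost_sum p (hat ?x n) k) (op (ghost_sum p (hat x n) k) (ghost_sum p (hat x' n) k))"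
    if "k \<le> n" for n k
    unfolding ghost[symmetric] by (rule N.eqv_ghost_sum) (rule x_eqv, use that in simp)
  have xfam: "N.xfam (hat ?x)"
    unfolding N.xfam_def
  proof (intro allI impI)
    fix n k :: nat assume k: "k \<le> n"
    have "N.eqv (op (ghost_sum p (hat x n) k) (ghost_sum p (hat x' n) k))
       (op (ghost_sum p (hat x (Suc n)) (Suc k)) (ghost_sum p (hat x' (Suc n)) (Suc k)))"
      using xl(1) xl'(1) k by (intro op_eqv) (auto simp: witt_lim_R_iff N.xfam_def)
    thus "N.eqv (ghost_sum p (hat ?x n) k) (ghost_sum p (hat ?x (Suc n)) (Suc k))"
      using x_ghost[OF k] x_ghost[of "Suc k" "Suc n"] k N.eqv_trans N.eqv_sym by (meson Suc_le_mono)
  qed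
  have "?x \<in> carrier (witt_lim p R)"
    unfolding witt_lim_R_iff using xfam x_eval by auto
  moreover have "N.rel (sharp ?z) (hat ?x)"
    unfolding N.rel_def
  proof
    fix m
    note yfam = yfam_sharp[OF zl(1)] yfam_sharp[OF zl'(1)]
    obtain G where G: "envelope p G" "\<And>n. height (sharp z) n \<le> G n"
      using grows_envelope[OF b zl(2) height_mono_yfam[OF yfam(1)]] by blast
    obtain G' where G': "envelope p G'" "\<And>n. height (sharp z') n \<le> G' n"
      using grows_envelope[OF b zl'(2) height_mono_yfam[OF yfam(2)]] by blast
    obtain T where T: "envelope p T" "\<And>u v n k. k \<le> n \<Longrightarrow>
       (\<And>i. i \<le> k \<Longrightarrow> N' (u i) \<le> N.rt n (G i) ^ p ^ i) \<Longrightarrow> (\<And>i. i \<le> k \<Longrightarrow> N' (v i) \<le> N.rt n (G' i) ^ p ^ i) \<Longrightarrow>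
       N' (peval (case_sum u v) (P k)) \<le> N.rt n (T k) ^ p ^ k"
      using bound[OF G(1) G'(1)] by blast
    define tr where "tr K w n i = (if i < K then w n i else (\<lambda>m. \<zero>\<^bsub>R\<^esub>))" for K and w :: "nat \<Rightarrow> nat \<Rightarrow> nat \<Rightarrow> 'a" and n i :: nat
    define q where "q K n k = zpoly_eval R' (case_sum (tr K z n) (tr K z' n)) (P k)" for K n k
    have tr_seq: "tr K z n i \<in> p_power_seqs p R" "tr K z' n i \<in> p_power_seqs p R" if "i \<le> n" for K n i
      using z_seq[OF zl(1) that] z_seq[OF zl'(1) that] R'_zero by (auto simp: tr_def)
    have tr_N': "N' (X (tr K w n i)) \<le> N.rt n (G i) ^ p ^ i"
      if i: "i \<le> n" and w: "w \<in> carrier (witt_lim p R')" "\<And>n. height (sharp w) n \<le> G n" and G: "envelope p G"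
      for K n i w G
    proof -
      have "N' (X (tr K w n i)) \<le> N.rt (n - i) (G i)"
      proof (cases "i < K")
        case True
        thus ?thesis
          using N.bnd_rt[OF yfam_bnd[OF yfam_sharp[OF w(1)] w(2)], of "n - i" i] i N'_X[OF z_seq[OF w(1) i]]
          by (simp add: tr_def)
      next
        case False
        have "N' (X (\<lambda>m. \<zero>\<^bsub>R\<^esub>)) = 0" using N'_X[OF R'_zero(1)] by (simp add: N_eq_0_iff)
        thus ?thesis using False N.rt_nonneg[OF envelope_nonneg[OF G]] by (simp add: tr_def)
      qed
      also have "\<dots> = N.rt n (G i) ^ p ^ i"
        using N.rt_add_power[OF envelope_nonneg[OF G], of "n - i" i i] i by simp
      finally show ?thesis .
    qed
    have "N.tends (N.psum (sharp ?z) m) (op (hat x m 0) (hat x' m 0))"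
    proof (rule N.rel_op[OF ghost homog op_tends yfam xl(2) xl'(2), where q = "\<lambda>K n k. X (q K n k 0)"
          and eps = "\<lambda>m K. N.rt m (T K) / real p ^ K"])
      fix K n k :: nat assume k: "k \<le> n"
      have "N.tends (\<lambda>l. peval (\<lambda>v. X (case_sum (tr K z n) (tr K z' n) v (0 + l))) (P k) ^ p ^ l) (X (q K n k 0))"
        unfolding q_def by (rule zpoly_eval_R'_limit) (use tr_seq k in \<open>auto elim!: vars_le[OF homog]\<close>)
      thus "N.tends (\<lambda>l. peval (case_sum (N.trunc K (sharp z) (n + l)) (N.trunc K (sharp z') (n + l))) (P k) ^ p ^ l)
          (X (q K n k 0))"
      proof (rule N.tends_eqv, intro always_eventually allI N.eqv_power eqv_peval_vars)
        fix l v assume "v \<in> zpoly_vars (P k)"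
        thus "N.eqv (X (case_sum (tr K z n) (tr K z' n) v (0 + l)))
            (case_sum (N.trunc K (sharp z) (n + l)) (N.trunc K (sharp z') (n + l)) v)"
          using z_entry[OF zl(1), of _ n l] z_entry[OF zl'(1), of _ n l] k
          by (auto elim!: vars_le[OF homog] simp: tr_def N.trunc_def eqv_iff)
      qed simp
    next
      fix K n k :: nat assume k: "k < K" "k \<le> n"
      have "q K n k = zpoly_eval R' (case_sum (z n) (z' n)) (P k)"
        unfolding q_def
        by (rule R'.zpoly_eval_cong)
          (use k z_seq[OF zl(1), of _ n] z_seq[OF zl'(1), of _ n] in \<open>auto elim!: vars_le[OF homog] simp: tr_def\<close>)
      thus "N.eqv (X (q K n k 0)) (sharp ?z n k)" using k by simp
    next
      fix m k K :: nat assume k: "K \<le> k"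
      have "N (X (q K (m + k) k 0)) = N' (peval (case_sum (\<lambda>i. X (tr K z (m + k) i)) (\<lambda>i. X (tr K z' (m + k) i))) (P k))"
      proof -
        have "q K (m + k) k = ev' (peval (\<lambda>v. X (case_sum (tr K z (m + k)) (tr K z' (m + k)) v)) (P k))"
          unfolding q_def by (rule zpoly_eval_cover_X[OF R'_cring]) (use tr_seq in \<open>auto elim!: vars_le[OF homog]\<close>)
        also have "(\<lambda>v. X (case_sum (tr K z (m + k)) (tr K z' (m + k)) v)) =
            case_sum (\<lambda>i. X (tr K z (m + k) i)) (\<lambda>i. X (tr K z' (m + k) i))"
          by (rule ext) (simp split: sum.split)
        finally show ?thesis by (simp add: N'_eq)
      qed
      also have "\<dots> \<le> N.rt (m + k) (T k) ^ p ^ k"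
        by (rule T(2)) (use tr_N'[OF _ zl(1) G(2) G(1)] tr_N'[OF _ zl'(1) G'(2) G'(1)] in auto)
      also have "\<dots> = N.rt m (T k)" by (rule N.rt_add_power[OF envelope_nonneg[OF T(1)]])
      also have "\<dots> \<le> real p ^ (k - K) * N.rt m (T K)"
        using N.rt_div_le[OF T(1), of m K "k - K"] k p_gt by (simp add: divide_le_eq mult.commute)
      also have "\<dots> = real p ^ k * (N.rt m (T K) / real p ^ K)"
        using k p_gt by (simp add: power_diff)
      finally show "N (X (q K (m + k) k 0)) \<le> real p ^ k * (N.rt m (T K) / real p ^ K)" .
    next
      show "(\<lambda>K. N.rt m (T K) / real p ^ K) \<longlonglongrightarrow> 0" for m
        using N.envelope_rt_tendsto_0[OF T(1), of m 0] by simp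
      show "0 \<le> N.rt m (T K) / real p ^ K" for m K
        using N.rt_nonneg[OF envelope_nonneg[OF T(1)]] by simp
    qed
    moreover have "N.eqv (op (hat x m 0) (hat x' m 0)) (hat ?x m 0)"
      using x_ghost[of 0 m] by (simp add: N.eqv_sym)
    ultimately show "N.tends (N.psum (sharp ?z) m) (hat ?x m 0)"
      by (rule_tac N.tends_eqv) auto
  qed
  ultimately show ?thesis by (simp add: corr_def)
qed


lemma rt_power_mono:
  assumes "0 \<le> a" "a \<le> b"
  shows "N.rt n a ^ k \<le> N.rt n b ^ k"
  by (intro power_mono N.rt_mono N.rt_nonneg assms)

lemma corr_add:
  assumes b: "0 < b" "b \<le> 1"
    and z: "z \<in> carrier (witt_lim_b p b R' nu')" "z' \<in> carrier (witt_lim_b p b R' nu')"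
    and corr: "corr z x" "corr z' x'"
  shows "corr (z \<oplus>\<^bsub>witt_lim p R'\<^esub> z') (x \<oplus>\<^bsub>witt_lim p R\<^esub> x')"
proof -
  have bound: "\<exists>T. envelope p T \<and> (\<forall>u v n k. k \<le> n \<longrightarrow>
       (\<forall>i\<le>k. N' (u i) \<le> N.rt n (G i) ^ p ^ i) \<longrightarrow> (\<forall>i\<le>k. N' (v i) \<le> N.rt n (G' i) ^ p ^ i) \<longrightarrow>
       N' (peval (case_sum u v) (witt_add_poly p k)) \<le> N.rt n (T k) ^ p ^ k)"
    if G: "envelope p G" and G': "envelope p G'" for G G'
  proof (intro exI[of _ "\<lambda>k. G k + G' k"] conjI allI impI envelope_add G G')
    fix u v and n k :: nat
    assume u: "\<forall>i\<le>k. N' (u i) \<le> N.rt n (G i) ^ p ^ i" and v: "\<forall>i\<le>k. N' (v i) \<le> N.rt n (G' i) ^ p ^ i"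
    note nonneg = envelope_nonneg[OF G] envelope_nonneg[OF G']
    show "N' (peval (case_sum u v) (witt_add_poly p k)) \<le> N.rt n (G k + G' k) ^ p ^ k"
    proof (rule N'.N_witt_add[OF prime])
      fix i assume i: "i \<le> k"
      have le: "G i \<le> G k + G' k" "G' i \<le> G k + G' k"
        using envelope_incr[OF G i] envelope_incr[OF G' i] nonneg[of k] by auto
      show "N' (u i) \<le> N.rt n (G k + G' k) ^ p ^ i"
        by (rule order_trans[OF _ rt_power_mono[OF nonneg(1) le(1)]]) (use u i in simp)
      show "N' (v i) \<le> N.rt n (G k + G' k) ^ p ^ i"
        by (rule order_trans[OF _ rt_power_mono[OF nonneg(2) le(2)]]) (use v i in simp)
    qed (use nonneg N.rt_nonneg in auto)
  qed
  have "corr (\<lambda>n. \<lambda>k\<in>{..n}. zpoly_eval R' (case_sum (z n) (z' n)) (witt_add_poly p k))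
      (\<lambda>n. \<lambda>k\<in>{..n}. zpoly_eval R (case_sum (x n) (x' n)) (witt_add_poly p k))"
  proof (rule corr_op[where op = "(+)" and e = 1, OF _ _ _ _ bound b z corr])
    show "ghost_sum p (\<lambda>k. peval (case_sum u v) (witt_add_poly p k)) n = ghost_sum p u n + ghost_sum p v n" for u v :: "nat \<Rightarrow> 'a zpoly" and n
      by (rule ghost_sum_witt_add[OF prime])
    show "homog (witt_wt p) ({..n} <+> {..n}) (1 * p ^ n) (witt_add_poly p n)" for n
      using homog_witt_add_poly[OF prime, of n] by simp
  qed (rule N.tends_add N.eqv_add; assumption)+
  thus ?thesis by (simp add: witt_lim_def witt_def)
qed

text \<open>
  Here the tails are only small enough because \<open>R'\<close> has characteristic \<open>p\<close>: the component of
  index \<open>k\<close> of a product is bounded by products of bounds for components of indices \<open>i\<close> and \<open>j\<close>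
  with \<open>i + j \<le> k\<close>.
\<close>

lemma corr_mult:
  assumes b: "0 < b" "b \<le> 1"
    and z: "z \<in> carrier (witt_lim_b p b R' nu')" "z' \<in> carrier (witt_lim_b p b R' nu')"
    and corr: "corr z x" "corr z' x'"
  shows "corr (z \<otimes>\<^bsub>witt_lim p R'\<^esub> z') (x \<otimes>\<^bsub>witt_lim p R\<^esub> x')"
proof -
  have bound: "\<exists>T. envelope p T \<and> (\<forall>u v n k. k \<le> n \<longrightarrow>
       (\<forall>i\<le>k. N' (u i) \<le> N.rt n (G i) ^ p ^ i) \<longrightarrow> (\<forall>i\<le>k. N' (v i) \<le> N.rt n (G' i) ^ p ^ i) \<longrightarrow>
       N' (peval (case_sum u v) (witt_mult_poly p k)) \<le> N.rt n (T k) ^ p ^ k)"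
    if G: "envelope p G" and G': "envelope p G'" for G G'
  proof (rule product_envelope[OF p_gt(3) G G'])
    fix T assume T: "envelope p T" "\<And>i j k. i + j \<le> k \<Longrightarrow> G i * G' j \<le> T k"
    note nonneg = envelope_nonneg[OF G] envelope_nonneg[OF G'] envelope_nonneg[OF T(1)]
    show ?thesis
    proof (intro exI[of _ T] conjI allI impI T(1))
      fix u v and n k :: nat
      assume u: "\<forall>i\<le>k. N' (u i) \<le> N.rt n (G i) ^ p ^ i" and v: "\<forall>i\<le>k. N' (v i) \<le> N.rt n (G' i) ^ p ^ i"
      show "N' (peval (case_sum u v) (witt_mult_poly p k)) \<le> N.rt n (T k) ^ p ^ k"
      proof (rule N'.N_witt_mult_char_p[OF prime N'_p])
        fix i j assume ij: "i + j \<le> k"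
        have "N' (u i) ^ p ^ j * N' (v j) ^ p ^ i \<le> (N.rt n (G i) ^ p ^ i) ^ p ^ j * (N.rt n (G' j) ^ p ^ j) ^ p ^ i"
          using u v ij nonneg N.rt_nonneg by (intro mult_mono power_mono) auto
        also have "\<dots> = N.rt n (G i * G' j) ^ p ^ (i + j)"
          by (simp add: real_root_mult power_mult_distrib mult.commute flip: power_mult power_add)
        also have "\<dots> \<le> N.rt n (T k) ^ p ^ (i + j)"
          by (intro rt_power_mono T ij mult_nonneg_nonneg nonneg)
        finally show "N' (u i) ^ p ^ j * N' (v j) ^ p ^ i \<le> N.rt n (T k) ^ p ^ (i + j)" .
      qed (use nonneg N.rt_nonneg in auto)
    qed
  qed
  have "corr (\<lambda>n. \<lambda>k\<in>{..n}. zpoly_eval R' (case_sum (z n) (z' n)) (witt_mult_poly p k))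
      (\<lambda>n. \<lambda>k\<in>{..n}. zpoly_eval R (case_sum (x n) (x' n)) (witt_mult_poly p k))"
  proof (rule corr_op[where op = "(*)" and e = 2, OF _ _ _ _ bound b z corr])
    show "ghost_sum p (\<lambda>k. peval (case_sum u v) (witt_mult_poly p k)) n = ghost_sum p u n * ghost_sum p v n" for u v :: "nat \<Rightarrow> 'a zpoly" and n
      by (rule ghost_sum_witt_mult[OF prime])
    show "homog (witt_wt p) ({..n} <+> {..n}) (2 * p ^ n) (witt_mult_poly p n)" for n
      using homog_witt_mult_poly[OF prime, of n] by simp
  qed (rule N.tends_mult N.eqv_mult; assumption)+
  thus ?thesis by (simp add: witt_lim_def witt_def)
qed

lemma corr_one: "corr (\<one>\<^bsub>witt_lim p R'\<^esub>) (\<one>\<^bsub>witt_lim p R\<^esub>)"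
proof -
  let ?x = "\<one>\<^bsub>witt_lim p R\<^esub>" and ?z = "\<one>\<^bsub>witt_lim p R'\<^esub>"
  have x: "?x n k = (if k = 0 then \<one>\<^bsub>R\<^esub> else \<zero>\<^bsub>R\<^esub>)" if "k \<le> n" for n k
    using that by (simp add: witt_lim_def witt_def)
  have z: "?z n k = (if k = 0 then (\<lambda>m. \<one>\<^bsub>R\<^esub>) else (\<lambda>m. \<zero>\<^bsub>R\<^esub>))" if "k \<le> n" for n k
    using that by (simp add: witt_lim_def witt_def)
  have eqv: "N.eqv (hat ?x n k) (if k = 0 then 1 else 0)" "N.eqv (sharp ?z n k) (if k = 0 then 1 else 0)"
    if "k \<le> n" for n k
    using x[OF that] z[OF that] by (auto simp: eqv_iff)
  have ghost: "N.eqv (ghost_sum p (hat ?x n) k) 1" if "k \<le> n" for n k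
  proof -
    have "N.eqv (ghost_sum p (hat ?x n) k) (ghost_sum p (\<lambda>k. if k = 0 then 1 else 0) k)"
      by (rule N.eqv_ghost_sum) (rule eqv(1), use that in simp)
    also have "ghost_sum p (\<lambda>k. if k = 0 then 1 else 0) k = (1 :: 'a zpoly)"
    proof -
      have "of_nat p ^ i * (if i = 0 then 1 else 0) ^ p ^ (k - i) = (if i = 0 then 1 else 0 :: 'a zpoly)" for i
        using zero_power[OF N.p_power_pos[of "k - i"], where ?'a = "'a zpoly"] by simp
      thus ?thesis by (simp add: ghost_sum_def)
    qed
    finally show ?thesis .
  qed
  have xfam: "N.xfam (hat ?x)"
    unfolding N.xfam_def
  proof (intro allI impI)
    fix n k :: nat assume "k \<le> n"
    hence "Suc k \<le> Suc n" by simp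
    show "N.eqv (ghost_sum p (hat ?x n) k) (ghost_sum p (hat ?x (Suc n)) (Suc k))"
      by (rule N.eqv_trans[OF ghost[OF \<open>k \<le> n\<close>] N.eqv_sym[OF ghost[OF \<open>Suc k \<le> Suc n\<close>]]])
  qed
  have "?x n \<in> {..n} \<rightarrow>\<^sub>E carrier R" for n
    by (auto simp: witt_lim_def witt_def)
  hence "?x \<in> carrier (witt_lim p R)" using xfam by (simp add: witt_lim_R_iff)
  moreover have "N.rel (sharp ?z) (hat ?x)"
    unfolding N.rel_def
  proof
    fix m
    have psum: "N.eqv (N.psum (sharp ?z) m K) 1" if "K \<ge> 1" for K
    proof -
      have "N.eqv (N.psum (sharp ?z) m K) (N.psum (\<lambda>n k. if k = 0 then 1 else 0) m K)"
        by (rule psum_eqv) (rule eqv(2))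
      also have "N.psum (\<lambda>n k. if k = 0 then 1 else 0) m K = 1"
      proof -
        have "N.psum (\<lambda>n k. if k = 0 then 1 else 0) m K = (\<Sum>k<K. if k = 0 then 1 else 0)"
          unfolding N.psum_def by (rule sum.cong) auto
        thus ?thesis using that by simp
      qed
      finally show ?thesis .
    qed
    have "N.tends (\<lambda>_. 1) 1" by (rule N.tends_const)
    thus "N.tends (N.psum (sharp ?z) m) (hat ?x m 0)"
    proof (rule N.tends_eqv)
      show "\<forall>\<^sub>F l in sequentially. N.eqv 1 (N.psum (sharp ?z) m l)"
        using eventually_ge_at_top[of 1] by eventually_elim (rule N.eqv_sym[OF psum])
      show "N.eqv 1 (hat ?x m 0)" using N.eqv_sym[OF eqv(1)[of 0 m]] by simp
    qed
  qed
  ultimately show ?thesis by (simp add: corr_def)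
qed

subsection \<open>The embedding of the integral elements\<close>

lemma vars_add_mult:
  "v \<in> zpoly_vars (witt_add_poly p k) \<Longrightarrow> v \<in> {..k} <+> {..k}"
  "v \<in> zpoly_vars (witt_mult_poly p k) \<Longrightarrow> v \<in> {..k} <+> {..k}"
  using homog_vars[OF homog_witt_add_poly[OF prime, of k]] homog_vars[OF homog_witt_mult_poly[OF prime, of k]]
  by auto

context
  fixes x assumes x: "x \<in> carrier (witt_lim p A')"
begin

lemma A'_closed: "k \<le> n \<Longrightarrow> x n k \<in> carrier A'"
  using x PiE_mem[of "x n" "{..n}" "\<lambda>_. carrier A'" k] by (simp add: witt_lim_def witt_def)

lemma j_SA: "k \<le> n \<Longrightarrow> j (x n k) \<in> SA"
  by (intro j_closed A'_closed)

lemma witt_lim_map_j: "witt_lim_map j x \<in> carrier (witt_lim p R')"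
proof -
  have "witt_F p R' n (witt_lim_map j x (Suc n)) = witt_lim_map j x n" for n
  proof -
    have "zpoly_eval R' (witt_lim_map j x (Suc n)) (witt_frob_poly p k) = j (x n k)" if k: "k \<le> n" for k
    proof -
      have vars: "v \<le> Suc n" if "v \<in> zpoly_vars (witt_frob_poly p k)" for v
        using vars_frob[OF that] k by simp
      have "zpoly_eval R' (witt_lim_map j x (Suc n)) (witt_frob_poly p k) =
          zpoly_eval R' (\<lambda>i. j (x (Suc n) i)) (witt_frob_poly p k)"
      proof (rule R'.zpoly_eval_cong)
        fix v assume "v \<in> zpoly_vars (witt_frob_poly p k)"
        from vars[OF this] show "witt_lim_map j x (Suc n) v = j (x (Suc n) v)" "j (x (Suc n) v) \<in> carrier R'"
          using j_SA[of v "Suc n"] SA_sub by (auto simp: witt_lim_map_def)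
      qed
      also have "\<dots> = j (zpoly_eval A' (x (Suc n)) (witt_frob_poly p k))"
        by (rule zpoly_eval_hom[OF A'_cring R'_cring j_hom]) (use A'_closed vars in blast)
      also have "zpoly_eval A' (x (Suc n)) (witt_frob_poly p k) = witt_F p A' n (x (Suc n)) k"
        using k by (simp add: witt_F_def)
      also have "witt_F p A' n (x (Suc n)) = x n" using x by (simp add: witt_lim_def)
      finally show ?thesis .
    qed
    thus ?thesis by (auto simp: witt_F_def witt_lim_map_def)
  qed
  moreover have "witt_lim_map j x n \<in> {..n} \<rightarrow>\<^sub>E carrier R'" for n
    using j_SA[of _ n] SA_sub by (auto simp: witt_lim_map_def)
  ultimately show ?thesis by (simp add: witt_lim_def witt_def)
qed

lemma witt_lim_map_j_mem: "k \<le> n \<Longrightarrow> mem (sharp (witt_lim_map j x) n k)"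
  using SA_mem[OF j_SA, of k n 0] by (simp add: witt_lim_map_def)

lemma witt_lim_map_j_b:
  assumes "b > 0"
  shows "witt_lim_map j x \<in> carrier (witt_lim_b p b R' nu')"
proof -
  have c: "1 < p powr b" using assms p_gt by (simp add: gr_one_powr)
  have h: "height (sharp (witt_lim_map j x)) n \<le> 1" for n
    by (rule height_le) (use mem_N_le[OF witt_lim_map_j_mem] N_nonneg in \<open>auto intro: power_le_one\<close>)
  have "grows b (sharp (witt_lim_map j x))"
    unfolding grows_def
  proof (rule tendsto_sandwich[OF _ _ tendsto_const])
    show "(\<lambda>n. inverse (p powr b) ^ n) \<longlonglongrightarrow> 0"
      using c by (intro LIMSEQ_power_zero) (simp add: inverse_less_1_iff)
    show "\<forall>\<^sub>F n in sequentially. height (sharp (witt_lim_map j x)) n / (p powr b) ^ n \<le> inverse (p powr b) ^ n"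
      using h by (intro always_eventually allI) (simp add: divide_inverse power_inverse mult_left_le_one_le height_nonneg)
  qed (simp add: height_nonneg)
  thus ?thesis using witt_lim_map_j by (simp add: witt_lim_b_R')
qed

text \<open>
  For integral elements, the comparison of ghost components gives congruences modulo \<open>p A\<close>
  instead of bounds for the seminorm.
\<close>

lemma corr_integral:
  assumes corr: "corr (witt_lim_map j x) u" and k: "k \<le> n"
  shows "memp 1 (hat u n k - sharp (witt_lim_map j x) n k)"
proof -
  let ?y = "sharp (witt_lim_map j x)"
  have u: "N.xfam (hat u)" "N.rel ?y (hat u)" using corr by (auto simp: corr_def witt_lim_R_iff)
  have yfam: "N.yfam ?y" by (rule yfam_sharp[OF witt_lim_map_j])
  have tail: "memp K (hat u m 0 - N.psum ?y m K)" for m K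
  proof -
    have "eventually (\<lambda>L. N (N.psum ?y m L - hat u m 0) < 1 / real p ^ K) sequentially"
      by (rule N.tendsD) (use u(2) p_gt in \<open>auto simp: N.rel_def\<close>)
    hence "eventually (\<lambda>L. N (N.psum ?y m L - hat u m 0) < 1 / real p ^ K \<and> L \<ge> K) sequentially"
      using eventually_ge_at_top by (rule eventually_conj)
    then obtain L where L: "N (N.psum ?y m L - hat u m 0) < 1 / real p ^ K" "L \<ge> K"
      by (auto simp: eventually_sequentially)
    have "memp K (hat u m 0 - N.psum ?y m L)"
      using N_less_memp[of "hat u m 0 - N.psum ?y m L" K] L(1) N.N_commute by simp
    moreover have "memp K (N.psum ?y m L - N.psum ?y m K)"
    proof -
      have "N.psum ?y m L - N.psum ?y m K = (\<Sum>i\<in>{K..<L}. of_nat p ^ i * ?y (m + i) i)"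
        using sum_diff_nat_ivl[of 0 K L "\<lambda>i. of_nat p ^ i * ?y (m + i) i"] L(2)
        by (simp add: N.psum_def lessThan_atLeast0)
      also have "memp K \<dots>"
      proof (rule memp.Q_sum)
        fix i assume i: "i \<in> {K..<L}"
        have "memp i (of_nat p ^ i * ?y (m + i) i)"
          unfolding memp_p_power by (rule witt_lim_map_j_mem) simp
        thus "memp K (of_nat p ^ i * ?y (m + i) i)" by (rule memp.Q_mono) (use i in simp)
      qed
      finally show ?thesis .
    qed
    ultimately have "memp K ((hat u m 0 - N.psum ?y m L) + (N.psum ?y m L - N.psum ?y m K))"
      by (rule memp.Q_add)
    thus ?thesis by simp
  qed
  show ?thesis
  proof (rule memp.congruent_of_ghost_sum[OF _ _ k])
    fix i assume i: "i \<le> n"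
    have "N.eqv (ghost_sum p (hat u n) i - ghost_sum p (?y n) i) (hat u (n - i) 0 - N.psum ?y (n - i) (Suc i))"
      by (intro N.eqv_diff N.xfam_ghost N.ghost_sum_yfam u yfam i)
    from memp_cong[OF this[unfolded eqv_iff]] tail[of "Suc i" "n - i"]
    show "memp (Suc i) (ghost_sum p (hat u n) i - ghost_sum p (?y n) i)" by blast
    show "memp 0 (?y n i)" using witt_lim_map_j_mem[OF i] by simp
  qed
qed

end

lemma witt_F_A:
  assumes "u \<in> {..Suc n} \<rightarrow>\<^sub>E carrier A"
  shows "witt_F p A n u = witt_F p R n u"
  unfolding witt_F_def
proof (rule restrict_ext)
  fix k assume k: "k \<in> {..n}"
  show "zpoly_eval A u (witt_frob_poly p k) = zpoly_eval R u (witt_frob_poly p k)"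
  proof (rule zpoly_eval_hom[OF cring_A R id_hom, symmetric])
    fix v assume "v \<in> zpoly_vars (witt_frob_poly p k)"
    hence "v \<le> Suc n" using vars_frob[of v k] k by simp
    thus "u v \<in> carrier A" using PiE_mem[OF assms, of v] by simp
  qed
qed

lemma witt_lim_A_iff:
  "u \<in> carrier (witt_lim p A) \<longleftrightarrow> u \<in> carrier (witt_lim p R) \<and> (\<forall>n. u n \<in> {..n} \<rightarrow>\<^sub>E carrier A)"
proof (cases "\<forall>n. u n \<in> {..n} \<rightarrow>\<^sub>E carrier A")
  case True
  have "{..n} \<rightarrow>\<^sub>E carrier A \<subseteq> {..n} \<rightarrow>\<^sub>E carrier R" for n :: nat
    by (rule PiE_mono) (rule A_sub)
  hence "u n \<in> {..n} \<rightarrow>\<^sub>E carrier R" for n using True by blast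
  moreover have "witt_F p A n (u (Suc n)) = witt_F p R n (u (Suc n))" for n
    by (rule witt_F_A) (use True in blast)
  ultimately show ?thesis using True by (simp add: witt_lim_def witt_def)
next
  case False
  thus ?thesis by (auto simp: witt_lim_def witt_def)
qed

text \<open>
  If \<open>u\<close> and \<open>v\<close> are congruent modulo \<open>p\<close>, then the ghost components of index \<open>n\<close> of \<open>u\<^sub>m\<^sub>+\<^sub>n\<close> and \<open>v\<^sub>m\<^sub>+\<^sub>n\<close> are
  congruent modulo \<open>p\<^sup>n\<^sup>+\<^sup>1\<close>. They are the first components of \<open>u\<^sub>m\<close> and \<open>v\<^sub>m\<close>, for all \<open>n\<close>.
\<close>

lemma inj_red: "inj_on (witt_lim_map red) (carrier (witt_lim p A))"
proof (rule inj_onI)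
  fix u v assume u: "u \<in> carrier (witt_lim p A)" and v: "v \<in> carrier (witt_lim p A)"
    and eq: "witt_lim_map red u = witt_lim_map red v"
  have uA: "u n \<in> {..n} \<rightarrow>\<^sub>E carrier A" "v n \<in> {..n} \<rightarrow>\<^sub>E carrier A" for n
    using u v by (auto simp: witt_lim_A_iff)
  have ux: "N.xfam (hat u)" "N.xfam (hat v)" using u v by (auto simp: witt_lim_A_iff witt_lim_R_iff)
  have uk: "u n k \<in> carrier A" "v n k \<in> carrier A" if "k \<le> n" for n k
    using PiE_mem[OF uA(1)[of n], of k] PiE_mem[OF uA(2)[of n], of k] that by auto
  have mem: "mem (hat u n k)" "mem (hat v n k)" if "k \<le> n" for n k
    using uk[OF that] A_sub by (auto simp: mem_def subset_iff)
  have cong: "memp 1 (hat u n k - hat v n k)" if "k \<le> n" for n k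
  proof -
    have "red (u n k) = red (v n k)"
      using fun_cong[OF fun_cong[OF eq, of n], of k] that by (simp add: witt_lim_map_def)
    thus ?thesis using red_eq_iff' uk[OF that] by blast
  qed
  have first: "N.eqv (hat u m 0) (hat v m 0)" for m
  proof -
    have "N (hat u m 0 - hat v m 0) \<le> 1 / real p ^ Suc n" for n
    proof (rule N_memp)
      have "memp (Suc n) (ghost_sum p (hat u (m + n)) n - ghost_sum p (hat v (m + n)) n)"
        by (rule memp.ghost_sum_congruent) (use cong mem in auto)
      moreover have "N.eqv (ghost_sum p (hat u (m + n)) n - ghost_sum p (hat v (m + n)) n) (hat u m 0 - hat v m 0)"
        using N.eqv_diff[OF N.xfam_ghost[OF ux(1), of n "m + n"] N.xfam_ghost[OF ux(2), of n "m + n"]] by simp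
      ultimately show "memp (Suc n) (hat u m 0 - hat v m 0)" unfolding eqv_iff using memp_cong by blast
    qed
    hence "N (hat u m 0 - hat v m 0) \<le> 0"
      by (intro LIMSEQ_le_const[OF N.p_power_tendsto_0]) auto
    thus ?thesis by (simp add: N.eqv_def N.N_le_0)
  qed
  show "u = v"
  proof (intro ext)
    fix n k
    show "u n k = v n k"
    proof (cases "k \<le> n")
      case True
      have "N.eqv (hat u n k) (hat v n k)"
      proof (rule N.eqv_of_ghost_sum[OF _ True])
        fix i assume i: "i \<le> n"
        show "N.eqv (ghost_sum p (hat u n) i) (ghost_sum p (hat v n) i)"
          by (rule N.eqv_trans[OF N.xfam_ghost[OF ux(1) i] N.eqv_trans[OF first N.eqv_sym[OF N.xfam_ghost[OF ux(2) i]]]])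
      qed
      thus ?thesis using uk[OF True] A_sub by (simp add: eqv_iff subset_iff)
    next
      case False
      thus ?thesis using PiE_arb[OF uA(1)[of n], of k] PiE_arb[OF uA(2)[of n], of k] by simp
    qed
  qed
qed

text \<open>
  The corresponding element is congruent modulo \<open>p\<close> to the image of \<open>x\<close>, hence it has entries in \<open>A\<close>. By
  injectivity of reduction, no other element of the inverse limit over \<open>A\<close> has the same reduction.
\<close>

lemma corr_iso:
  assumes x: "x \<in> carrier (witt_lim p A')" and corr: "corr (witt_lim_map j x) u"
  shows "witt_lim_iso p A x = u"
proof -
  have uR: "u n \<in> {..n} \<rightarrow>\<^sub>E carrier R" for n using corr by (simp add: corr_def witt_lim_R_iff)
  have cong: "memp 1 (hat u n k - sharp (witt_lim_map j x) n k)" if "k \<le> n" for n k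
    by (rule corr_integral[OF x corr that])
  have mem_u: "mem (hat u n k)" if "k \<le> n" for n k
    using mem_add[OF memp.Q_mono[OF cong[OF that], of 0, simplified] witt_lim_map_j_mem[OF x that]] by simp
  have uk: "u n k \<in> carrier A" if "k \<le> n" for n k
    using mem_u[OF that] PiE_mem[OF uR[of n], of k] that by (simp add: mem_def)
  have "u n \<in> {..n} \<rightarrow>\<^sub>E carrier A" for n
    using uk uR[of n] by (auto simp: PiE_iff)
  hence u: "u \<in> carrier (witt_lim p A)" using corr by (simp add: witt_lim_A_iff corr_def)
  have "witt_lim_map red u = witt_lim_map (\<lambda>y. y 0) x"
  proof -
    have "red (u n k) = x n k 0" if k: "k \<le> n" for n k
    proof -
      have "j (x n k) 0 \<in> carrier A" by (rule SA_A[OF j_SA[OF x k]])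
      moreover have "memp 1 (X (u n k) - X (j (x n k) 0))" using cong[OF k] k by (simp add: witt_lim_map_def)
      ultimately have "red (u n k) = red (j (x n k) 0)" using red_eq_iff' uk[OF k] by blast
      also have "\<dots> = x n k 0"
        using fun_cong[OF rdc_j[OF A'_closed[OF x k]], of 0] by (simp add: rdc_def)
      finally show ?thesis .
    qed
    thus ?thesis by (auto simp: witt_lim_map_def fun_eq_iff)
  qed
  thus ?thesis
    unfolding witt_lim_iso_def using inv_into_f_f[OF inj_red u] by simp
qed

lemma witt_lim_map_op:
  assumes x: "x \<in> carrier (witt_lim p A')" "y \<in> carrier (witt_lim p A')"
    and vars: "\<And>k v. v \<in> zpoly_vars (P k) \<Longrightarrow> v \<in> {..k} <+> {..k}"
  shows "witt_lim_map j (\<lambda>n. \<lambda>k\<in>{..n}. zpoly_eval A' (case_sum (x n) (y n)) (P k)) =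
    (\<lambda>n. \<lambda>k\<in>{..n}. zpoly_eval R' (case_sum (witt_lim_map j x n) (witt_lim_map j y n)) (P k))"
proof -
  have "j (zpoly_eval A' (case_sum (x n) (y n)) (P k)) =
      zpoly_eval R' (case_sum (witt_lim_map j x n) (witt_lim_map j y n)) (P k)" if k: "k \<le> n" for n k
  proof -
    have c: "case_sum (x n) (y n) v \<in> carrier A'" if "v \<in> zpoly_vars (P k)" for v
      using vars[OF that] k A'_closed[OF x(1), of _ n] A'_closed[OF x(2), of _ n] by auto
    have "j (zpoly_eval A' (case_sum (x n) (y n)) (P k)) = zpoly_eval R' (\<lambda>v. j (case_sum (x n) (y n) v)) (P k)"
      by (rule zpoly_eval_hom[OF A'_cring R'_cring j_hom c, symmetric])
    also have "\<dots> = zpoly_eval R' (case_sum (witt_lim_map j x n) (witt_lim_map j y n)) (P k)"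
    proof (rule R'.zpoly_eval_cong)
      fix v assume v: "v \<in> zpoly_vars (P k)"
      show eq: "j (case_sum (x n) (y n) v) = case_sum (witt_lim_map j x n) (witt_lim_map j y n) v"
        using vars[OF v] k by (auto simp: witt_lim_map_def)
      show "case_sum (witt_lim_map j x n) (witt_lim_map j y n) v \<in> carrier R'"
        using ring_hom_closed[OF j_hom c[OF v]] by (simp add: eq)
    qed
    finally show ?thesis .
  qed
  thus ?thesis by (auto simp: witt_lim_map_def fun_eq_iff)
qed

lemma embedding:
  assumes "b > 0"
  shows "witt_lim_map j \<in> ring_hom (witt_lim p A') (witt_lim_b p b R' nu')"
    and "inj_on (witt_lim_map j) (carrier (witt_lim p A'))"
proof -
  interpret A': cring A' by (rule A'_cring)
  interpret j: ring_hom_cring A' R' j by unfold_locales (rule j_hom)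
  have ops: "x \<otimes>\<^bsub>witt_lim p S\<^esub> y = (\<lambda>n. \<lambda>k\<in>{..n}. zpoly_eval S (case_sum (x n) (y n)) (witt_mult_poly p k))"
    "x \<oplus>\<^bsub>witt_lim p S\<^esub> y = (\<lambda>n. \<lambda>k\<in>{..n}. zpoly_eval S (case_sum (x n) (y n)) (witt_add_poly p k))"
    for S :: "('c, 'd) ring_scheme" and x y
    by (simp_all add: witt_lim_def witt_def)
  have ops': "mult (witt_lim_b p b R' nu') = mult (witt_lim p R')" "add (witt_lim_b p b R' nu') = add (witt_lim p R')"
    by (simp_all add: witt_lim_b_def)
  show "witt_lim_map j \<in> ring_hom (witt_lim p A') (witt_lim_b p b R' nu')"
  proof (rule ring_hom_memI)
    fix x y assume xy: "x \<in> carrier (witt_lim p A')" "y \<in> carrier (witt_lim p A')"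
    show "witt_lim_map j x \<in> carrier (witt_lim_b p b R' nu')" by (rule witt_lim_map_j_b[OF xy(1) assms])
    show "witt_lim_map j (x \<otimes>\<^bsub>witt_lim p A'\<^esub> y) = witt_lim_map j x \<otimes>\<^bsub>witt_lim_b p b R' nu'\<^esub> witt_lim_map j y"
      unfolding ops' ops by (rule witt_lim_map_op[OF xy vars_add_mult(2)])
    show "witt_lim_map j (x \<oplus>\<^bsub>witt_lim p A'\<^esub> y) = witt_lim_map j x \<oplus>\<^bsub>witt_lim_b p b R' nu'\<^esub> witt_lim_map j y"
      unfolding ops' ops by (rule witt_lim_map_op[OF xy vars_add_mult(1)])
  next
    show "witt_lim_map j \<one>\<^bsub>witt_lim p A'\<^esub> = \<one>\<^bsub>witt_lim_b p b R' nu'\<^esub>"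
      using j.hom_one j.hom_zero by (auto simp: witt_lim_map_def witt_lim_b_def witt_lim_def witt_def fun_eq_iff)
  qed
  show "inj_on (witt_lim_map j) (carrier (witt_lim p A'))"
  proof (rule inj_onI, intro ext)
    fix x y n k m assume x: "x \<in> carrier (witt_lim p A')" and y: "y \<in> carrier (witt_lim p A')"
      and eq: "witt_lim_map j x = witt_lim_map j y"
    have "x n k = y n k"
    proof (cases "k \<le> n")
      case True
      hence "j (x n k) = j (y n k)"
        using fun_cong[OF fun_cong[OF eq, of n], of k] by (simp add: witt_lim_map_def)
      hence "rdc (j (x n k)) = rdc (j (y n k))" by (rule arg_cong)
      thus ?thesis unfolding rdc_j[OF A'_closed[OF x True]] rdc_j[OF A'_closed[OF y True]] .
    next
      case False
      have "x n \<in> {..n} \<rightarrow>\<^sub>E carrier A'" "y n \<in> {..n} \<rightarrow>\<^sub>E carrier A'"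
        using x y by (simp_all add: witt_lim_def witt_def)
      from this[THEN PiE_arb, of k] False show ?thesis by simp
    qed
    thus "x n k m = y n k m" by simp
  qed
qed

subsection \<open>The isomorphism\<close>

definition Phi :: "(nat \<Rightarrow> nat \<Rightarrow> nat \<Rightarrow> 'a) \<Rightarrow> (nat \<Rightarrow> nat \<Rightarrow> 'a)" where
  "Phi z = (THE x. corr z x)"

lemma Phi_eq: "corr z x \<Longrightarrow> Phi z = x"
  unfolding Phi_def using corr_unique by blast

text \<open>
  The bounds in \<open>corr_bound\<close> and \<open>corr_surj\<close> say that neither \<open>Phi\<close> nor its inverse increases the seminorm.
\<close>

lemma Phi_iso:
  assumes b: "0 < b" "b \<le> 1"
  shows "Phi \<in> ring_iso (witt_lim_b p b R' nu') (witt_lim_b p b R nu)"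
    and "z \<in> carrier (witt_lim_b p b R' nu') \<Longrightarrow> witt_lim_norm p b nu (Phi z) = witt_lim_norm p b nu' z"
proof -
  have corr: "corr z (Phi z)" if "z \<in> carrier (witt_lim_b p b R' nu')" for z
    using corr_exists[OF b that] Phi_eq by auto
  have ops: "mult (witt_lim_b p b S \<mu>) = mult (witt_lim p S)" "add (witt_lim_b p b S \<mu>) = add (witt_lim p S)"
    "one (witt_lim_b p b S \<mu>) = one (witt_lim p S)"
    for S :: "('c, 'd) ring_scheme" and \<mu>
    by (simp_all add: witt_lim_b_def)
  have inj: "inj_on Phi (carrier (witt_lim_b p b R' nu'))"
    by (rule inj_onI) (use corr corr_inj[OF b] in metis)
  have surj: "x \<in> Phi ` carrier (witt_lim_b p b R' nu')" if "x \<in> carrier (witt_lim_b p b R nu)" for x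
    using corr_surj[OF b that] Phi_eq by blast
  show "Phi \<in> ring_iso (witt_lim_b p b R' nu') (witt_lim_b p b R nu)"
  proof (rule ring_iso_memI)
    show "bij_betw Phi (carrier (witt_lim_b p b R' nu')) (carrier (witt_lim_b p b R nu))"
      unfolding bij_betw_def using inj surj corr_bound(1)[OF b _ corr] by blast
  qed (use corr_bound(1)[OF b _ corr] Phi_eq[OF corr_mult[OF b]] Phi_eq[OF corr_add[OF b]] corr Phi_eq[OF corr_one]
      in \<open>auto simp: ops\<close>)
  assume z: "z \<in> carrier (witt_lim_b p b R' nu')"
  have x: "Phi z \<in> carrier (witt_lim_b p b R nu)" by (rule corr_bound(1)[OF b z corr[OF z]])
  have bdd: "bdd_above (range f)" if "f \<longlonglongrightarrow> 0" for f :: "nat \<Rightarrow> real"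
    using that by (intro Bseq_bdd_above convergent_imp_Bseq) (auto simp: convergent_def)
  have bdd_z: "bdd_above (range (witt_lim_term p b nu' z))"
    by (rule bdd) (use z in \<open>simp add: witt_lim_b_def\<close>)
  have bdd_x: "bdd_above (range (witt_lim_term p b nu (Phi z)))"
    by (rule bdd) (use x in \<open>simp add: witt_lim_b_def\<close>)
  obtain z0 where z0: "z0 \<in> carrier (witt_lim_b p b R' nu')" "corr z0 (Phi z)"
    "\<forall>M n. (\<forall>l. witt_lim_term p b nu (Phi z) l \<le> M) \<longrightarrow> witt_lim_term p b nu' z0 n \<le> M"
    using corr_surj[OF b x] by blast
  have "z0 = z" by (rule corr_inj[OF b z0(1) z z0(2) corr[OF z]])
  show "witt_lim_norm p b nu (Phi z) = witt_lim_norm p b nu' z"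
    unfolding witt_lim_norm_def
  proof (rule antisym)
    show "(SUP n. witt_lim_term p b nu (Phi z) n) \<le> (SUP n. witt_lim_term p b nu' z n)"
      by (rule cSUP_least) (use corr_bound(2)[OF b z corr[OF z]] cSUP_upper[OF UNIV_I bdd_z] in auto)
    show "(SUP n. witt_lim_term p b nu' z n) \<le> (SUP n. witt_lim_term p b nu (Phi z) n)"
      by (rule cSUP_least) (use z0(3) \<open>z0 = z\<close> cSUP_upper[OF UNIV_I bdd_x] in auto)
  qed
qed

end

theorem theorem6p7:
  fixes p :: nat
    and A R :: "('a, 'm) ring_scheme"
    and \<nu> :: "'a \<Rightarrow> real"
    and R' :: "(nat \<Rightarrow> 'a) ring"
    and \<nu>' :: "(nat \<Rightarrow> 'a) \<Rightarrow> real"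
    and A' :: "(nat \<Rightarrow> 'a set) ring"
    and j :: "(nat \<Rightarrow> 'a set) \<Rightarrow> (nat \<Rightarrow> 'a)"
  defines "\<nu> \<equiv> p_adic_seminorm p A R"
    and "A' \<equiv> A_prime p A"
    and "R' \<equiv> R_prime p R \<nu>"
    and "\<nu>' \<equiv> R_prime_norm \<nu>"
    and "j \<equiv> A_prime_to_R_prime p A R"
  assumes "Factorial_Ring.prime p"
    and "cring A"
    and "is_inverting_p p A R"
    and "p_normal p A R"
    and "witt_perfect p A"
    and "p_adically_complete p A"
  shows "(\<forall>b>0.
            witt_lim_map j \<in> ring_hom (witt_lim p A') (witt_lim_b p b R' \<nu>') \<and>
            inj_on (witt_lim_map j) (carrier (witt_lim p A'))) \<and>
         (\<forall>b. 0 < b \<and> b \<le> 1 \<longrightarrow>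
            (\<exists>\<Phi> \<in> ring_iso (witt_lim_b p b R' \<nu>') (witt_lim_b p b R \<nu>).
               (\<forall>x \<in> carrier (witt_lim p A'). \<Phi> (witt_lim_map j x) = witt_lim_iso p A x) \<and>
               (\<forall>x \<in> carrier (witt_lim_b p b R' \<nu>').
                  witt_lim_norm p b \<nu> (\<Phi> x) = witt_lim_norm p b \<nu>' x)))"
proof -
  interpret complete_p_normal p A R
    by (rule complete_p_normal.intro) fact+
  show ?thesis
    unfolding \<nu>_def A'_def R'_def \<nu>'_def j_def
  proof (intro conjI allI impI)
    fix b :: real assume "b > 0"
    thus "witt_lim_map (A_prime_to_R_prime p A R) \<in> ring_hom (witt_lim p (A_prime p A))
        (witt_lim_b p b (R_prime p R (p_adic_seminorm p A R)) (R_prime_norm (p_adic_seminorm p A R)))"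
      and "inj_on (witt_lim_map (A_prime_to_R_prime p A R)) (carrier (witt_lim p (A_prime p A)))"
      by (rule embedding)+
  next
    fix b :: real assume "0 < b \<and> b \<le> 1"
    hence b: "0 < b" "b \<le> 1" by auto
    have "Phi (witt_lim_map (A_prime_to_R_prime p A R) x) = witt_lim_iso p A x"
      if x: "x \<in> carrier (witt_lim p (A_prime p A))" for x
    proof -
      obtain u where u: "corr (witt_lim_map (A_prime_to_R_prime p A R) x) u"
        using corr_exists[OF b witt_lim_map_j_b[OF x b(1)]] by blast
      show ?thesis using Phi_eq[OF u] corr_iso[OF x u] by simp
    qed
    with Phi_iso[OF b] show "\<exists>\<Phi>\<in>ring_iso
         (witt_lim_b p b (R_prime p R (p_adic_seminorm p A R)) (R_prime_norm (p_adic_seminorm p A R)))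
         (witt_lim_b p b R (p_adic_seminorm p A R)).
        (\<forall>x\<in>carrier (witt_lim p (A_prime p A)).
            \<Phi> (witt_lim_map (A_prime_to_R_prime p A R) x) = witt_lim_iso p A x) \<and>
        (\<forall>x\<in>carrier (witt_lim_b p b (R_prime p R (p_adic_seminorm p A R)) (R_prime_norm (p_adic_seminorm p A R))).
            witt_lim_norm p b (p_adic_seminorm p A R) (\<Phi> x) =
            witt_lim_norm p b (R_prime_norm (p_adic_seminorm p A R)) x)"
      by (intro bexI[of _ Phi] conjI ballI) auto
  qed
qed

end
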